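(* Fix an integer $n\ge 3$. For an integer $l\ge 0$, define $M_l:=\left\{m\in\mathbb N:\frac{nl}{l+1}<m<\frac{n(l+1)}{l+2}\right\}$, where $\mathbb N=\{1,2,3,\dots\}$. If $M_l$ is empty, then $\mathrm{Dgm}_{2l+1}^{\mathfrak D}(G_n)$ is trivial. Otherwise, $$\mathrm{Dgm}_{2l+1}^{\mathfrak D}(G_n)=\left\{\left(a_l,\left\lceil\tfrac{n(l+1)}{l+2}\right\rceil\right)\right\},\qquad a_l:=\min M_l,$$ where the point has multiplicity $1$.
   Context: The cycle network $G_n=(X_n,\omega_{G_n})$ has node set $X_n=\{x_1,\dots,x_n\}$, and $\omega_{G_n}(x,x')$ is the shortest (directed) path distance in the directed graph with edges $(x_1,x_2),(x_2,x_3),\dots,(x_{n-1},x_n),(x_n,x_1)$, each of weight $1$ (so $\omega_{G_n}(x_i,x_j)$ is the representative of $j-i$ modulo $n$ in $\{0,\dots,n-1\}$). For a finite set $X$ with weight function $\omega_X:X\times X\to\mathbb R$ and $\delta\in\mathbb R$, the Dowker $\delta$-sink complex $\mathfrak D^{\mathrm{si}}_{\delta,X}$ consists of all nonempty $\sigma\subseteq X$ for which there is $x'\in X$ with $\omega_X(x,x')\le\delta$ for all $x\in\sigma$; these form a filtration in $\delta$. Fix a field $\mathbb K$. $\mathrm{Dgm}_k^{\mathfrak D}(X)$, the $k$-dimensional Dowker persistence diagram, is the persistence diagram of the persistence vector space obtained by applying $H_k(\cdot;\mathbb K)$ to this filtration (the source filtration, defined with $\omega_X(x',x)\le\delta$ instead,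 gives the same diagram), i.e. the multiset of points $(a,b)$, $a<b$, one for each interval $[a,b)$ in its decomposition into interval modules. A diagram is trivial if it has no off-diagonal points. *)

theory Defs
  imports
    "HOL-Algebra.AbelCoset"
    "HOL-Algebra.Module"
    "HOL-Library.Poly_Mapping"
    "HOL-Library.Multiset"
    "HOL-Library.Extended_Real"
begin

text \<open>
  A vector space over the field \<open>'k\<close> is given by a \<open>module\<close> record with scalars of type
  \<open>'k\<close>. The ring fields \<open>mult\<close> and \<open>one\<close> of that record play no role for modules and are left
  undefined throughout.
\<close>

section \<open>Persistence vector spaces\<close>

record ('k, 'v) persistence_space =
  space_at :: "real \<Rightarrow> ('k, 'v) module"
  transition :: "real \<Rightarrow> real \<Rightarrow> 'v \<Rightarrow> 'v"  \<comment> \<open>only relevant for \<open>s \<le> t\<close>\<close>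

definition linear_map :: "('k, 'v) module \<Rightarrow> ('k, 'w) module \<Rightarrow> ('v \<Rightarrow> 'w) \<Rightarrow> bool" where
  "linear_map M N f \<longleftrightarrow>
     f \<in> carrier M \<rightarrow> carrier N \<and>
     (\<forall>x\<in>carrier M. \<forall>y\<in>carrier M. f (x \<oplus>\<^bsub>M\<^esub> y) = f x \<oplus>\<^bsub>N\<^esub> f y) \<and>
     (\<forall>c. \<forall>x\<in>carrier M. f (c \<odot>\<^bsub>M\<^esub> x) = c \<odot>\<^bsub>N\<^esub> f x)"

definition persistence_iso ::
    "('k, 'v) persistence_space \<Rightarrow> ('k, 'w) persistence_space \<Rightarrow> (real \<Rightarrow> 'v \<Rightarrow> 'w) \<Rightarrow> bool" where
  "persistence_iso V W \<phi> \<longleftrightarrow>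
     (\<forall>t. linear_map (space_at V t) (space_at W t) (\<phi> t) \<and>
          bij_betw (\<phi> t) (carrier (space_at V t)) (carrier (space_at W t))) \<and>
     (\<forall>s t. s \<le> t \<longrightarrow> (\<forall>x\<in>carrier (space_at V s).
        \<phi> t (transition V s t x) = transition W s t (\<phi> s x)))"

definition persistence_isomorphic ::
    "('k, 'v) persistence_space \<Rightarrow> ('k, 'w) persistence_space \<Rightarrow> bool" where
  "persistence_isomorphic V W \<longleftrightarrow> (\<exists>\<phi>. persistence_iso V W \<phi>)"

text \<open>The interval module of \<open>[a, b)\<close>, where \<open>b = \<infinity>\<close> is allowed.\<close>

definition interval_module :: "real \<times> ereal \<Rightarrow> ('k::field, 'k) persistence_space" where
  "interval_module = (\<lambda>(a, b).
     \<lparr> space_at = (\<lambda>t.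
         \<lparr> carrier = (if a \<le> t \<and> ereal t < b then UNIV else {0}),
           monoid.mult = undefined, one = undefined, zero = 0, add = (+), smult = (*) \<rparr>),
       transition = (\<lambda>s t x. if a \<le> s \<and> ereal t < b then x else 0) \<rparr>)"

text \<open>The direct sum of a family indexed by \<open>I\<close>, which has to be finite.\<close>

definition direct_sum ::
    "'i set \<Rightarrow> ('i \<Rightarrow> ('k, 'v) persistence_space) \<Rightarrow> ('k, 'i \<Rightarrow> 'v) persistence_space" where
  "direct_sum I V =
     \<lparr> space_at = (\<lambda>t.
         \<lparr> carrier = (\<Pi>\<^sub>E i\<in>I. carrier (space_at (V i) t)),
           monoid.mult = undefined, one = undefined,
           zero = (\<lambda>i\<in>I. \<zero>\<^bsub>space_at (V i) t\<^esub>),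
           add = (\<lambda>f g. \<lambda>i\<in>I. f i \<oplus>\<^bsub>space_at (V i) t\<^esub> g i),
           smult = (\<lambda>c f. \<lambda>i\<in>I. c \<odot>\<^bsub>space_at (V i) t\<^esub> f i) \<rparr>),
       transition = (\<lambda>s t f. \<lambda>i\<in>I. transition (V i) s t (f i)) \<rparr>"

definition has_persistence_diagram ::
    "('k::field, 'v) persistence_space \<Rightarrow> (real \<times> ereal) multiset \<Rightarrow> bool" where
  "has_persistence_diagram V D \<longleftrightarrow>
     (\<exists>ds. mset ds = D \<and> (\<forall>(a, b)\<in>set ds. ereal a < b) \<and>
        persistence_isomorphic V (direct_sum {..<length ds} (\<lambda>i. interval_module (ds ! i))))"

definition persistence_diagram ::
    "('k::field, 'v) persistence_space \<Rightarrow> (real \<times> ereal) multiset" where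
  "persistence_diagram V = (THE D. has_persistence_diagram V D)"


section \<open>Simplicial homology\<close>

text \<open>
  A simplicial complex is a set of finite nonempty sets of vertices. A chain is a finitely supported
  function from simplices to the field; the simplex \<open>{v\<^sub>0 < \<dots> < v\<^sub>k}\<close> stands for the oriented simplex
  \<open>[v\<^sub>0, \<dots>, v\<^sub>k]\<close>, so that the face omitting \<open>v\<close> has sign \<open>(-1)\<close> to the number of vertices below \<open>v\<close>.
  Homology is not reduced: the boundary of a vertex is \<open>0\<close>.
\<close>

definition chains :: "'a set set \<Rightarrow> nat \<Rightarrow> ('a set \<Rightarrow>\<^sub>0 'k::field) set" where
  "chains L k = {c. \<forall>\<sigma>\<in>Poly_Mapping.keys c. \<sigma> \<in> L \<and> card \<sigma> = Suc k}"

definition simplex_boundary :: "'a::linorder set \<Rightarrow> ('a set \<Rightarrow>\<^sub>0 'k::field)" where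
  "simplex_boundary \<sigma> =
     (if card \<sigma> \<le> 1 then 0
      else \<Sum>v\<in>\<sigma>. Poly_Mapping.single (\<sigma> - {v}) ((-1) ^ card {u\<in>\<sigma>. u < v}))"

definition chain_scale :: "'k::field \<Rightarrow> ('a set \<Rightarrow>\<^sub>0 'k) \<Rightarrow> ('a set \<Rightarrow>\<^sub>0 'k)" where
  "chain_scale r c = Poly_Mapping.map ((*) r) c"

definition boundary :: "('a::linorder set \<Rightarrow>\<^sub>0 'k::field) \<Rightarrow> ('a set \<Rightarrow>\<^sub>0 'k)" where
  "boundary c =
     (\<Sum>\<sigma>\<in>Poly_Mapping.keys c. chain_scale (Poly_Mapping.lookup c \<sigma>) (simplex_boundary \<sigma>))"

definition cycles :: "'a::linorder set set \<Rightarrow> nat \<Rightarrow> ('a set \<Rightarrow>\<^sub>0 'k::field) set" where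
  "cycles L k = {c \<in> chains L k. boundary c = 0}"

definition boundaries :: "'a::linorder set set \<Rightarrow> nat \<Rightarrow> ('a set \<Rightarrow>\<^sub>0 'k::field) set" where
  "boundaries L k = boundary ` chains L (Suc k)"

definition cycle_space :: "'a::linorder set set \<Rightarrow> nat \<Rightarrow> ('k::field, 'a set \<Rightarrow>\<^sub>0 'k) module" where
  "cycle_space L k =
     \<lparr> carrier = cycles L k, monoid.mult = undefined, one = undefined,
       zero = 0, add = (+), smult = chain_scale \<rparr>"

definition quotient_module :: "('k, 'v) module \<Rightarrow> 'v set \<Rightarrow> ('k, 'v set) module" where
  "quotient_module M B =
     \<lparr> carrier = a_rcosets\<^bsub>M\<^esub> B, monoid.mult = undefined, one = undefined,
       zero = B, add = set_add M,
       smult = (\<lambda>c A. \<Union>x\<in>A. B +>\<^bsub>M\<^esub> (c \<odot>\<^bsub>M\<^esub> x)) \<rparr>"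

definition homology ::
    "'a::linorder set set \<Rightarrow> nat \<Rightarrow> ('k::field, ('a set \<Rightarrow>\<^sub>0 'k) set) module" where
  "homology L k = quotient_module (cycle_space L k) (boundaries L k)"

text \<open>
  The map on homology induced by an inclusion \<open>L \<subseteq> L'\<close> sends the class of \<open>z\<close> in \<open>L\<close> to the class of
  \<open>z\<close> in \<open>L'\<close>; as the latter is the same for all representatives \<open>z\<close>, it is written as a union.
\<close>

definition homology_inclusion ::
    "'a::linorder set set \<Rightarrow> nat \<Rightarrow> ('a set \<Rightarrow>\<^sub>0 'k::field) set \<Rightarrow> ('a set \<Rightarrow>\<^sub>0 'k) set" where
  "homology_inclusion L' k A = (\<Union>z\<in>A. boundaries L' k +>\<^bsub>cycle_space L' k\<^esub> z)"

definition persistent_homology ::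
    "(real \<Rightarrow> 'a::linorder set set) \<Rightarrow> nat \<Rightarrow> ('k::field, ('a set \<Rightarrow>\<^sub>0 'k) set) persistence_space" where
  "persistent_homology F k =
     \<lparr> space_at = (\<lambda>t. homology (F t) k),
       transition = (\<lambda>s t. homology_inclusion (F t) k) \<rparr>"


section \<open>Dowker persistence diagrams\<close>

definition dowker_sink :: "'a set \<Rightarrow> ('a \<Rightarrow> 'a \<Rightarrow> real) \<Rightarrow> real \<Rightarrow> 'a set set" where
  "dowker_sink X \<omega> \<delta> = {\<sigma>. \<sigma> \<noteq> {} \<and> \<sigma> \<subseteq> X \<and> (\<exists>x'\<in>X. \<forall>x\<in>\<sigma>. \<omega> x x' \<le> \<delta>)}"

definition dowker_persistence ::
    "nat \<Rightarrow> 'a::linorder set \<Rightarrow> ('a \<Rightarrow> 'a \<Rightarrow> real)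
      \<Rightarrow> ('k::field, ('a set \<Rightarrow>\<^sub>0 'k) set) persistence_space" where
  "dowker_persistence k X \<omega> = persistent_homology (dowker_sink X \<omega>) k"

definition dowker_diagram ::
    "'k::field itself \<Rightarrow> nat \<Rightarrow> 'a::linorder set \<Rightarrow> ('a \<Rightarrow> 'a \<Rightarrow> real) \<Rightarrow> (real \<times> ereal) multiset" where
  "dowker_diagram _ k X \<omega> =
     persistence_diagram (dowker_persistence k X \<omega> :: ('k, ('a set \<Rightarrow>\<^sub>0 'k) set) persistence_space)"


section \<open>Cycle networks\<close>

text \<open>The node \<open>x\<^sub>i\<close> is represented by its index \<open>i\<close>.\<close>

definition cycle_nodes :: "nat \<Rightarrow> nat set" where
  "cycle_nodes n = {1..n}"

definition cycle_edges :: "nat \<Rightarrow> (nat \<times> nat) set" where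
  "cycle_edges n = {(i, Suc i) | i. 1 \<le> i \<and> i < n} \<union> {(n, 1)}"

text \<open>All edges have weight \<open>1\<close>, so the length of a path is its number of edges.\<close>

definition cycle_weight :: "nat \<Rightarrow> nat \<Rightarrow> nat \<Rightarrow> real" where
  "cycle_weight n i j = real (LEAST d. (i, j) \<in> cycle_edges n ^^ d)"

lemma cycle_edges_relpow:
  assumes "n \<ge> 1" "i \<in> cycle_nodes n"
  shows "(i, j) \<in> cycle_edges n ^^ d \<longleftrightarrow> j = (i - 1 + d) mod n + 1"
proof (induction d arbitrary: j)
  case 0
  then show ?case using assms by (auto simp: cycle_nodes_def)
next
  case (Suc d)
  define r where "r = (i - 1 + d) mod n"
  have r: "r < n" using assms by (simp add: r_def)
  have "(i, j) \<in> cycle_edges n ^^ Suc d \<longleftrightarrow> (r + 1, j) \<in> cycle_edges n"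
    using Suc by (auto simp: r_def relcomp_unfold)
  also have "\<dots> \<longleftrightarrow> j = (if Suc r = n then 0 else Suc r) + 1"
    using r by (auto simp: cycle_edges_def)
  also have "(if Suc r = n then 0 else Suc r) = (i - 1 + Suc d) mod n"
    by (simp add: r_def mod_Suc)
  finally show ?case .
qed

lemma cycle_weight_eq:
  assumes "i \<in> cycle_nodes n" "j \<in> cycle_nodes n"
  shows "cycle_weight n i j = real_of_int ((int j - int i) mod int n)"
proof -
  define d where "d = nat ((int j - int i) mod int n)"
  have n: "n \<ge> 1" and ij: "1 \<le> i" "i \<le> n" "1 \<le> j" "j \<le> n"
    using assms by (auto simp: cycle_nodes_def)
  have d: "int d = (int j - int i) mod int n" using n by (simp add: d_def)
  have iff: "(i, j) \<in> cycle_edges n ^^ e \<longleftrightarrow> int e mod int n = int d" for e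
  proof -
    have "(i, j) \<in> cycle_edges n ^^ e \<longleftrightarrow> (j - 1) = (i - 1 + e) mod n"
      using cycle_edges_relpow[OF n assms(1)] ij by auto
    also have "\<dots> \<longleftrightarrow> int (j - 1) = int ((i - 1 + e) mod n)"
      by (simp only: of_nat_eq_iff)
    also have "\<dots> \<longleftrightarrow> (int j - 1) mod int n = (int i - 1 + int e) mod int n"
      using ij by (simp add: zmod_int of_nat_diff add_diff_eq diff_add_eq)
    also have "\<dots> \<longleftrightarrow> int e mod int n = (int j - int i) mod int n"
      by (simp add: mod_eq_dvd_iff algebra_simps dvd_diff_commute)
    finally show ?thesis by (simp only: d)
  qed
  have "(LEAST e. (i, j) \<in> cycle_edges n ^^ e) = d"
  proof (rule Least_equality)
    show "(i, j) \<in> cycle_edges n ^^ d" using iff[of d] d by simp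
  next
    fix e assume "(i, j) \<in> cycle_edges n ^^ e"
    then have "int d = int (e mod n)" using iff by (simp add: zmod_int)
    then show "d \<le> e" by simp
  qed
  then show ?thesis by (simp add: cycle_weight_def flip: d)
qed

definition M_set :: "nat \<Rightarrow> nat \<Rightarrow> nat set" where
  "M_set n l =
     {m. 1 \<le> m \<and> real (n * l) / real (l + 1) < real m \<and> real m < real (n * (l + 1)) / real (l + 2)}"

end

theory Submission
  imports Defs
begin

text \<open>
  At a scale in \<open>[m, m + 1)\<close> the sink complex of the cycle network consists of the sets that miss
  \<open>p = n - 1 - m\<close> cyclically consecutive vertices, and \<open>m \<in> M_set n l\<close> means
  \<open>(p + 1) (l + 1) < n < (p + 1) (l + 2)\<close>.

  The full simplex is acyclic, so a cycle \<open>c\<close> in this complex is \<open>\<partial> d\<close> for a chain \<open>d\<close> of the full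
  simplex, and \<open>c\<close> bounds in the complex iff \<open>d\<close> can be pushed off the dense sets, those that do
  not miss \<open>p\<close> cyclically consecutive vertices. A discrete Morse matching on the dense sets has a
  critical set of size \<open>2 l + 3\<close> only if \<open>m \<in> M_set n l\<close>, and then at most one. Hence the homology
  in degree \<open>2 l + 1\<close> vanishes for all other \<open>m\<close> and is at most one-dimensional for these.

  The boundary of a cyclic polytope, that is, the signed sum of all unions of \<open>l + 1\<close> disjoint pairs of
  cyclically adjacent vertices, is a cycle \<open>z\<close> in the complex for every \<open>m \<in> M_set n l\<close>. It is
  nontrivial there because an explicit cocycle takes the value \<open>1\<close> on it. Since the same \<open>z\<close> works
  for all these \<open>m\<close>, the inclusions are isomorphisms between the corresponding homology groups.
\<close>

section \<open>Uniqueness of small persistence diagrams\<close>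

text \<open>\<open>persistence_diagram\<close> is a definite description, so uniqueness of a
  decomposition has to be shown along with its existence. Only diagrams with at most one point
  occur, and for these a comparison of one-dimensional spaces replaces the general theorem on
  interval decompositions. The size 2 l + 3 is that of the simplices in a filling d of a (2 l +
  1)-cycle. The matching acts on d twice: subtracting boundaries of larger chains removes its lower
  sets and leaves the boundary of d unchanged; then, in the absence of critical sets, no upper set
  can occur either, because the boundary of d contains no dense set. This only bounds the homology
  from above, which is why survival of z needs a cocycle of its own. The cocycle has values 0 and 1
  and is nonzero on exactly one simplex of z, so the argument is the same in every characteristic.
  The inequalities come from p + 1 = n - m: both bounds on m together become (n - m) l < m < (n - m)
  (l + 1).\<close>

definition closed_persistence :: "('k, 'v) persistence_space \<Rightarrow> bool" where
  "closed_persistence V \<longleftrightarrow>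
     (\<forall>t c. \<forall>x\<in>carrier (space_at V t). c \<odot>\<^bsub>space_at V t\<^esub> x \<in> carrier (space_at V t)) \<and>
     (\<forall>s t. s \<le> t \<longrightarrow> (\<forall>x\<in>carrier (space_at V s). transition V s t x \<in> carrier (space_at V t)))"

definition covers :: "real \<times> ereal \<Rightarrow> real \<Rightarrow> bool" where
  "covers I t \<longleftrightarrow> fst I \<le> t \<and> ereal t < snd I"

definition interval_unit :: "(real \<times> ereal) list \<Rightarrow> nat \<Rightarrow> nat \<Rightarrow> 'k::field" where
  "interval_unit ds i = (\<lambda>j\<in>{..<length ds}. if j = i then 1 else 0)"

abbreviation interval_sum :: "(real \<times> ereal) list \<Rightarrow> ('k::field, nat \<Rightarrow> 'k) persistence_space" where
  "interval_sum ds \<equiv> direct_sum {..<length ds} (\<lambda>i. interval_module (ds ! i))"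

lemma carrier_interval_sum:
  "carrier (space_at (interval_sum ds) t) =
     (\<Pi>\<^sub>E i\<in>{..<length ds}. if covers (ds ! i) t then UNIV else {0})"
  by (auto simp: direct_sum_def interval_module_def covers_def case_prod_beta)

lemma smult_interval_sum:
  "c \<odot>\<^bsub>space_at (interval_sum ds) t\<^esub> f = (\<lambda>i\<in>{..<length ds}. c * f i)"
  by (simp add: direct_sum_def interval_module_def case_prod_beta)

lemma add_interval_sum:
  "f \<oplus>\<^bsub>space_at (interval_sum ds) t\<^esub> g = (\<lambda>i\<in>{..<length ds}. f i + g i)"
  by (simp add: direct_sum_def interval_module_def case_prod_beta)

lemma transition_interval_sum:
  "transition (interval_sum ds) s t f =
     (\<lambda>i\<in>{..<length ds}. if fst (ds ! i) \<le> s \<and> ereal t < snd (ds ! i) then f i else 0)"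
  by (simp add: direct_sum_def interval_module_def case_prod_beta)

lemma interval_unit_in_carrier:
  assumes "covers (ds ! i) t"
  shows "interval_unit ds i \<in> carrier (space_at (interval_sum ds) t)"
  using assms by (auto simp: carrier_interval_sum interval_unit_def)

lemma zero_in_carrier_interval_sum:
  "(\<lambda>i\<in>{..<length ds}. 0) \<in> carrier (space_at (interval_sum ds) t)"
  by (auto simp: carrier_interval_sum)

lemma interval_unit_neq_zero:
  assumes "i < length ds"
  shows "interval_unit ds i \<noteq> (\<lambda>i\<in>{..<length ds}. 0)"
proof
  assume "interval_unit ds i = (\<lambda>i\<in>{..<length ds}. 0)"
  from fun_cong[OF this, of i] show False using assms by (simp add: interval_unit_def)
qed

text \<open>The zero vector and the unit vector of a covering interval are distinct, which is too
  much for a carrier with at most one element.\<close>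

lemma no_cover_of_trivial:
  assumes "persistence_iso V (interval_sum ds) \<phi>"
    and "carrier (space_at V t) \<subseteq> {x}" and "i < length ds"
  shows "\<not> covers (ds ! i) t"
proof
  assume cov: "covers (ds ! i) t"
  have b: "bij_betw (\<phi> t) (carrier (space_at V t)) (carrier (space_at (interval_sum ds) t))"
    using assms(1) by (simp add: persistence_iso_def)
  then have "carrier (space_at (interval_sum ds) t) \<subseteq> {\<phi> t x}"
    using assms(2) by (auto simp: bij_betw_def)
  then have e: "interval_unit ds i = \<phi> t x" "(\<lambda>i\<in>{..<length ds}. 0) = \<phi> t x"
    using interval_unit_in_carrier[OF cov] zero_in_carrier_interval_sum[of ds t] by blast+
  show False
    by (rule notE[OF interval_unit_neq_zero[OF assms(3)] trans[OF e(1) e(2)[symmetric]]])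
qed

lemma diagram_empty_unique:
  assumes "has_persistence_diagram V D" and "\<And>t. \<exists>x. carrier (space_at V t) \<subseteq> {x}"
  shows "D = {#}"
proof -
  obtain ds \<phi> where ds: "mset ds = D" "\<forall>(a, b)\<in>set ds. ereal a < b"
    and iso: "persistence_iso V (interval_sum ds) \<phi>"
    using assms(1) by (auto simp: has_persistence_diagram_def persistence_isomorphic_def)
  have "ds = []"
  proof (rule ccontr)
    assume "ds \<noteq> []"
    then have l: "0 < length ds" by simp
    have "ds ! 0 \<in> set ds" using l by (rule nth_mem)
    then have "covers (ds ! 0) (fst (ds ! 0))"
      using ds(2) by (auto simp: covers_def case_prod_beta)
    moreover obtain x where "carrier (space_at V (fst (ds ! 0))) \<subseteq> {x}" using assms(2) by blast
    ultimately show False using no_cover_of_trivial[OF iso _ l] by blast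
  qed
  then show ?thesis using ds(1) by simp
qed

lemma ex_preimage:
  assumes "persistence_iso V W \<phi>" and "w \<in> carrier (space_at W t)"
  obtains x where "x \<in> carrier (space_at V t)" "\<phi> t x = w"
proof -
  have "\<phi> t ` carrier (space_at V t) = carrier (space_at W t)"
    using assms(1) by (simp add: persistence_iso_def bij_betw_def)
  then have "w \<in> \<phi> t ` carrier (space_at V t)" using assms(2) by simp
  then show ?thesis using that by blast
qed

lemma iso_inj:
  assumes "persistence_iso V W \<phi>" and "x \<in> carrier (space_at V t)" "y \<in> carrier (space_at V t)"
    and "\<phi> t x = \<phi> t y"
  shows "x = y"
  using assms by (auto simp: persistence_iso_def bij_betw_def inj_on_def)

lemma iso_smult:
  assumes "persistence_iso V W \<phi>" and "x \<in> carrier (space_at V t)"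
  shows "\<phi> t (c \<odot>\<^bsub>space_at V t\<^esub> x) = c \<odot>\<^bsub>space_at W t\<^esub> \<phi> t x"
  using assms by (auto simp: persistence_iso_def linear_map_def)

lemma iso_transition:
  assumes "persistence_iso V W \<phi>" and "s \<le> t" and "x \<in> carrier (space_at V s)"
  shows "\<phi> t (transition V s t x) = transition W s t (\<phi> s x)"
  using assms by (auto simp: persistence_iso_def)

lemma iso_carrier:
  assumes "persistence_iso V W \<phi>" and "x \<in> carrier (space_at V t)"
  shows "\<phi> t x \<in> carrier (space_at W t)"
  using assms by (auto simp: persistence_iso_def bij_betw_def)

lemma iso_trivial:
  assumes "persistence_iso V W \<phi>" and "carrier (space_at W t) \<subseteq> {w}"
    and "x \<in> carrier (space_at V t)"
  shows "carrier (space_at V t) \<subseteq> {x}"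
proof
  fix y assume y: "y \<in> carrier (space_at V t)"
  then have "\<phi> t y = \<phi> t x" using iso_carrier[OF assms(1)] assms(2,3) by blast
  then show "y \<in> {x}" using iso_inj[OF assms(1) y assms(3)] by simp
qed

text \<open>V has dimension 1 inside I and 0 outside, and its transitions inside I are injective. So
  the intervals of the other decomposition stay inside I, never overlap, cover I, and do not end
  while I lasts. The one that covers the left end of I is then all of I and leaves no room for a
  second one.\<close>

lemma diagram_singleton_unique:
  fixes V :: "('k::field, 'v) persistence_space"
  assumes cl: "closed_persistence V"
    and D: "has_persistence_diagram V D"
    and E: "has_persistence_diagram V {#I#}"
  shows "D = {#I#}"
proof -
  obtain ds \<phi> where ds: "mset ds = D" "\<forall>(a, b)\<in>set ds. ereal a < b"
    and iso: "persistence_iso V (interval_sum ds) \<phi>"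
    using D by (auto simp: has_persistence_diagram_def persistence_isomorphic_def)
  obtain es \<psi> where es: "mset es = {#I#}" "\<forall>(a, b)\<in>set es. ereal a < b"
    and jso0: "persistence_iso V (interval_sum es) \<psi>"
    using E by (auto simp: has_persistence_diagram_def persistence_isomorphic_def)
  have esI: "es = [I]" using es(1) by simp
  have jso: "persistence_iso V (interval_sum [I]) \<psi>" using jso0 by (simp add: esI)
  have I: "ereal (fst I) < snd I" using es(2) by (simp add: esI case_prod_beta)
  \<comment> \<open>The isomorphisms are injective on carriers only, so multiples and images under
    transitions have to be known to stay in the carriers before they can be compared.\<close>
  have smult_closed: "c \<odot>\<^bsub>space_at V t\<^esub> x \<in> carrier (space_at V t)"
    if "x \<in> carrier (space_at V t)" for c t x
    using cl that by (auto simp: closed_persistence_def)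
  have trans_closed: "transition V s t x \<in> carrier (space_at V t)"
    if "x \<in> carrier (space_at V s)" "s \<le> t" for s t x
    using cl that by (auto simp: closed_persistence_def)
  have cov_self: "covers (ds ! i) (fst (ds ! i))" if "i < length ds" for i
    using ds(2) nth_mem[OF that] by (auto simp: covers_def case_prod_beta)

  have outside: "covers I t" if i: "i < length ds" and cov: "covers (ds ! i) t" for i t
  proof (rule ccontr)
    assume n: "\<not> covers I t"
    then have c: "carrier (space_at (interval_sum [I]) t) = {\<lambda>i\<in>{..<1}. 0 :: 'k}"
      unfolding carrier_interval_sum by (auto simp: PiE_def Pi_def extensional_def fun_eq_iff)
    obtain x where x: "x \<in> carrier (space_at V t)" "\<phi> t x = interval_unit ds i"
      using ex_preimage[OF iso interval_unit_in_carrier[OF cov]] by blast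
    have "carrier (space_at V t) \<subseteq> {x}"
      using iso_trivial[OF jso _ x(1)] c by simp
    then show False using no_cover_of_trivial[OF iso _ i] cov by blast
  qed

  \<comment> \<open>V is a bare record without vector space axioms; \<open>0 \<odot> x\<close>
    serves as its zero vector, since both isomorphisms send it to zero.\<close>
  have unit_not_zero: "x \<noteq> 0 \<odot>\<^bsub>space_at V t\<^esub> x"
    if "i < length ds" "x \<in> carrier (space_at V t)" "\<phi> t x = interval_unit ds i" for i t x
  proof
    assume "x = 0 \<odot>\<^bsub>space_at V t\<^esub> x"
    then have "interval_unit ds i = (0::'k) \<odot>\<^bsub>space_at (interval_sum ds) t\<^esub> interval_unit ds i"
      using iso_smult[OF iso that(2), of 0] that(3) by simp
    then have "interval_unit ds i = (\<lambda>i\<in>{..<length ds}. 0 :: 'k)"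
      by (simp add: smult_interval_sum)
    then show False
      using interval_unit_neq_zero[OF that(1), where ?'a = 'k] by blast
  qed

  have coord: "\<psi> t x 0 \<noteq> 0"
    if "i < length ds" "x \<in> carrier (space_at V t)" "\<phi> t x = interval_unit ds i" for i t x
  proof
    assume z: "\<psi> t x 0 = 0"
    have "\<psi> t x \<in> carrier (space_at (interval_sum [I]) t)" by (rule iso_carrier[OF jso that(2)])
    then have "\<psi> t x = 0 \<odot>\<^bsub>space_at (interval_sum [I]) t\<^esub> \<psi> t x"
      unfolding carrier_interval_sum smult_interval_sum
      using z by (auto simp: fun_eq_iff PiE_def Pi_iff extensional_def)
    then have "\<psi> t x = \<psi> t (0 \<odot>\<^bsub>space_at V t\<^esub> x)" using iso_smult[OF jso that(2)] by simp
    then show False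
      using iso_inj[OF jso that(2) smult_closed[OF that(2)]] unit_not_zero[OF that] by blast
  qed

  have at_most_one: "i = j"
    if ij: "i < length ds" "j < length ds" "covers (ds ! i) t" "covers (ds ! j) t" for i j t
  proof (rule ccontr)
    assume ne: "i \<noteq> j"
    obtain x where x: "x \<in> carrier (space_at V t)" "\<phi> t x = interval_unit ds i"
      using ex_preimage[OF iso interval_unit_in_carrier[OF ij(3)]] by blast
    obtain y where y: "y \<in> carrier (space_at V t)" "\<phi> t y = interval_unit ds j"
      using ex_preimage[OF iso interval_unit_in_carrier[OF ij(4)]] by blast
    \<comment> \<open>In a one-dimensional space two vectors satisfy the relation b x = a y with
      their own coordinates as coefficients. Read in the other decomposition, where x and y are
      different unit vectors, it forces b = 0.\<close>
    define a b where "a = \<psi> t x 0" and "b = \<psi> t y 0"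
    have "\<psi> t (b \<odot>\<^bsub>space_at V t\<^esub> x) = \<psi> t (a \<odot>\<^bsub>space_at V t\<^esub> y)"
      unfolding iso_smult[OF jso x(1)] iso_smult[OF jso y(1)] smult_interval_sum
      by (auto simp: a_def b_def fun_eq_iff restrict_def)
    then have "b \<odot>\<^bsub>space_at V t\<^esub> x = a \<odot>\<^bsub>space_at V t\<^esub> y"
      using iso_inj[OF jso] smult_closed x(1) y(1) by blast
    then have "b \<odot>\<^bsub>space_at (interval_sum ds) t\<^esub> interval_unit ds i
        = a \<odot>\<^bsub>space_at (interval_sum ds) t\<^esub> interval_unit ds j"
      using iso_smult[OF iso x(1), of b] iso_smult[OF iso y(1), of a] x(2) y(2) by simp
    from fun_cong[OF this, of i] have "b = 0"
      using ij(1) ne by (simp add: smult_interval_sum interval_unit_def)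
    then show False using coord[OF ij(2) y] by (simp add: b_def)
  qed

  have inside: "\<exists>i<length ds. covers (ds ! i) t" if "covers I t" for t
  proof (rule ccontr)
    assume n: "\<not> ?thesis"
    have c: "carrier (space_at (interval_sum ds) t) \<subseteq> {\<lambda>i\<in>{..<length ds}. 0}"
      unfolding carrier_interval_sum using n by (auto simp: PiE_def Pi_iff extensional_def fun_eq_iff)
    obtain x where x: "x \<in> carrier (space_at V t)"
      using ex_preimage[OF jso zero_in_carrier_interval_sum] by blast
    have "carrier (space_at V t) \<subseteq> {x}"
      by (rule iso_trivial[OF iso c x])
    then show False using no_cover_of_trivial[OF jso, of t x 0] that by simp
  qed

  \<comment> \<open>Inside I the transition preserves the only coordinate under \<psi>, so the image
    of the unit vector is nonzero at t. An interval of \<open>ds\<close> that ended in between would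
    make it zero.\<close>
  have persist: "covers (ds ! i) t"
    if i: "i < length ds" and cov: "covers (ds ! i) s" and st: "s \<le> t" and covt: "covers I t" for i s t
  proof -
    obtain x where x: "x \<in> carrier (space_at V s)" "\<phi> s x = interval_unit ds i"
      using ex_preimage[OF iso interval_unit_in_carrier[OF cov]] by blast
    have "covers I s" by (rule outside[OF i cov])
    then have "\<psi> t (transition V s t x) 0 = \<psi> s x 0"
      using covt unfolding iso_transition[OF jso st x(1)] transition_interval_sum
      by (simp add: covers_def)
    then have nz: "\<psi> t (transition V s t x) 0 \<noteq> 0" using coord[OF i x] by simp
    show ?thesis
    proof (rule ccontr)
      assume "\<not> covers (ds ! i) t"
      then have "\<not> ereal t < snd (ds ! i)"
        using cov st by (auto simp: covers_def)
      then have "\<phi> t (transition V s t x) = (\<lambda>j\<in>{..<length ds}. 0)"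
        unfolding iso_transition[OF iso st x(1)] transition_interval_sum x(2)
        by (auto simp: interval_unit_def restrict_def fun_eq_iff)
      then have "\<phi> t (transition V s t x) = \<phi> t (0 \<odot>\<^bsub>space_at V t\<^esub> transition V s t x)"
        using iso_smult[OF iso trans_closed[OF x(1) st]]
        by (simp add: smult_interval_sum)
      then have "transition V s t x = 0 \<odot>\<^bsub>space_at V t\<^esub> transition V s t x"
        using iso_inj[OF iso] trans_closed[OF x(1) st] smult_closed by blast
      then have "\<psi> t (transition V s t x) = \<psi> t (0 \<odot>\<^bsub>space_at V t\<^esub> transition V s t x)"
        by (rule arg_cong)
      also have "\<dots> = 0 \<odot>\<^bsub>space_at (interval_sum [I]) t\<^esub> \<psi> t (transition V s t x)"
        by (rule iso_smult[OF jso trans_closed[OF x(1) st]])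
      finally have "\<psi> t (transition V s t x)
          = 0 \<odot>\<^bsub>space_at (interval_sum [I]) t\<^esub> \<psi> t (transition V s t x)" .
      from fun_cong[OF this[unfolded smult_interval_sum], of 0] show False using nz by simp
    qed
  qed

  have "covers I (fst I)" using I by (simp add: covers_def)
  then obtain i where i: "i < length ds" "covers (ds ! i) (fst I)" using inside by blast
  have iff: "covers (ds ! i) t \<longleftrightarrow> covers I t" for t
  proof
    assume "covers I t"
    then show "covers (ds ! i) t" using persist[OF i] by (simp add: covers_def)
  qed (rule outside[OF i(1)])
  have uniq: "j = i" if "j < length ds" for j
    using at_most_one[OF that i(1) cov_self[OF that]] iff outside[OF that cov_self[OF that]] by blast
  have "0 < length ds" using i(1) by linarith
  then have i0: "i = 0" using uniq[of 0] by simp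
  have "\<not> 1 < length ds" using uniq[of 1] i0 by auto
  then have len: "length ds = 1" using i(1) by linarith
  have "covers (ds ! i) (fst (ds ! i))" by (rule cov_self[OF i(1)])
  then have fst: "fst (ds ! i) = fst I"
    using iff[of "fst I"] iff[of "fst (ds ! i)"] i(2) by (auto simp: covers_def)
  \<comment> \<open>The smaller of two different right ends is a real number, and at that time only
    one of the two intervals is alive.\<close>
  have "\<not> snd (ds ! i) < snd I"
  proof
    assume l: "snd (ds ! i) < snd I"
    have "ereal (fst I) < snd (ds ! i)" using i(2) by (simp add: covers_def)
    with l obtain r where r: "snd (ds ! i) = ereal r" by (cases "snd (ds ! i)") auto
    have "covers I r" using l r \<open>ereal (fst I) < snd (ds ! i)\<close> by (simp add: covers_def)
    then show False using iff[of r] r by (simp add: covers_def)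
  qed
  moreover have "\<not> snd I < snd (ds ! i)"
  proof
    assume l: "snd I < snd (ds ! i)"
    with I obtain r where r: "snd I = ereal r" by (cases "snd I") auto
    have "covers (ds ! i) r" using l r I fst by (simp add: covers_def)
    then show False using iff[of r] r by (simp add: covers_def)
  qed
  ultimately have "ds ! i = I" using fst by (simp add: prod_eq_iff)
  then have "ds = [I]" using len i0 by (intro nth_equalityI) auto
  then show ?thesis using ds(1) by simp
qed

section \<open>Chains and boundaries\<close>

lemma lookup_chain_scale [simp]:
  "Poly_Mapping.lookup (chain_scale r c) \<sigma> = r * Poly_Mapping.lookup c \<sigma>"
  by (simp add: chain_scale_def Poly_Mapping.map.rep_eq when_def)

lemma keys_chain_scale: "Poly_Mapping.keys (chain_scale r c) \<subseteq> Poly_Mapping.keys c"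
  by (auto simp: in_keys_iff)

lemma chain_scale_simps [simp]:
  "chain_scale r 0 = 0" "chain_scale 0 c = 0" "chain_scale 1 c = c"
  "chain_scale r (chain_scale s c) = chain_scale (r * s) c"
  by (auto intro!: poly_mapping_eqI simp: mult.assoc)

lemma chain_scale_distrib:
  "chain_scale r (c + d) = chain_scale r c + chain_scale r d"
  "chain_scale r (c - d) = chain_scale r c - chain_scale r d"
  "chain_scale (r + s) c = chain_scale r c + chain_scale s c"
  "chain_scale (r - s) c = chain_scale r c - chain_scale s c"
  by (auto intro!: poly_mapping_eqI simp: lookup_add lookup_minus algebra_simps)

lemma chain_scale_single [simp]:
  "chain_scale r (Poly_Mapping.single \<sigma> s) = Poly_Mapping.single \<sigma> (r * s)"
  by (auto intro!: poly_mapping_eqI simp: lookup_single when_def)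

section \<open>Evaluation of cochains and linear extension\<close>

definition pairing :: "('a set \<Rightarrow> 'k::field) \<Rightarrow> ('a set \<Rightarrow>\<^sub>0 'k) \<Rightarrow> 'k" where
  "pairing f c = (\<Sum>\<sigma>\<in>Poly_Mapping.keys c. Poly_Mapping.lookup c \<sigma> * f \<sigma>)"

definition extend_linearly ::
    "('a set \<Rightarrow> ('a set \<Rightarrow>\<^sub>0 'k::field)) \<Rightarrow> ('a set \<Rightarrow>\<^sub>0 'k) \<Rightarrow> ('a set \<Rightarrow>\<^sub>0 'k)" where
  "extend_linearly g c =
     (\<Sum>\<sigma>\<in>Poly_Mapping.keys c. chain_scale (Poly_Mapping.lookup c \<sigma>) (g \<sigma>))"

lemma boundary_eq_extend: "boundary = extend_linearly simplex_boundary"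
  by (rule ext) (simp add: boundary_def extend_linearly_def)

lemma pairing_eq_sum:
  assumes "finite A" "Poly_Mapping.keys c \<subseteq> A"
  shows "pairing f c = (\<Sum>\<sigma>\<in>A. Poly_Mapping.lookup c \<sigma> * f \<sigma>)"
  unfolding pairing_def by (rule sum.mono_neutral_left) (use assms in \<open>auto simp: in_keys_iff\<close>)

lemma pairing_zero [simp]: "pairing f 0 = 0"
  by (simp add: pairing_def)

lemma pairing_single [simp]: "pairing f (Poly_Mapping.single \<sigma> r) = r * f \<sigma>"
  by (cases "r = 0") (simp_all add: pairing_def)

lemma pairing_add: "pairing f (c + d) = pairing f c + pairing f d"
proof -
  define A where "A = Poly_Mapping.keys c \<union> Poly_Mapping.keys d"
  have "finite A" "Poly_Mapping.keys c \<subseteq> A" "Poly_Mapping.keys d \<subseteq> A" "Poly_Mapping.keys (c + d) \<subseteq> A"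
    using keys_add[of c d] by (auto simp: A_def)
  then show ?thesis
    by (simp add: pairing_eq_sum lookup_add distrib_right sum.distrib)
qed

lemma pairing_scale: "pairing f (chain_scale r c) = r * pairing f c"
  unfolding pairing_eq_sum[OF finite_keys keys_chain_scale]
  by (simp add: pairing_def sum_distrib_left mult.assoc)

lemma pairing_diff: "pairing f (c - d) = pairing f c - pairing f d"
  using pairing_add[of f "c - d" d] by simp

lemma pairing_sum: "pairing f (sum c A) = (\<Sum>i\<in>A. pairing f (c i))"
  by (induction A rule: infinite_finite_induct) (simp_all add: pairing_add)

text \<open>Each coefficient of an extended map is the value of a cochain; linearity of all extended
  maps is thereby reduced to that of \<open>pairing\<close>.\<close>

lemma lookup_extend:
  "Poly_Mapping.lookup (extend_linearly g c) \<rho> = pairing (\<lambda>\<sigma>. Poly_Mapping.lookup (g \<sigma>) \<rho>) c"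
  by (simp add: extend_linearly_def pairing_def lookup_sum)

lemma extend_zero [simp]: "extend_linearly g 0 = 0"
  by (simp add: extend_linearly_def)

lemma extend_single [simp]:
  "extend_linearly g (Poly_Mapping.single \<sigma> r) = chain_scale r (g \<sigma>)"
  by (rule poly_mapping_eqI) (simp add: lookup_extend)

lemma extend_add: "extend_linearly g (c + d) = extend_linearly g c + extend_linearly g d"
  by (rule poly_mapping_eqI) (simp add: lookup_extend lookup_add pairing_add)

lemma extend_diff: "extend_linearly g (c - d) = extend_linearly g c - extend_linearly g d"
  by (rule poly_mapping_eqI) (simp add: lookup_extend lookup_minus pairing_diff)

lemma extend_scale: "extend_linearly g (chain_scale r c) = chain_scale r (extend_linearly g c)"
  by (rule poly_mapping_eqI) (simp add: lookup_extend pairing_scale)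

lemma extend_sum: "extend_linearly g (sum c A) = (\<Sum>i\<in>A. extend_linearly g (c i))"
  by (rule poly_mapping_eqI) (simp add: lookup_extend lookup_sum pairing_sum)

lemma pairing_extend: "pairing f (extend_linearly g c) = pairing (\<lambda>\<sigma>. pairing f (g \<sigma>)) c"
  by (simp add: extend_linearly_def pairing_sum pairing_scale) (simp add: pairing_def)

lemmas boundary_linear =
  extend_zero[of simplex_boundary, folded boundary_eq_extend]
  extend_add[of simplex_boundary, folded boundary_eq_extend]
  extend_diff[of simplex_boundary, folded boundary_eq_extend]
  extend_scale[of simplex_boundary, folded boundary_eq_extend]

lemmas boundary_sum = extend_sum[of simplex_boundary, folded boundary_eq_extend]

lemmas boundary_single = extend_single[of simplex_boundary, folded boundary_eq_extend]

lemmas lookup_boundary = lookup_extend[of simplex_boundary, folded boundary_eq_extend]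

lemmas pairing_boundary = pairing_extend[of _ simplex_boundary, folded boundary_eq_extend]

section \<open>Face signs and the square of the boundary\<close>

abbreviation face_sign :: "'a::linorder set \<Rightarrow> 'a \<Rightarrow> 'k::field" where
  "face_sign \<sigma> v \<equiv> (-1) ^ card {u\<in>\<sigma>. u < v}"

lemma pairing_simplex_boundary:
  "pairing f (simplex_boundary \<sigma>) =
     (if card \<sigma> \<le> 1 then 0 else \<Sum>v\<in>\<sigma>. face_sign \<sigma> v * f (\<sigma> - {v}))"
  by (simp add: simplex_boundary_def pairing_sum)

lemma lookup_simplex_boundary:
  "Poly_Mapping.lookup (simplex_boundary \<sigma>) \<rho> =
     (if card \<sigma> \<le> 1 then 0 else \<Sum>v\<in>\<sigma>. if \<sigma> - {v} = \<rho> then face_sign \<sigma> v else 0)"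
  by (simp add: simplex_boundary_def lookup_sum lookup_single when_def)

lemma lookup_simplex_boundary_face:
  assumes "v \<in> \<sigma>" "card \<sigma> \<ge> 2"
  shows "Poly_Mapping.lookup (simplex_boundary \<sigma>) (\<sigma> - {v}) = (face_sign \<sigma> v :: 'k::field)"
proof -
  have fin: "finite \<sigma>" using assms(2) by (metis card.infinite not_numeral_le_zero)
  have "(\<Sum>u\<in>\<sigma>. if \<sigma> - {u} = \<sigma> - {v} then face_sign \<sigma> u else 0) =
        (\<Sum>u\<in>\<sigma>. if u = v then face_sign \<sigma> v else (0::'k))"
    using assms(1) by (intro sum.cong) auto
  then show ?thesis using fin assms by (simp add: lookup_simplex_boundary)
qed

lemma lookup_simplex_boundary_insert:
  assumes "v \<notin> \<rho>" "finite \<rho>" "\<rho> \<noteq> {}"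
  shows "Poly_Mapping.lookup (simplex_boundary (insert v \<rho>)) \<rho> = (face_sign \<rho> v :: 'k::field)"
proof -
  have "{u \<in> insert v \<rho>. u < v} = {u \<in> \<rho>. u < v}" by auto
  moreover have "card (insert v \<rho>) \<ge> 2" using assms by (simp add: Suc_leI card_gt_0_iff)
  moreover have "insert v \<rho> - {v} = \<rho>" using assms(1) by auto
  ultimately show ?thesis
    using lookup_simplex_boundary_face[of v "insert v \<rho>", where ?'k = 'k] by simp
qed

lemma lookup_simplex_boundary_nonzero:
  assumes "Poly_Mapping.lookup (simplex_boundary \<sigma>) \<rho> \<noteq> (0 :: 'k::field)"
  obtains v where "v \<in> \<sigma>" "\<rho> = \<sigma> - {v}" "card \<sigma> \<ge> 2"
proof -
  have c: "\<not> card \<sigma> \<le> 1" and s: "(\<Sum>v\<in>\<sigma>. if \<sigma> - {v} = \<rho> then face_sign \<sigma> v else (0::'k)) \<noteq> 0"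
    using assms by (auto simp: lookup_simplex_boundary split: if_splits)
  from s obtain v where "v \<in> \<sigma>" "(if \<sigma> - {v} = \<rho> then face_sign \<sigma> v else (0::'k)) \<noteq> 0"
    by (rule sum.not_neutral_contains_not_neutral)
  then show ?thesis using c that[of v] by (auto split: if_splits)
qed

lemma card_less_Diff:
  fixes u v :: "'a::linorder"
  assumes "finite \<sigma>" "u \<in> \<sigma>" "u < v"
  shows "card {x\<in>\<sigma>. x < v} = Suc (card {x\<in>\<sigma> - {u}. x < v})"
proof -
  have "{x\<in>\<sigma>. x < v} = insert u {x\<in>\<sigma> - {u}. x < v}" using assms by auto
  then show ?thesis using assms(1) by simp
qed

text \<open>Deleting the smaller vertex u lowers the position of v by one, while deleting v does not
  move u. Hence the two orders of deletion have opposite signs.\<close>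

lemma face_sign_swap:
  fixes u v :: "'a::linorder"
  assumes "finite \<sigma>" "u \<in> \<sigma>" "v \<in> \<sigma>" "u < v"
  shows "face_sign \<sigma> v * face_sign (\<sigma> - {v}) u = (- (face_sign \<sigma> u * face_sign (\<sigma> - {u}) v) :: 'k::field)"
proof -
  have "{x \<in> \<sigma> - {v}. x < u} = {x \<in> \<sigma>. x < u}" using assms(4) by auto
  then show ?thesis using card_less_Diff[OF assms(1,2,4)] by simp
qed

lemma boundary_simplex_boundary: "boundary (simplex_boundary \<sigma>) = (0 :: 'a::linorder set \<Rightarrow>\<^sub>0 'k::field)"
proof (cases "finite \<sigma> \<and> card \<sigma> \<ge> 3")
  case False
  \<comment> \<open>An edge is treated apart because the boundary of a vertex is 0 by convention,
    not by cancellation.\<close>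
  have "boundary (simplex_boundary \<sigma>) = (0 :: 'a set \<Rightarrow>\<^sub>0 'k)" if "card \<sigma> = 2"
  proof -
    have "simplex_boundary (\<sigma> - {v}) = (0 :: 'a set \<Rightarrow>\<^sub>0 'k)" if "v \<in> \<sigma>" for v
    proof -
      have "card (\<sigma> - {v}) \<le> 1" using that \<open>card \<sigma> = 2\<close> by (simp add: card_Diff_singleton)
      then show ?thesis by (simp only: simplex_boundary_def if_True)
    qed
    then show ?thesis
      by (simp add: simplex_boundary_def[of \<sigma>] boundary_sum boundary_single boundary_linear)
  qed
  moreover have "card \<sigma> \<le> 1 \<or> card \<sigma> = 2" using False by (cases "finite \<sigma>") auto
  ultimately show ?thesis by (auto simp: simplex_boundary_def boundary_linear)
next
  case True
  then have fin: "finite \<sigma>" and c: "card \<sigma> \<ge> 3" by auto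
  show ?thesis
  proof (rule poly_mapping_eqI)
    fix \<rho> :: "'a set"
    \<comment> \<open>\<open>T (v, u)\<close> is the contribution of deleting v and then u; swapping
      the two matches the pairs in P with those in Q and changes the sign.\<close>
    define T :: "'a \<times> 'a \<Rightarrow> 'k" where
      "T = (\<lambda>(v, u). if \<sigma> - {v} - {u} = \<rho> then face_sign \<sigma> v * face_sign (\<sigma> - {v}) u else 0)"
    define P Q where "P = {(v, u). v \<in> \<sigma> \<and> u \<in> \<sigma> \<and> u < v}" and "Q = {(v, u). v \<in> \<sigma> \<and> u \<in> \<sigma> \<and> v < u}"
    have finPQ: "finite P" "finite Q"
      by (rule finite_subset[of _ "\<sigma> \<times> \<sigma>"]; use fin in \<open>auto simp: P_def Q_def\<close>)+
    have "Poly_Mapping.lookup (boundary (simplex_boundary \<sigma>)) \<rho>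
        = (\<Sum>v\<in>\<sigma>. face_sign \<sigma> v * Poly_Mapping.lookup (simplex_boundary (\<sigma> - {v})) \<rho>)"
      using c by (simp add: lookup_boundary pairing_simplex_boundary)
    also have "\<dots> = (\<Sum>v\<in>\<sigma>. \<Sum>u\<in>\<sigma> - {v}. T (v, u))"
    proof (rule sum.cong)
      fix v assume "v \<in> \<sigma>"
      then have "\<not> card (\<sigma> - {v}) \<le> 1" using c fin by simp
      then show "face_sign \<sigma> v * Poly_Mapping.lookup (simplex_boundary (\<sigma> - {v})) \<rho>
          = (\<Sum>u\<in>\<sigma> - {v}. T (v, u))"
        unfolding lookup_simplex_boundary T_def
        by (simp add: sum_distrib_left if_distrib cong: if_cong)
    qed simp
    also have "\<dots> = sum T (SIGMA v:\<sigma>. \<sigma> - {v})"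
      using fin by (simp add: sum.Sigma)
    also have "(SIGMA v:\<sigma>. \<sigma> - {v}) = P \<union> Q" by (auto simp: P_def Q_def)
    also have "sum T (P \<union> Q) = sum T P + sum T Q"
      by (rule sum.union_disjoint) (use finPQ in \<open>auto simp: P_def Q_def\<close>)
    also have "sum T Q = (\<Sum>x\<in>P. T (prod.swap x))"
      by (rule sum.reindex_bij_witness[of _ prod.swap prod.swap]) (auto simp: P_def Q_def)
    also have "\<dots> = (\<Sum>x\<in>P. - T x)"
    proof (rule sum.cong)
      fix x assume "x \<in> P"
      then obtain v u where x: "x = (v, u)" "v \<in> \<sigma>" "u \<in> \<sigma>" "u < v" by (auto simp: P_def)
      have "\<sigma> - {v} - {u} = \<sigma> - {u} - {v}" by auto
      then show "T (prod.swap x) = - T x"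
        using face_sign_swap[OF fin x(3,2,4), where ?'k = 'k] by (simp add: T_def x(1))
    qed simp
    finally show "Poly_Mapping.lookup (boundary (simplex_boundary \<sigma>)) \<rho> = Poly_Mapping.lookup (0 :: 'a set \<Rightarrow>\<^sub>0 'k) \<rho>"
      by (simp add: sum_negf)
  qed
qed

lemma boundary_boundary: "boundary (boundary c) = (0 :: 'a::linorder set \<Rightarrow>\<^sub>0 'k::field)"
proof -
  have "boundary (boundary c) =
      (\<Sum>\<sigma>\<in>Poly_Mapping.keys c. chain_scale (Poly_Mapping.lookup c \<sigma>) (boundary (simplex_boundary \<sigma>)))"
    by (simp add: boundary_def[of c] boundary_sum boundary_linear)
  then show ?thesis by (simp add: boundary_simplex_boundary)
qed

section \<open>The cone contraction of the full simplex\<close>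

definition cone :: "'a \<Rightarrow> 'a set \<Rightarrow> ('a set \<Rightarrow>\<^sub>0 'k::field)" where
  "cone w \<sigma> = (if w \<in> \<sigma> then 0 else Poly_Mapping.single (insert w \<sigma>) 1)"

lemma extend_simplex_boundary:
  "extend_linearly g (simplex_boundary \<sigma>) =
     (if card \<sigma> \<le> 1 then 0 else \<Sum>v\<in>\<sigma>. chain_scale (face_sign \<sigma> v) (g (\<sigma> - {v})))"
  by (simp add: simplex_boundary_def extend_sum)

text \<open>If w is in \<sigma>, only the face omitting w survives coning, and it gives \<sigma>
  back. Otherwise w, placed in front of all other vertices, flips their signs, so the faces of the
  cone that contain w cancel against the cones of the faces of \<sigma>. A single vertex has to be
  excluded because homology is not reduced.\<close>

lemma cone_homotopy_simplex:
  fixes w :: "'a::linorder"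
  assumes c: "card \<sigma> \<ge> 2" and w: "\<forall>v\<in>\<sigma>. w \<le> v"
  shows "boundary (cone w \<sigma>) + extend_linearly (cone w) (simplex_boundary \<sigma>)
    = (Poly_Mapping.single \<sigma> 1 :: 'a set \<Rightarrow>\<^sub>0 'k::field)"
proof -
  have fin: "finite \<sigma>" using c by (metis card.infinite not_numeral_le_zero)
  have ne: "\<sigma> \<noteq> {}" using c by auto
  show ?thesis
  proof (cases "w \<in> \<sigma>")
    case True
    have "{u \<in> \<sigma>. u < w} = {}" using w by (auto dest: leD)
    then have s: "face_sign \<sigma> w = (1::'k)" by (metis card.empty power_0)
    have "extend_linearly (cone w) (simplex_boundary \<sigma>) =
        (\<Sum>v\<in>\<sigma>. if v = w then Poly_Mapping.single \<sigma> 1 else (0 :: 'a set \<Rightarrow>\<^sub>0 'k))"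
      using c True unfolding extend_simplex_boundary
      by (auto intro!: sum.cong simp: cone_def s insert_absorb)
    then show ?thesis using True fin by (simp add: cone_def boundary_linear)
  next
    case False
    have e: "{u \<in> insert w \<sigma>. u < w} = {}" using w by (auto dest: leD)
    have s0: "face_sign (insert w \<sigma>) w = (1 :: 'k)" by (simp only: e card.empty power_0)
    have d0: "insert w \<sigma> - {w} = \<sigma>" using False by auto
    have s: "face_sign (insert w \<sigma>) v = (- face_sign \<sigma> v :: 'k)"
      and d: "insert w \<sigma> - {v} = insert w (\<sigma> - {v})" if "v \<in> \<sigma>" for v
    proof -
      have "w < v" using that w False by (metis order_le_less)
      then show "face_sign (insert w \<sigma>) v = (- face_sign \<sigma> v :: 'k)"
        using card_less_Diff[of "insert w \<sigma>" w v] fin False by simp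
      show "insert w \<sigma> - {v} = insert w (\<sigma> - {v})" using \<open>w < v\<close> by auto
    qed
    have "boundary (cone w \<sigma>) = (\<Sum>v\<in>insert w \<sigma>. Poly_Mapping.single (insert w \<sigma> - {v}) (face_sign (insert w \<sigma>) v :: 'k))"
      using False c fin ne by (simp add: cone_def boundary_single simplex_boundary_def)
    also have "\<dots> = Poly_Mapping.single \<sigma> 1
        + (\<Sum>v\<in>\<sigma>. Poly_Mapping.single (insert w \<sigma> - {v}) (face_sign (insert w \<sigma>) v))"
      by (simp only: sum.insert[OF fin False] s0 d0)
    also have "(\<Sum>v\<in>\<sigma>. Poly_Mapping.single (insert w \<sigma> - {v}) (face_sign (insert w \<sigma>) v :: 'k))
        = (\<Sum>v\<in>\<sigma>. - Poly_Mapping.single (insert w (\<sigma> - {v})) (face_sign \<sigma> v))"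
      by (rule sum.cong) (simp_all only: s d single_uminus)
    finally have "boundary (cone w \<sigma>) = Poly_Mapping.single \<sigma> 1
        - (\<Sum>v\<in>\<sigma>. Poly_Mapping.single (insert w (\<sigma> - {v})) (face_sign \<sigma> v :: 'k))"
      by (simp add: sum_negf)
    moreover have "extend_linearly (cone w) (simplex_boundary \<sigma>) =
        (\<Sum>v\<in>\<sigma>. Poly_Mapping.single (insert w (\<sigma> - {v})) (face_sign \<sigma> v :: 'k))"
      using c False unfolding extend_simplex_boundary by (auto intro!: sum.cong simp: cone_def)
    ultimately show ?thesis by simp
  qed
qed

text \<open>Summing the homotopy formula over the simplices of c leaves only the boundary of the
  cone, as the other term cones the boundary of c.\<close>

lemma cycle_bounds_cone:
  fixes c :: "'a::linorder set \<Rightarrow>\<^sub>0 'k::field"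
  assumes "boundary c = 0" and "\<forall>\<sigma>\<in>Poly_Mapping.keys c. card \<sigma> \<ge> 2 \<and> (\<forall>v\<in>\<sigma>. w \<le> v)"
  shows "boundary (extend_linearly (cone w) c) = c"
proof -
  have "boundary (extend_linearly (cone w) c) + extend_linearly (cone w) (boundary c)
      = (\<Sum>\<sigma>\<in>Poly_Mapping.keys c. chain_scale (Poly_Mapping.lookup c \<sigma>)
          (boundary (cone w \<sigma>) + extend_linearly (cone w) (simplex_boundary \<sigma>)))"
    by (simp add: extend_linearly_def[of _ c] boundary_def[of c] boundary_sum extend_sum
        boundary_linear extend_scale chain_scale_distrib sum.distrib)
  also have "\<dots> = (\<Sum>\<sigma>\<in>Poly_Mapping.keys c. Poly_Mapping.single \<sigma> (Poly_Mapping.lookup c \<sigma>))"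
    by (rule sum.cong) (use assms(2) in \<open>simp_all add: cone_homotopy_simplex\<close>)
  also have "\<dots> = c"
    by (rule poly_mapping_eqI) (simp add: lookup_sum lookup_single when_def in_keys_iff)
  finally show ?thesis using assms(1) by simp
qed

section \<open>Persistent homology with one-dimensional stages\<close>

definition face_closed :: "'a set set \<Rightarrow> bool" where
  "face_closed L \<longleftrightarrow> (\<forall>\<sigma>\<in>L. \<forall>\<tau>. \<tau> \<subseteq> \<sigma> \<longrightarrow> \<tau> \<noteq> {} \<longrightarrow> \<tau> \<in> L)"

text \<open>The coset B + x without the module record, so that classes at different stages are
  written in the same way.\<close>

definition coset :: "'v::plus set \<Rightarrow> 'v \<Rightarrow> 'v set" where
  "coset B x = (\<lambda>b. b + x) ` B"

lemma chains_linear: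
  "0 \<in> chains L k"
  "c \<in> chains L k \<Longrightarrow> d \<in> chains L k \<Longrightarrow> c + d \<in> chains L k"
  "c \<in> chains L k \<Longrightarrow> d \<in> chains L k \<Longrightarrow> c - d \<in> chains L k"
  "c \<in> chains L k \<Longrightarrow> chain_scale r c \<in> chains L k"
  using keys_add[of c d] keys_diff[of c d] keys_chain_scale[of r c]
  by (auto simp: chains_def)

lemma cycles_linear:
  "0 \<in> cycles L k"
  "c \<in> cycles L k \<Longrightarrow> d \<in> cycles L k \<Longrightarrow> c + d \<in> cycles L k"
  "c \<in> cycles L k \<Longrightarrow> d \<in> cycles L k \<Longrightarrow> c - d \<in> cycles L k"
  "c \<in> cycles L k \<Longrightarrow> chain_scale r c \<in> cycles L k"
  by (auto simp: cycles_def chains_linear boundary_linear)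

lemma boundaries_linear:
  "0 \<in> boundaries L k"
  "c \<in> boundaries L k \<Longrightarrow> d \<in> boundaries L k \<Longrightarrow> c + d \<in> boundaries L k"
  "c \<in> boundaries L k \<Longrightarrow> d \<in> boundaries L k \<Longrightarrow> c - d \<in> boundaries L k"
  "c \<in> boundaries L k \<Longrightarrow> chain_scale r c \<in> boundaries L k"
proof -
  show "0 \<in> boundaries L k"
    unfolding boundaries_def using chains_linear(1) boundary_linear(1) by (metis imageI)
  show "c \<in> boundaries L k \<Longrightarrow> d \<in> boundaries L k \<Longrightarrow> c + d \<in> boundaries L k"
    unfolding boundaries_def using chains_linear(2)
    by (auto intro!: image_eqI[where f = boundary, OF boundary_linear(2)[symmetric]])
  show "c \<in> boundaries L k \<Longrightarrow> d \<in> boundaries L k \<Longrightarrow> c - d \<in> boundaries L k"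
    unfolding boundaries_def using chains_linear(3)
    by (auto intro!: image_eqI[where f = boundary, OF boundary_linear(3)[symmetric]])
  show "c \<in> boundaries L k \<Longrightarrow> chain_scale r c \<in> boundaries L k"
    unfolding boundaries_def using chains_linear(4)
    by (auto intro!: image_eqI[where f = boundary, OF boundary_linear(4)[symmetric]])
qed

lemma keys_boundary:
  assumes "\<rho> \<in> Poly_Mapping.keys (boundary c)"
  obtains \<sigma> v where "\<sigma> \<in> Poly_Mapping.keys c" "v \<in> \<sigma>" "\<rho> = \<sigma> - {v}" "card \<sigma> \<ge> 2"
proof -
  have "pairing (\<lambda>\<sigma>. Poly_Mapping.lookup (simplex_boundary \<sigma>) \<rho>) c \<noteq> 0"
    using assms by (simp add: in_keys_iff lookup_boundary)
  then obtain \<sigma> where s: "\<sigma> \<in> Poly_Mapping.keys c"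
    and "Poly_Mapping.lookup c \<sigma> * Poly_Mapping.lookup (simplex_boundary \<sigma>) \<rho> \<noteq> 0"
    unfolding pairing_def by (rule sum.not_neutral_contains_not_neutral)
  then have "Poly_Mapping.lookup (simplex_boundary \<sigma> :: _ \<Rightarrow>\<^sub>0 'b) \<rho> \<noteq> 0" by auto
  then obtain v where "v \<in> \<sigma>" "\<rho> = \<sigma> - {v}" "card \<sigma> \<ge> 2"
    by (rule lookup_simplex_boundary_nonzero)
  with s that show ?thesis by blast
qed

lemma cycles_mono: "L \<subseteq> L' \<Longrightarrow> cycles L k \<subseteq> cycles L' k"
  by (auto simp: cycles_def chains_def)

lemma boundaries_mono: "L \<subseteq> L' \<Longrightarrow> boundaries L k \<subseteq> boundaries L' k"
  unfolding boundaries_def by (rule image_mono) (auto simp: chains_def)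

lemma a_r_coset_cycle_space: "B +>\<^bsub>cycle_space L k\<^esub> x = coset B x"
  by (auto simp: a_r_coset_def r_coset_def cycle_space_def coset_def)

lemma carrier_homology: "carrier (homology L k) = coset (boundaries L k) ` cycles L k"
  by (auto simp: homology_def quotient_module_def A_RCOSETS_def RCOSETS_def coset_def
      cycle_space_def r_coset_def)

lemma in_coset_iff:
  "y \<in> coset (boundaries L k) x \<longleftrightarrow> y - x \<in> boundaries L k"
  by (force simp: coset_def image_iff)

lemma coset_eqI:
  assumes "x - y \<in> boundaries L k"
  shows "coset (boundaries L k) x = coset (boundaries L k) y"
proof -
  have "w - x \<in> boundaries L k \<longleftrightarrow> w - y \<in> boundaries L k" for w
  proof
    assume "w - x \<in> boundaries L k"
    from boundaries_linear(2)[OF this assms] show "w - y \<in> boundaries L k" by simp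
  next
    assume "w - y \<in> boundaries L k"
    from boundaries_linear(3)[OF this assms] show "w - x \<in> boundaries L k" by simp
  qed
  then show ?thesis using in_coset_iff by blast
qed

lemma self_in_coset: "x \<in> coset (boundaries L k) x"
  using boundaries_linear(1)[of L k] by (simp add: in_coset_iff)

lemma add_homology:
  "coset (boundaries L k) x \<oplus>\<^bsub>homology L k\<^esub> coset (boundaries L k) y = coset (boundaries L k) (x + y)"
proof -
  have "coset (boundaries L k) x \<oplus>\<^bsub>homology L k\<^esub> coset (boundaries L k) y =
      {u + v | u v. u \<in> coset (boundaries L k) x \<and> v \<in> coset (boundaries L k) y}"
    by (auto simp: homology_def quotient_module_def set_add_def set_mult_def cycle_space_def)
  also have "\<dots> = coset (boundaries L k) (x + y)"
  proof (intro equalityI subsetI)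
    fix w assume "w \<in> {u + v | u v. u \<in> coset (boundaries L k) x \<and> v \<in> coset (boundaries L k) y}"
    then obtain u v where w: "w = u + v" and "u - x \<in> boundaries L k" "v - y \<in> boundaries L k"
      by (auto simp: in_coset_iff)
    from boundaries_linear(2)[OF this(2,3)] show "w \<in> coset (boundaries L k) (x + y)"
      by (simp add: in_coset_iff w algebra_simps)
  next
    fix w assume "w \<in> coset (boundaries L k) (x + y)"
    then have "w - y \<in> coset (boundaries L k) x"
      by (simp add: in_coset_iff algebra_simps)
    moreover have "w = (w - y) + y" by simp
    ultimately show "w \<in> {u + v | u v. u \<in> coset (boundaries L k) x \<and> v \<in> coset (boundaries L k) y}"
      using self_in_coset by blast
  qed
  finally show ?thesis .
qed

lemma smult_homology:
  "r \<odot>\<^bsub>homology L k\<^esub> coset (boundaries L k) x = coset (boundaries L k) (chain_scale r x)"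
proof -
  have "coset (boundaries L k) (chain_scale r y) = coset (boundaries L k) (chain_scale r x)"
    if "y \<in> coset (boundaries L k) x" for y
    using that boundaries_linear(4)[of "y - x" L k r]
    by (intro coset_eqI) (simp add: in_coset_iff chain_scale_distrib)
  moreover have "r \<odot>\<^bsub>homology L k\<^esub> coset (boundaries L k) x
      = (\<Union>y\<in>coset (boundaries L k) x. coset (boundaries L k) (chain_scale r y))"
    by (simp add: homology_def quotient_module_def a_r_coset_cycle_space)
       (simp add: cycle_space_def)
  ultimately show ?thesis using self_in_coset by blast
qed

lemma homology_inclusion_coset:
  assumes "L \<subseteq> L'"
  shows "homology_inclusion L' k (coset (boundaries L k) x) = coset (boundaries L' k) x"
proof -
  have "coset (boundaries L' k) y = coset (boundaries L' k) x"
    if "y \<in> coset (boundaries L k) x" for y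
    using that boundaries_mono[OF assms]
    by (intro coset_eqI) (auto simp: in_coset_iff)
  then show ?thesis
    unfolding homology_inclusion_def a_r_coset_cycle_space using self_in_coset by blast
qed

lemma closed_persistent_homology:
  assumes "\<And>s t. s \<le> t \<Longrightarrow> F s \<subseteq> F t"
  shows "closed_persistence (persistent_homology F k)"
  unfolding closed_persistence_def persistent_homology_def
proof (simp add: carrier_homology, intro conjI allI impI ballI)
  fix t c x assume "x \<in> cycles (F t) k"
  then show "c \<odot>\<^bsub>homology (F t) k\<^esub> coset (boundaries (F t) k) x
      \<in> coset (boundaries (F t) k) ` cycles (F t) k"
    by (simp add: smult_homology cycles_linear)
next
  fix s t x assume "s \<le> t" "x \<in> cycles (F s) k"
  then show "homology_inclusion (F t) k (coset (boundaries (F s) k) x)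
      \<in> coset (boundaries (F t) k) ` cycles (F t) k"
    using assms[of s t] cycles_mono[of "F s" "F t" k] by (auto simp: homology_inclusion_coset)
qed

text \<open>Each class is a unique multiple of the class of z, and the factor is its coordinate.
  Because z is the same chain at all stages, inclusions preserve the coordinate, which is what the
  transitions of the interval module do.\<close>

lemma has_diagram_singleton:
  fixes z :: "'a::linorder set \<Rightarrow>\<^sub>0 'k::field"
  assumes ab: "ereal a < b"
    and mono: "\<And>s t. s \<le> t \<Longrightarrow> F s \<subseteq> F t"
    and z_cycle: "\<And>t. covers (a, b) t \<Longrightarrow> z \<in> cycles (F t) k"
    and z_nontrivial: "\<And>t. covers (a, b) t \<Longrightarrow> z \<notin> boundaries (F t) k"
    and z_spans: "\<And>t c. covers (a, b) t \<Longrightarrow> c \<in> cycles (F t) k \<Longrightarrow>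
                    \<exists>r. c - chain_scale r z \<in> boundaries (F t) k"
    and trivial: "\<And>t. \<not> covers (a, b) t \<Longrightarrow> (cycles (F t) k :: ('a set \<Rightarrow>\<^sub>0 'k) set) \<subseteq> boundaries (F t) k"
  shows "has_persistence_diagram
    (persistent_homology F k :: ('k, ('a set \<Rightarrow>\<^sub>0 'k) set) persistence_space) {#(a, b)#}"
proof -
  let ?V = "persistent_homology F k :: ('k, ('a set \<Rightarrow>\<^sub>0 'k) set) persistence_space"
  let ?B = "\<lambda>t. boundaries (F t) k :: ('a set \<Rightarrow>\<^sub>0 'k) set"
  let ?Z = "\<lambda>t. cycles (F t) k :: ('a set \<Rightarrow>\<^sub>0 'k) set"
  define coord where "coord t x = (if covers (a, b) t then THE r. x - chain_scale r z \<in> ?B t else 0)" for t x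
  have coord_eq: "coord t x = r" if cov: "covers (a, b) t" and r: "x - chain_scale r z \<in> ?B t" for t x r
  proof -
    have "s = r" if s: "x - chain_scale s z \<in> ?B t" for s
    proof (rule ccontr)
      assume ne: "s \<noteq> r"
      from boundaries_linear(3)[OF s r] have "chain_scale (r - s) z \<in> ?B t"
        by (simp add: chain_scale_distrib)
      from boundaries_linear(4)[OF this, of "inverse (r - s)"] have "z \<in> ?B t" using ne by simp
      then show False using z_nontrivial[OF cov] by simp
    qed
    with r have "(THE r. x - chain_scale r z \<in> ?B t) = r" by (rule the_equality)
    then show ?thesis using cov by (simp add: coord_def)
  qed
  have coord: "x - chain_scale (coord t x) z \<in> ?B t" if "x \<in> ?Z t" "covers (a, b) t" for t x
    using z_spans[OF that(2,1)] coord_eq[OF that(2)] by metis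
  have coord_add: "coord t (x + y) = coord t x + coord t y" if "x \<in> ?Z t" "y \<in> ?Z t" for t x y
  proof (cases "covers (a, b) t")
    case True
    from boundaries_linear(2)[OF coord[OF that(1) True] coord[OF that(2) True]]
    show ?thesis by (intro coord_eq[OF True]) (simp add: chain_scale_distrib algebra_simps)
  qed (simp add: coord_def)
  have coord_scale: "coord t (chain_scale c x) = c * coord t x" if "x \<in> ?Z t" for t x c
  proof (cases "covers (a, b) t")
    case True
    from boundaries_linear(4)[OF coord[OF that True], of c]
    show ?thesis by (intro coord_eq[OF True]) (simp add: chain_scale_distrib)
  qed (simp add: coord_def)
  have coord_cong: "coord t x = coord t y" if "x \<in> ?Z t" "x - y \<in> ?B t" for t x y
  proof (cases "covers (a, b) t")
    case True
    from boundaries_linear(3)[OF coord[OF that(1) True] that(2)]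
    have "coord t y = coord t x" by (intro coord_eq[OF True]) simp
    then show ?thesis by simp
  qed (simp add: coord_def)
  \<comment> \<open>A class is a set of chains; an arbitrary representative is chosen, and
    \<open>coord_cong\<close> makes the choice irrelevant.\<close>
  define \<phi> where "\<phi> t A = (\<lambda>i\<in>{..<length [(a, b)]}. coord t (SOME x. x \<in> A))" for t A
  have \<phi>: "\<phi> t (coset (?B t) x) = (\<lambda>i\<in>{..<length [(a, b)]}. coord t x)" if x: "x \<in> ?Z t" for t x
  proof -
    have "(SOME y. y \<in> coset (?B t) x) \<in> coset (?B t) x" using self_in_coset by (rule someI)
    then have "(SOME y. y \<in> coset (?B t) x) - x \<in> ?B t" by (simp add: in_coset_iff)
    from boundaries_linear(3)[OF boundaries_linear(1) this]
    have "x - (SOME y. y \<in> coset (?B t) x) \<in> ?B t" by simp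
    then have "coord t x = coord t (SOME y. y \<in> coset (?B t) x)" by (rule coord_cong[OF x])
    then show ?thesis by (simp add: \<phi>_def)
  qed
  have carrier_V: "carrier (space_at ?V t) = coset (?B t) ` ?Z t" for t
    by (simp add: persistent_homology_def carrier_homology)
  have \<phi>_carrier: "\<phi> t A \<in> carrier (space_at (interval_sum [(a, b)]) t)"
    if A: "A \<in> carrier (space_at ?V t)" for t A
  proof -
    obtain x where x: "x \<in> ?Z t" "A = coset (?B t) x" using A by (auto simp: carrier_V)
    show ?thesis
      unfolding carrier_interval_sum x(2) \<phi>[OF x(1)] restrict_PiE_iff by (simp add: coord_def)
  qed
  have "persistence_iso ?V (interval_sum [(a, b)]) \<phi>"
    unfolding persistence_iso_def
  proof (intro conjI allI impI ballI)
    fix t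
    show "linear_map (space_at ?V t) (space_at (interval_sum [(a, b)]) t) (\<phi> t)"
      unfolding linear_map_def
    proof (intro conjI allI ballI)
      show "\<phi> t \<in> carrier (space_at ?V t) \<rightarrow> carrier (space_at (interval_sum [(a, b)]) t)"
        using \<phi>_carrier by blast
      fix A assume "A \<in> carrier (space_at ?V t)"
      then obtain x where x: "x \<in> ?Z t" "A = coset (?B t) x" by (auto simp: carrier_V)
      show "\<phi> t (c \<odot>\<^bsub>space_at ?V t\<^esub> A) = c \<odot>\<^bsub>space_at (interval_sum [(a, b)]) t\<^esub> \<phi> t A" for c
        unfolding smult_interval_sum using x
        by (auto simp: persistent_homology_def smult_homology \<phi> cycles_linear coord_scale)
      fix A' assume "A' \<in> carrier (space_at ?V t)"
      then obtain y where y: "y \<in> ?Z t" "A' = coset (?B t) y" by (auto simp: carrier_V)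
      show "\<phi> t (A \<oplus>\<^bsub>space_at ?V t\<^esub> A') = \<phi> t A \<oplus>\<^bsub>space_at (interval_sum [(a, b)]) t\<^esub> \<phi> t A'"
        unfolding add_interval_sum using x y
        by (auto simp: persistent_homology_def add_homology \<phi> cycles_linear coord_add)
    qed
    show "bij_betw (\<phi> t) (carrier (space_at ?V t)) (carrier (space_at (interval_sum [(a, b)]) t))"
      unfolding bij_betw_def
    proof
      show "inj_on (\<phi> t) (carrier (space_at ?V t))"
      proof (rule inj_onI)
        fix A A' assume "A \<in> carrier (space_at ?V t)" "A' \<in> carrier (space_at ?V t)"
        then obtain x y where x: "x \<in> ?Z t" "A = coset (?B t) x"
          and y: "y \<in> ?Z t" "A' = coset (?B t) y" by (auto simp: carrier_V)
        assume "\<phi> t A = \<phi> t A'"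
        then have "\<phi> t A 0 = \<phi> t A' 0" by simp
        then have e: "coord t x = coord t y" by (simp add: x y \<phi>)
        have "x - y \<in> ?B t"
        proof (cases "covers (a, b) t")
          case True
          from boundaries_linear(3)[OF coord[OF x(1) True] coord[OF y(1) True]] show ?thesis
            by (simp add: e)
        next
          case False
          then show ?thesis using trivial[OF False] cycles_linear(3)[OF x(1) y(1)] by blast
        qed
        then show "A = A'" unfolding x(2) y(2) by (rule coset_eqI)
      qed
      show "\<phi> t ` carrier (space_at ?V t) = carrier (space_at (interval_sum [(a, b)]) t)"
      proof
        show "\<phi> t ` carrier (space_at ?V t) \<subseteq> carrier (space_at (interval_sum [(a, b)]) t)"
          using \<phi>_carrier by blast
        show "carrier (space_at (interval_sum [(a, b)]) t) \<subseteq> \<phi> t ` carrier (space_at ?V t)"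
        proof
          fix f assume f: "f \<in> carrier (space_at (interval_sum [(a, b)]) t :: ('k, nat \<Rightarrow> 'k) module)"
          show "f \<in> \<phi> t ` carrier (space_at ?V t)"
          proof (cases "covers (a, b) t")
            case True
            have z: "chain_scale (f 0) z \<in> ?Z t" by (rule cycles_linear(4)[OF z_cycle[OF True]])
            have "coord t (chain_scale (f 0) z) = f 0"
              by (rule coord_eq[OF True]) (simp add: boundaries_linear)
            then have eq: "\<phi> t (coset (?B t) (chain_scale (f 0) z)) = f"
              using f unfolding carrier_interval_sum \<phi>[OF z]
              by (auto simp: fun_eq_iff PiE_def extensional_def)
            show ?thesis unfolding carrier_V by (intro image_eqI[where f = "\<phi> t", OF eq[symmetric]] imageI z)
          next
            case False
            then have eq: "\<phi> t (coset (?B t) 0) = f"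
              using f unfolding carrier_interval_sum \<phi>[OF cycles_linear(1)]
              by (auto simp: fun_eq_iff PiE_def Pi_iff extensional_def coord_def)
            show ?thesis
              unfolding carrier_V by (intro image_eqI[where f = "\<phi> t", OF eq[symmetric]] imageI cycles_linear(1))
          qed
        qed
      qed
    qed
  next
    fix s t :: real and A assume st: "s \<le> t" and "A \<in> carrier (space_at ?V s)"
    then obtain x where x: "x \<in> ?Z s" "A = coset (?B s) x" by (auto simp: carrier_V)
    have xt: "x \<in> ?Z t" using cycles_mono[OF mono[OF st]] x(1) by blast
    have "coord t x = (if a \<le> s \<and> ereal t < b then coord s x else 0)"
    proof (cases "covers (a, b) t")
      case t: True
      show ?thesis
      proof (cases "covers (a, b) s")
        case True
        then have "coord t x = coord s x"
          using coord[OF x(1) True] boundaries_mono[OF mono[OF st]] by (intro coord_eq[OF t]) blast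
        then show ?thesis using True t by (simp add: covers_def)
      next
        case False
        \<comment> \<open>As s \<le> t < b, a stage s outside the interval lies before a, and there
          every cycle already bounds.\<close>
        have "\<not> a \<le> s"
          using False t st le_less_trans[of "ereal s" "ereal t" b] by (auto simp: covers_def)
        moreover have "x \<in> ?B t" using trivial[OF False] x(1) boundaries_mono[OF mono[OF st]] by blast
        then have "coord t x = 0" by (intro coord_eq[OF t]) simp
        ultimately show ?thesis by simp
      qed
    next
      case False
      then have "\<not> (a \<le> s \<and> ereal t < b)" using st by (auto simp: covers_def)
      moreover have "coord t x = 0" using False by (simp add: coord_def)
      ultimately show ?thesis by auto
    qed
    then show "\<phi> t (transition ?V s t A) = transition (interval_sum [(a, b)]) s t (\<phi> s A)"
      unfolding transition_interval_sum using x xt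
      by (auto simp: persistent_homology_def homology_inclusion_coset[OF mono[OF st]] \<phi> fun_eq_iff restrict_def)
  qed
  then show ?thesis
    unfolding has_persistence_diagram_def persistence_isomorphic_def
    by (intro exI[of _ "[(a, b)]"]) (use ab in auto)
qed

lemma has_diagram_empty:
  assumes "\<And>t. (cycles (F t) k :: ('a::linorder set \<Rightarrow>\<^sub>0 'k::field) set) \<subseteq> boundaries (F t) k"
  shows "has_persistence_diagram
    (persistent_homology F k :: ('k, ('a set \<Rightarrow>\<^sub>0 'k) set) persistence_space) {#}"
    and "\<exists>x. carrier (space_at (persistent_homology F k :: ('k, ('a set \<Rightarrow>\<^sub>0 'k) set) persistence_space) t) \<subseteq> {x}"
proof -
  let ?V = "persistent_homology F k :: ('k, ('a set \<Rightarrow>\<^sub>0 'k) set) persistence_space"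
  have carrier_V: "carrier (space_at ?V t) = {coset (boundaries (F t) k) 0}" for t
  proof -
    have "coset (boundaries (F t) k) x = coset (boundaries (F t) k) 0"
      if "x \<in> cycles (F t) k" for x :: "'a set \<Rightarrow>\<^sub>0 'k"
      using that assms[of t] by (intro coset_eqI) auto
    then have "coset (boundaries (F t) k) ` cycles (F t) k \<subseteq> {coset (boundaries (F t) k) (0 :: 'a set \<Rightarrow>\<^sub>0 'k)}"
      by blast
    moreover have "coset (boundaries (F t) k) (0 :: 'a set \<Rightarrow>\<^sub>0 'k) \<in> coset (boundaries (F t) k) ` cycles (F t) k"
      by (intro imageI cycles_linear(1))
    ultimately show ?thesis unfolding persistent_homology_def by (simp add: carrier_homology) blast
  qed
  then show "\<exists>x. carrier (space_at ?V t) \<subseteq> {x}" by blast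
  have carrier_W: "carrier (space_at (interval_sum [] :: ('k, nat \<Rightarrow> 'k) persistence_space) t) = {\<lambda>i. undefined}" for t
    unfolding carrier_interval_sum by simp
  have "persistence_iso ?V (interval_sum []) (\<lambda>t A i. undefined)"
    unfolding persistence_iso_def linear_map_def bij_betw_def carrier_W carrier_V
      smult_interval_sum add_interval_sum transition_interval_sum
    by (simp add: restrict_def)
  then show "has_persistence_diagram ?V {#}"
    unfolding has_persistence_diagram_def persistence_isomorphic_def
    by (intro exI[of _ "[]"]) auto
qed

section \<open>Acyclic matchings\<close>

definition simplices :: "'a set \<Rightarrow> nat \<Rightarrow> 'a set set" where
  "simplices W N = {\<sigma>. \<sigma> \<subseteq> W \<and> card \<sigma> = N}"

text \<open>
  The family \<open>V\<close> is what is left of the full simplex on \<open>W\<close> after removing a subcomplex. A set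
  \<open>S \<in> L\<close> is matched with \<open>insert (partner S) S\<close>; all other faces of the latter have smaller weight,
  which is acyclicity in the sense of discrete Morse theory.
\<close>

locale acyclic_matching =
  fixes W :: "'a::linorder set" and V L :: "'a set set"
    and partner :: "'a set \<Rightarrow> 'a" and weight :: "'a set \<Rightarrow> nat"
  assumes finite_W: "finite W"
    and up_closed: "S \<in> V \<Longrightarrow> S \<subseteq> T \<Longrightarrow> T \<subseteq> W \<Longrightarrow> T \<in> V"
    and lower: "S \<in> L \<Longrightarrow> S \<in> V \<and> S \<subseteq> W \<and> S \<noteq> {}"
    and partner: "S \<in> L \<Longrightarrow> partner S \<in> W - S"
    and acyclic: "S \<in> L \<Longrightarrow> x \<in> S \<Longrightarrow> insert (partner S) S - {x} \<in> V \<Longrightarrow>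
      weight (insert (partner S) S - {x}) < weight S"
begin

text \<open>All lower sets of the top weight M are cancelled at once by the boundaries of their
  matched simplices. The remaining faces of these simplices in V are lighter, so no lower set of
  weight M or more comes back, and the bound drops.\<close>

lemma eliminate_lower_bounded:
  fixes d :: "'a set \<Rightarrow>\<^sub>0 'k::field"
  assumes "Poly_Mapping.keys d \<subseteq> simplices W N"
    and "\<forall>S\<in>Poly_Mapping.keys d \<inter> L. weight S < M"
  shows "\<exists>e. Poly_Mapping.keys e \<subseteq> simplices W (Suc N) \<and> Poly_Mapping.keys (d - boundary e) \<inter> L = {}"
  using assms
proof (induction M arbitrary: d)
  case 0
  then show ?case by (intro exI[of _ 0]) (auto simp: boundary_linear)
next
  case (Suc M)
  define X where "X = {S \<in> Poly_Mapping.keys d \<inter> L. weight S = M}"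
  have finX: "finite X" by (simp add: X_def)
  define up where "up S = insert (partner S) S" for S
  \<comment> \<open>The sign of S as a face of \<open>up S\<close> occurs squared in the boundary,
    so S gets exactly its coefficient in d.\<close>
  define e0 where "e0 = (\<Sum>S\<in>X. Poly_Mapping.single (up S)
      (Poly_Mapping.lookup d S * face_sign S (partner S)))"
  have fin: "finite S" if "S \<in> L" for S
    using lower[OF that] finite_W finite_subset by blast
  have e0_keys: "Poly_Mapping.keys e0 \<subseteq> simplices W (Suc N)"
  proof
    fix \<sigma> assume "\<sigma> \<in> Poly_Mapping.keys e0"
    then have "(\<Sum>S\<in>X. Poly_Mapping.lookup (Poly_Mapping.single (up S)
        (Poly_Mapping.lookup d S * face_sign S (partner S))) \<sigma>) \<noteq> 0"
      by (simp add: e0_def in_keys_iff lookup_sum)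
    then obtain S where S: "S \<in> X" and "Poly_Mapping.lookup (Poly_Mapping.single (up S)
        (Poly_Mapping.lookup d S * face_sign S (partner S))) \<sigma> \<noteq> 0"
      by (rule sum.not_neutral_contains_not_neutral)
    then have \<sigma>: "\<sigma> = up S" by (auto simp: lookup_single when_def split: if_splits)
    have "S \<in> L" "S \<in> simplices W N" using S Suc.prems(1) by (auto simp: X_def)
    then show "\<sigma> \<in> simplices W (Suc N)"
      using partner fin by (auto simp: \<sigma> up_def simplices_def)
  qed
  have lookup_e0: "Poly_Mapping.lookup (boundary e0) T = (if T \<in> X then Poly_Mapping.lookup d T else 0)"
    if T: "T \<in> V" "M \<le> weight T" for T
  proof -
    have "Poly_Mapping.lookup d S * face_sign S (partner S) *
        Poly_Mapping.lookup (simplex_boundary (up S)) T = (if S = T then Poly_Mapping.lookup d S else 0)"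
      if S: "S \<in> X" for S
    proof (cases "S = T")
      case True
      have SL: "S \<in> L" using S by (simp add: X_def)
      have "Poly_Mapping.lookup (simplex_boundary (up S)) T = (face_sign S (partner S) :: 'k)"
        unfolding up_def True[symmetric]
        by (rule lookup_simplex_boundary_insert) (use partner[OF SL] lower[OF SL] fin[OF SL] in auto)
      then show ?thesis using True by (simp flip: power_add)
    next
      case False
      have "Poly_Mapping.lookup (simplex_boundary (up S)) T = (0::'k)"
      proof (rule ccontr)
        assume "\<not> ?thesis"
        then obtain v where v: "v \<in> up S" "T = up S - {v}" by (rule lookup_simplex_boundary_nonzero)
        have SL: "S \<in> L" and w: "weight S = M" using S by (simp_all add: X_def)
        have "v \<noteq> partner S" using v False partner[OF SL] by (auto simp: up_def)
        then have "v \<in> S" using v(1) by (simp add: up_def)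
        from acyclic[OF SL this] show False using T v(2) w by (simp add: up_def)
      qed
      then show ?thesis using False by simp
    qed
    then have "Poly_Mapping.lookup (boundary e0) T = (\<Sum>S\<in>X. if S = T then Poly_Mapping.lookup d S else 0)"
      unfolding e0_def lookup_boundary pairing_sum by (intro sum.cong) simp_all
    then show ?thesis using finX by simp
  qed
  define d1 where "d1 = d - boundary e0"
  have d1_keys: "Poly_Mapping.keys d1 \<subseteq> simplices W N"
  proof
    fix \<rho> assume "\<rho> \<in> Poly_Mapping.keys d1"
    then have "\<rho> \<in> Poly_Mapping.keys d \<or> \<rho> \<in> Poly_Mapping.keys (boundary e0)"
      using keys_diff[of d "boundary e0"] by (auto simp: d1_def)
    then show "\<rho> \<in> simplices W N"
    proof
      assume "\<rho> \<in> Poly_Mapping.keys (boundary e0)"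
      then obtain \<sigma> v where "\<sigma> \<in> Poly_Mapping.keys e0" "v \<in> \<sigma>" "\<rho> = \<sigma> - {v}" by (rule keys_boundary)
      then show ?thesis using e0_keys by (auto simp: simplices_def card_Diff_singleton)
    qed (use Suc.prems in blast)
  qed
  moreover have "\<forall>T\<in>Poly_Mapping.keys d1 \<inter> L. weight T < M"
  proof (rule ballI, rule ccontr)
    fix T assume T: "T \<in> Poly_Mapping.keys d1 \<inter> L" and "\<not> weight T < M"
    then have M: "M \<le> weight T" by simp
    have TV: "T \<in> V" using T lower by blast
    have "Poly_Mapping.lookup d T \<noteq> (if T \<in> X then Poly_Mapping.lookup d T else 0)"
      using T lookup_e0[OF TV M] by (auto simp: d1_def in_keys_iff lookup_minus)
    then have "T \<notin> X" "T \<in> Poly_Mapping.keys d" by (auto simp: in_keys_iff split: if_splits)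
    then show False using T M Suc.prems(2) by (force simp: X_def)
  qed
  ultimately obtain e1 where e1: "Poly_Mapping.keys e1 \<subseteq> simplices W (Suc N)"
    "Poly_Mapping.keys (d1 - boundary e1) \<inter> L = {}"
    using Suc.IH by blast
  have "d - boundary (e0 + e1) = d1 - boundary e1" by (simp add: d1_def boundary_linear)
  moreover have "Poly_Mapping.keys (e0 + e1) \<subseteq> simplices W (Suc N)"
    using e0_keys e1(1) keys_add[of e0 e1] by blast
  ultimately show ?case using e1(2) by metis
qed

lemma eliminate_lower:
  fixes d :: "'a set \<Rightarrow>\<^sub>0 'k::field"
  assumes "Poly_Mapping.keys d \<subseteq> simplices W N"
  obtains e where "Poly_Mapping.keys e \<subseteq> simplices W (Suc N)"
    and "Poly_Mapping.keys (d - boundary e) \<inter> L = {}"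
proof -
  have "\<forall>S\<in>Poly_Mapping.keys d \<inter> L. weight S < Suc (Max (weight ` Poly_Mapping.keys d))"
    by (simp add: less_Suc_eq_le)
  from eliminate_lower_bounded[OF assms this] that show ?thesis by blast
qed

text \<open>Take the heaviest lower partner S0 of a simplex of d. Any other simplex of d with S0 as
  a face would be matched to a set heavier than S0, by acyclicity; so S0 is hit only by its own
  match and cannot cancel in the boundary. But S0 is in V, where the boundary vanishes.\<close>

lemma eliminate_upper:
  fixes d :: "'a set \<Rightarrow>\<^sub>0 'k::field"
  assumes W: "\<forall>S\<in>Poly_Mapping.keys d. S \<subseteq> W"
    and cycle: "Poly_Mapping.keys (boundary d) \<inter> V = {}"
    and upper: "\<forall>S\<in>Poly_Mapping.keys d \<inter> V. \<exists>S0\<in>L. S = insert (partner S0) S0"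
  shows "Poly_Mapping.keys d \<inter> V = {}"
proof (rule ccontr)
  define A where "A = {S \<in> L. insert (partner S) S \<in> Poly_Mapping.keys d}"
  assume "Poly_Mapping.keys d \<inter> V \<noteq> {}"
  then obtain S where S: "S \<in> Poly_Mapping.keys d \<inter> V" by blast
  from bspec[OF upper S] obtain T where "T \<in> L" "S = insert (partner T) T" by (rule bexE)
  then have "T \<in> A" using S by (simp add: A_def)
  then have "A \<noteq> {}" by blast
  have "A \<subseteq> Pow W" using lower by (auto simp: A_def)
  then have finA: "finite A" using finite_W finite_subset by blast
  then have "Max (weight ` A) \<in> weight ` A" using \<open>A \<noteq> {}\<close> by simp
  then obtain S0 where S0: "S0 \<in> A" and max: "weight S0 = Max (weight ` A)" by auto
  have S0L: "S0 \<in> L" and key: "insert (partner S0) S0 \<in> Poly_Mapping.keys d"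
    using S0 by (auto simp: A_def)
  have fin: "finite S0" using lower[OF S0L] finite_W finite_subset by blast
  let ?S1 = "insert (partner S0) S0"
  have "Poly_Mapping.lookup (boundary d) S0 =
      (\<Sum>S\<in>Poly_Mapping.keys d. if S = ?S1 then Poly_Mapping.lookup d S * face_sign S0 (partner S0) else 0)"
    unfolding lookup_boundary pairing_def
  proof (rule sum.cong)
    fix S assume S: "S \<in> Poly_Mapping.keys d"
    show "Poly_Mapping.lookup d S * Poly_Mapping.lookup (simplex_boundary S) S0 =
        (if S = ?S1 then Poly_Mapping.lookup d S * face_sign S0 (partner S0) else 0)"
    proof (cases "S = ?S1")
      case True
      have "Poly_Mapping.lookup (simplex_boundary S) S0 = (face_sign S0 (partner S0) :: 'k)"
        unfolding True
        by (rule lookup_simplex_boundary_insert) (use partner[OF S0L] lower[OF S0L] fin in auto)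
      then show ?thesis using True by simp
    next
      case False
      have "Poly_Mapping.lookup (simplex_boundary S) S0 = (0::'k)"
      proof (rule ccontr)
        assume "\<not> ?thesis"
        then obtain v where v: "v \<in> S" "S0 = S - {v}" by (rule lookup_simplex_boundary_nonzero)
        have "S \<in> V" using up_closed[of S0 S] lower[OF S0L] W S v(2) by blast
        then obtain S' where S': "S' \<in> L" "S = insert (partner S') S'" using upper S by blast
        have ne: "S' \<noteq> S0" using S'(2) False by auto
        then have "v \<noteq> partner S'" using v(2) S' partner[OF S'(1)] by auto
        then have "v \<in> S'" using v(1) S'(2) by simp
        from acyclic[OF S'(1) this] have "weight S0 < weight S'"
          using lower[OF S0L] v(2) S'(2) by simp
        moreover have "S' \<in> A" using S' S by (simp add: A_def)
        then have "weight S' \<le> weight S0" using finA max by simp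
        ultimately show False by simp
      qed
      then show ?thesis using False by simp
    qed
  qed simp
  then have "Poly_Mapping.lookup (boundary d) S0 \<noteq> 0" using key by (simp add: in_keys_iff)
  then show False using cycle lower[OF S0L] by (auto simp: in_keys_iff)
qed

end

section \<open>Enumerating finite sets of natural numbers\<close>

definition el :: "nat set \<Rightarrow> nat \<Rightarrow> nat" where
  "el S i = sorted_list_of_set S ! i"

lemma el_in: "finite S \<Longrightarrow> i < card S \<Longrightarrow> el S i \<in> S"
  unfolding el_def by (metis nth_mem set_sorted_list_of_set length_sorted_list_of_set)

lemma el_less: "finite S \<Longrightarrow> i < j \<Longrightarrow> j < card S \<Longrightarrow> el S i < el S j"
  unfolding el_def
  by (metis sorted_list_of_set.strict_sorted_key_list_of_set sorted_wrt_nth_less length_sorted_list_of_set)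

lemma el_le: "finite S \<Longrightarrow> i \<le> j \<Longrightarrow> j < card S \<Longrightarrow> el S i \<le> el S j"
  using el_less[of S i j] by (cases "i = j") auto

lemma el_cases:
  assumes "finite S" "y \<in> S"
  obtains i where "i < card S" "y = el S i"
  using assms unfolding el_def
  by (metis in_set_conv_nth set_sorted_list_of_set length_sorted_list_of_set)

lemma el_image: "finite S \<Longrightarrow> el S ` {..<card S} = S"
  by (auto simp: el_in elim: el_cases[of S])

lemma el_unique:
  assumes mono: "\<And>i j. i < j \<Longrightarrow> j < N \<Longrightarrow> y i < y j" and im: "y ` {..<N} = S"
  shows "card S = N" and "j < N \<Longrightarrow> el S j = y j"
proof -
  have sorted: "sorted_wrt (<) (map y [0..<N])"
    by (simp add: sorted_wrt_iff_nth_less mono)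
  have set: "set (map y [0..<N]) = S" using im by (auto simp: atLeast0LessThan)
  then have fin: "finite S" by auto
  have eq: "sorted_list_of_set S = map y [0..<N]"
    using sorted set fin
    by (intro strict_sorted_equal) (auto simp: sorted_list_of_set.strict_sorted_key_list_of_set)
  then show "card S = N" by (metis length_map length_sorted_list_of_set length_upt diff_zero)
  show "el S j = y j" if "j < N" using that by (simp add: el_def eq)
qed

lemma el_delete:
  assumes "finite S" "i < card S" "j < card S - 1"
  shows "el (S - {el S i}) j = (if j < i then el S j else el S (Suc j))"
proof (rule el_unique(2)[where N = "card S - 1"])
  let ?y = "\<lambda>j. if j < i then el S j else el S (Suc j)"
  show "?y i' < ?y j'" if "i' < j'" "j' < card S - 1" for i' j'
    using that assms(1) by (auto intro: el_less)
  show "?y ` {..<card S - 1} = S - {el S i}"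
  proof (intro equalityI subsetI)
    fix z assume "z \<in> ?y ` {..<card S - 1}"
    then obtain k where k: "k < card S - 1" "z = ?y k" by blast
    have "el S k < el S i" if "k < i" using el_less[OF assms(1) that assms(2)] .
    moreover have "el S i < el S (Suc k)" if "\<not> k < i"
      using that k(1) by (intro el_less[OF assms(1)]) auto
    ultimately show "z \<in> S - {el S i}" using k el_in[OF assms(1)] assms(2) by (auto split: if_splits)
  next
    fix z assume z: "z \<in> S - {el S i}"
    then obtain k where k: "k < card S" "z = el S k" using el_cases[OF assms(1)] by blast
    have "k \<noteq> i" using z k by auto
    show "z \<in> ?y ` {..<card S - 1}"
    proof (cases "k < i")
      case True
      then show ?thesis using k assms(2) by (intro image_eqI[of _ _ k]) auto
    next
      case False
      then show ?thesis using k \<open>k \<noteq> i\<close> by (intro image_eqI[of _ _ "k - 1"]) auto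
    qed
  qed
qed (use assms in simp)

text \<open>Turns the sign of the face omitting \<open>el S i\<close> into the i-th power of
  -1.\<close>

lemma card_below_el:
  assumes "finite S" "i < card S"
  shows "card {u\<in>S. u < el S i} = i"
proof -
  have "{u\<in>S. u < el S i} = el S ` {..<i}"
  proof (intro equalityI subsetI)
    fix u assume u: "u \<in> {u\<in>S. u < el S i}"
    then obtain k where k: "k < card S" "u = el S k" using el_cases[OF assms(1)] by blast
    have "k < i"
    proof (rule ccontr)
      assume "\<not> k < i"
      then have "el S i \<le> el S k" using k(1) by (intro el_le[OF assms(1)]) auto
      then show False using u k by simp
    qed
    then show "u \<in> el S ` {..<i}" using k by simp
  qed (use assms el_less el_in in auto)
  moreover have "inj_on (el S) {..<i}"
  proof (rule linorder_inj_onI)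
    fix x y assume "x < y" "x \<in> {..<i}" "y \<in> {..<i}"
    then have "el S x < el S y" using assms by (intro el_less) auto
    then show "el S x \<noteq> el S y" by simp
  qed auto
  ultimately show ?thesis by (simp add: card_image)
qed

section \<open>Complexes of circular arcs\<close>

text \<open>
  The faces are the sets contained in a cyclic interval of \<open>n - p\<close> of the \<open>n\<close> vertices; \<open>a\<close> is the
  last element of the interval, so that \<open>a + 1, \<dots>, a + p\<close> (modulo \<open>n\<close>) are missing.
\<close>

definition arc_complex :: "nat \<Rightarrow> nat \<Rightarrow> nat set set" where
  "arc_complex n p =
     {S. S \<noteq> {} \<and> S \<subseteq> {1..n} \<and> (\<exists>a\<in>{1..n}. \<forall>y\<in>S. y \<le> a \<and> a + p < y + n \<or> a + p < y)}"

text \<open>What is left of the full simplex after removing the complex. Equivalently, cyclic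
  neighbours in such a set are at most p apart.\<close>

definition dense_sets :: "nat \<Rightarrow> nat \<Rightarrow> nat set set" where
  "dense_sets n p = {S. S \<noteq> {} \<and> S \<subseteq> {1..n}} - arc_complex n p"

lemma face_closed_arc_complex: "face_closed (arc_complex n p)"
  unfolding face_closed_def arc_complex_def by blast

lemma dense_sets_finite: "S \<in> dense_sets n p \<Longrightarrow> finite S"
  by (auto simp: dense_sets_def intro: finite_subset)

lemma arc_complex_finite: "S \<in> arc_complex n p \<Longrightarrow> finite S"
  by (auto simp: arc_complex_def intro: finite_subset)

lemma arc_complexI:
  assumes "S \<noteq> {}" "S \<subseteq> {1..n}" "a \<in> {1..n}"
    and "\<And>y. y \<in> S \<Longrightarrow> y \<le> a \<and> a + p < y + n \<or> a + p < y"
  shows "S \<in> arc_complex n p"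
  using assms unfolding arc_complex_def by blast

lemma arc_complex_inner_gap:
  assumes S: "S \<subseteq> {1..n}" and i: "Suc i < card S" and gap: "el S i + p < el S (Suc i)"
  shows "S \<in> arc_complex n p"
proof (rule arc_complexI)
  have fin: "finite S" using S finite_subset by blast
  show "S \<noteq> {}" using i by auto
  have in_S: "el S i \<in> S" "el S (Suc i) \<in> S" using i fin by (auto intro: el_in)
  then show "el S i \<in> {1..n}" using S by blast
  fix y assume "y \<in> S"
  then obtain k where k: "k < card S" "y = el S k" using el_cases[OF fin] by blast
  show "y \<le> el S i \<and> el S i + p < y + n \<or> el S i + p < y"
  proof (cases "k \<le> i")
    case True
    then have "y \<le> el S i" using i el_le[OF fin, of k i] k by simp
    moreover have "el S (Suc i) \<le> n" using in_S S by auto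
    ultimately show ?thesis using gap by simp
  next
    case False
    then have "el S (Suc i) \<le> y" using el_le[OF fin, of "Suc i" k] k by simp
    then show ?thesis using gap by simp
  qed
qed (use S in auto)

lemma arc_complex_outer_gap:
  assumes S: "S \<subseteq> {1..n}" "S \<noteq> {}" and gap: "el S (card S - 1) + p < el S 0 + n"
  shows "S \<in> arc_complex n p"
proof (rule arc_complexI)
  have fin: "finite S" using S finite_subset by blast
  then have c: "card S > 0" using S by (simp add: card_gt_0_iff)
  show "el S (card S - 1) \<in> {1..n}" using el_in[OF fin, of "card S - 1"] c S by auto
  fix y assume "y \<in> S"
  then obtain k where k: "k < card S" "y = el S k" using el_cases[OF fin] by blast
  have "el S 0 \<le> y" "y \<le> el S (card S - 1)" using k by (auto intro: el_le[OF fin])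
  then show "y \<le> el S (card S - 1) \<and> el S (card S - 1) + p < y + n \<or> el S (card S - 1) + p < y"
    using gap by simp
qed (use S in auto)

text \<open>If a lies between the least and the largest element, the p missing positions after a
  separate two successive elements. Otherwise they belong to the gap that wraps around from n to
  1.\<close>

lemma arc_complex_gap:
  assumes "S \<in> arc_complex n p"
  obtains i where "Suc i < card S" "el S i + p < el S (Suc i)"
  | "el S (card S - 1) + p < el S 0 + n"
proof -
  obtain a where S: "S \<noteq> {}" "S \<subseteq> {1..n}" and a: "a \<in> {1..n}"
    and gap: "\<And>y. y \<in> S \<Longrightarrow> y \<le> a \<and> a + p < y + n \<or> a + p < y"
    using assms unfolding arc_complex_def by blast
  have fin: "finite S" using S finite_subset by blast
  then have c: "card S > 0" using S by (simp add: card_gt_0_iff)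
  have g: "el S k \<le> a \<and> a + p < el S k + n \<or> a + p < el S k" if "k < card S" for k
    using gap el_in[OF fin that] by blast
  have "(\<exists>i. Suc i < card S \<and> el S i + p < el S (Suc i)) \<or> el S (card S - 1) + p < el S 0 + n"
  proof (cases "el S 0 \<le> a \<and> a < el S (card S - 1)")
    case True
    \<comment> \<open>The first element beyond a: it must even lie beyond a + p, whereas its
      predecessor is at most a.\<close>
    define k where "k = (LEAST k. k < card S \<and> a < el S k)"
    have k: "k < card S" "a < el S k"
      using LeastI[of "\<lambda>k. k < card S \<and> a < el S k" "card S - 1"] True c by (auto simp: k_def)
    have "k \<noteq> 0" using k True by (metis not_le)
    have "el S (k - 1) \<le> a"
      using not_less_Least[of "k - 1" "\<lambda>k. k < card S \<and> a < el S k"] \<open>k \<noteq> 0\<close> k(1)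
      by (auto simp flip: k_def)
    moreover have "a + p < el S k" using g[OF k(1)] k(2) by simp
    ultimately have "Suc (k - 1) < card S \<and> el S (k - 1) + p < el S (Suc (k - 1))"
      using k(1) \<open>k \<noteq> 0\<close> by simp
    then show ?thesis by blast
  next
    case False
    have "el S (card S - 1) \<le> n" using el_in[OF fin, of "card S - 1"] c S(2) by auto
    then have "el S (card S - 1) + p < el S 0 + n"
      using False g[of 0] g[of "card S - 1"] c a by auto
    then show ?thesis ..
  qed
  then show ?thesis using that by blast
qed

lemma dense_inner:
  assumes "S \<in> dense_sets n p" "Suc i < card S"
  shows "el S (Suc i) \<le> el S i + p"
  using assms arc_complex_inner_gap[of S n i p] by (force simp: dense_sets_def)

lemma dense_outer:
  assumes "S \<in> dense_sets n p"
  shows "el S 0 + n \<le> el S (card S - 1) + p"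
  using assms arc_complex_outer_gap[of S n p] by (force simp: dense_sets_def)

lemma dense_up_closed:
  assumes "S \<in> dense_sets n p" "S \<subseteq> T" "T \<subseteq> {1..n}"
  shows "T \<in> dense_sets n p"
  using assms face_closed_arc_complex[of n p] unfolding dense_sets_def face_closed_def by blast

section \<open>A matching on the dense sets\<close>

text \<open>
  Write \<open>x\<^sub>0 < \<dots> < x\<^sub>r\<close> for the elements of a dense set \<open>S\<close> with \<open>x\<^sub>0 = 1\<close>. Removing \<open>x\<^sub>i\<close> leaves a
  dense set iff \<open>x\<^sub>i\<^sub>+\<^sub>1\<close> lies before \<open>target n p S i\<close>, the position next to the \<open>p\<close> elements following
  the cyclic predecessor of \<open>x\<^sub>i\<close>. The first \<open>i < r\<close> for which \<open>x\<^sub>i\<^sub>+\<^sub>1\<close> is not the target decides how \<open>S\<close> is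
  matched: the target is inserted if it comes before \<open>x\<^sub>i\<^sub>+\<^sub>1\<close>, and \<open>x\<^sub>i\<close> is removed otherwise.
\<close>

definition target :: "nat \<Rightarrow> nat \<Rightarrow> nat set \<Rightarrow> nat \<Rightarrow> nat" where
  "target n p S i = (if i = 0 then el S (card S - 1) + p + 1 - n else el S (i - 1) + p + 1)"

definition insertable :: "nat \<Rightarrow> nat \<Rightarrow> nat set \<Rightarrow> nat \<Rightarrow> bool" where
  "insertable n p S i \<longleftrightarrow> 1 \<in> S \<and> Suc i < card S \<and>
     (\<forall>j<i. el S (Suc j) = target n p S j) \<and> target n p S i < el S (Suc i)"

text \<open>A set without 1 is matched by inserting 1. Seen from the larger set this is the removal
  of its first element, the case i = 0 of the rule above.\<close>

definition lower_sets :: "nat \<Rightarrow> nat \<Rightarrow> nat set set" where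
  "lower_sets n p = {S \<in> dense_sets n p. 1 \<notin> S \<or> (\<exists>i. insertable n p S i)}"

definition partner :: "nat \<Rightarrow> nat \<Rightarrow> nat set \<Rightarrow> nat" where
  "partner n p S = (if 1 \<notin> S then 1 else target n p S (THE i. insertable n p S i))"

definition critical :: "nat \<Rightarrow> nat \<Rightarrow> nat set \<Rightarrow> bool" where
  "critical n p S \<longleftrightarrow> S \<in> dense_sets n p \<and> 1 \<in> S \<and>
     (\<forall>i. Suc i < card S \<longrightarrow> el S (Suc i) = target n p S i)"

lemma insertable_unique:
  assumes "insertable n p S i" "insertable n p S j"
  shows "i = j"
  using assms by (cases i j rule: linorder_cases) (auto simp: insertable_def)

lemma partner_insertable: "insertable n p S i \<Longrightarrow> partner n p S = target n p S i"
  using insertable_unique[of n p S] the_equality[of "insertable n p S" i]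
  by (auto simp: partner_def insertable_def[of n p S i])

text \<open>Density of S guarantees that the subtraction of n in \<open>target\<close> is not
  truncated.\<close>

lemma target_0:
  assumes "S \<in> dense_sets n p"
  shows "target n p S 0 + n = el S (card S - 1) + p + 1"
  using dense_outer[OF assms] by (simp add: target_def)

lemma target_Suc: "target n p S (Suc i) = el S i + p + 1"
  by (simp add: target_def)

text \<open>For an insertable index the target thus lies strictly between two successive elements,
  so inserting it really adds a vertex.\<close>

lemma el_less_target:
  assumes "S \<in> dense_sets n p" "i < card S"
  shows "el S i < target n p S i"
proof (cases i)
  case 0
  then show ?thesis using target_0[OF assms(1)] dense_outer[OF assms(1)] by simp
next
  case (Suc j)
  then show ?thesis using dense_inner[OF assms(1), of j] assms(2) by (simp add: target_Suc)
qed

lemma not_in_between: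
  assumes fin: "finite S" and i: "Suc i < card S" and c: "el S i < c" "c < el S (Suc i)"
  shows "c \<notin> S"
proof
  assume "c \<in> S"
  then obtain k where k: "k < card S" "c = el S k" using el_cases[OF fin] by blast
  show False
  proof (cases "k \<le> i")
    case True
    then show False using el_le[OF fin, of k i] k c i by simp
  next
    case False
    then show False using el_le[OF fin, of "Suc i" k] k c by simp
  qed
qed

lemma partner_in:
  assumes "S \<in> lower_sets n p"
  shows "partner n p S \<in> {1..n} - S"
proof (cases "1 \<in> S")
  case False
  have "S \<noteq> {}" "S \<subseteq> {1..n}" using assms by (auto simp: lower_sets_def dense_sets_def)
  then show ?thesis using False by (force simp: partner_def)
next
  case True
  then obtain i where i: "insertable n p S i" and S: "S \<in> dense_sets n p"
    using assms by (auto simp: lower_sets_def)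
  have fin: "finite S" using S by (rule dense_sets_finite)
  have i': "Suc i < card S" "target n p S i < el S (Suc i)" using i by (auto simp: insertable_def)
  have l: "el S i < target n p S i" using el_less_target[OF S] i' by simp
  have "target n p S i \<notin> S" by (rule not_in_between[OF fin i'(1) l i'(2)])
  moreover have "el S (Suc i) \<in> S" using el_in[OF fin] i' by blast
  then have "el S (Suc i) \<le> n" using S by (auto simp: dense_sets_def)
  ultimately show ?thesis using l i' by (simp add: partner_insertable[OF i])
qed

text \<open>With the j-th element gone, the next element after its predecessor is at
  \<open>target n p S j\<close> or beyond: it is the following element of S if j < i, and the
  inserted target itself if j = i. Either way p positions in a row are free. Hence only elements
  above the inserted one can be exchanged for it.\<close>

lemma exchange_not_dense:
  assumes S: "S \<in> dense_sets n p" and i: "insertable n p S i" and j: "j \<le> i"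
  shows "insert (target n p S i) S - {el S j} \<notin> dense_sets n p"
proof -
  let ?c = "target n p S i"
  have fin: "finite S" using S by (rule dense_sets_finite)
  have sub: "S \<subseteq> {1..n}" using S by (auto simp: dense_sets_def)
  have i': "Suc i < card S" "?c < el S (Suc i)" using i by (auto simp: insertable_def)
  have l: "el S i < ?c" using el_less_target[OF S] i' by simp
  have cn: "?c \<in> {1..n}"
    using partner_in[of S n p] S i by (auto simp: lower_sets_def partner_insertable[OF i])
  have tj: "target n p S j \<le> el S (Suc j)"
    using i j by (cases "j = i") (auto simp: insertable_def)
  have tjc: "target n p S j \<le> ?c"
  proof (cases "j = i")
    case False
    then have "target n p S j = el S (Suc j)" using i j by (auto simp: insertable_def)
    also have "\<dots> \<le> el S i" using False j i' by (intro el_le[OF fin]) auto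
    finally show ?thesis using l by simp
  qed simp
  have el_range: "el S k \<in> {1..n}" if "k < card S" for k using el_in[OF fin that] sub by blast
  have "insert ?c S - {el S j} \<in> arc_complex n p"
  proof (cases j)
    case 0
    show ?thesis
    proof (rule arc_complexI)
      show "insert ?c S - {el S j} \<noteq> {}"
        using el_le[OF fin, of j i] j i' l by auto
      show "el S (card S - 1) \<in> {1..n}" using i' by (intro el_range) auto
      fix y assume y: "y \<in> insert ?c S - {el S j}"
      \<comment> \<open>For j = 0 the predecessor is the last element of S, and the free positions
        wrap around; the inserted element has to be kept below that last element.\<close>
      have "el S (Suc i) \<le> el S (card S - 1)" using i' by (intro el_le[OF fin]) auto
      then have "?c \<le> el S (card S - 1)" using i' by simp
      moreover have "target n p S 0 \<le> y \<and> y \<le> el S (card S - 1)" if yS: "y \<in> S"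
      proof -
        obtain k where k: "k < card S" "y = el S k" using el_cases[OF fin yS] by blast
        then have "k \<noteq> 0" using y 0 by (intro notI) auto
        then have "el S 1 \<le> y" using k el_le[OF fin, of 1 k] by simp
        moreover have "y \<le> el S (card S - 1)" using k by (auto intro: el_le[OF fin])
        ultimately show ?thesis using tj 0 by simp
      qed
      ultimately have "target n p S 0 \<le> y \<and> y \<le> el S (card S - 1)" using y tjc 0 by auto
      then show "y \<le> el S (card S - 1) \<and> el S (card S - 1) + p < y + n \<or> el S (card S - 1) + p < y"
        using target_0[OF S] by simp
    qed (use sub cn in auto)
  next
    case (Suc m)
    have t: "target n p S j = el S m + p + 1" by (simp add: Suc target_Suc)
    show ?thesis
    proof (rule arc_complexI)
      show "insert ?c S - {el S j} \<noteq> {}"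
        using el_le[OF fin, of j i] j i' l by auto
      show "el S m \<in> {1..n}" using i' j Suc by (intro el_range) auto
      fix y assume y: "y \<in> insert ?c S - {el S j}"
      show "y \<le> el S m \<and> el S m + p < y + n \<or> el S m + p < y"
      proof (cases "y = ?c")
        case True
        then show ?thesis using tjc t by simp
      next
        case False
        then obtain k where k: "k < card S" "y = el S k" using y el_cases[OF fin, of y] by blast
        have "k \<noteq> j" using k y by auto
        show ?thesis
        proof (cases "k < j")
          case True
          then have "y \<le> el S m" using k el_le[OF fin, of k m] Suc j i' by simp
          moreover have "el S (Suc j) \<le> n" using el_range[of "Suc j"] j i' by simp
          ultimately show ?thesis using tj t y cn sub by auto
        next
          case False
          then have "el S (Suc j) \<le> y" using k el_le[OF fin, of "Suc j" k] \<open>k \<noteq> j\<close> by simp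
          then show ?thesis using tj t by simp
        qed
      qed
    qed (use sub cn in auto)
  qed
  then show ?thesis by (simp add: dense_sets_def)
qed

lemma sum_exchange_less:
  fixes S :: "nat set"
  assumes "finite S" "x \<in> S" "c \<notin> S" "c < x"
  shows "\<Sum>(insert c S - {x}) < \<Sum>S"
proof -
  have "insert c S - {x} = insert c (S - {x})" using assms by auto
  then show ?thesis
    using assms sum.remove[of S x "\<lambda>x. x"] by simp
qed

text \<open>The weight is the sum of the elements. Whenever a face other than S is dense, the
  removed x is larger than the inserted partner, so the sum drops.\<close>

interpretation arc_matching: acyclic_matching "{1..n}" "dense_sets n p" "lower_sets n p" "partner n p" "\<Sum>"
  for n p
proof
  show "finite {1..n}" by simp
  show "T \<in> dense_sets n p" if "S \<in> dense_sets n p" "S \<subseteq> T" "T \<subseteq> {1..n}" for S T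
    using that by (rule dense_up_closed)
  show "S \<in> dense_sets n p \<and> S \<subseteq> {1..n} \<and> S \<noteq> {}" if "S \<in> lower_sets n p" for S
    using that by (auto simp: lower_sets_def dense_sets_def)
  show "partner n p S \<in> {1..n} - S" if "S \<in> lower_sets n p" for S
    using that by (rule partner_in)
  fix S x assume L: "S \<in> lower_sets n p" and x: "x \<in> S"
    and D: "insert (partner n p S) S - {x} \<in> dense_sets n p"
  have S: "S \<in> dense_sets n p" using L by (simp add: lower_sets_def)
  have fin: "finite S" using S by (rule dense_sets_finite)
  have "partner n p S < x"
  proof (cases "1 \<in> S")
    case True
    then obtain i where i: "insertable n p S i" using L by (auto simp: lower_sets_def)
    have i': "Suc i < card S" "target n p S i < el S (Suc i)" using i by (auto simp: insertable_def)
    obtain j where j: "j < card S" "x = el S j" using el_cases[OF fin x] by blast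
    have "\<not> j \<le> i"
      using exchange_not_dense[OF S i] D j(2) by (auto simp: partner_insertable[OF i])
    then have "el S (Suc i) \<le> x" using j el_le[OF fin, of "Suc i" j] by simp
    then show ?thesis using i' by (simp add: partner_insertable[OF i])
  next
    case False
    have "x \<in> {1..n}" "x \<noteq> 1" using x S False by (auto simp: dense_sets_def)
    then show ?thesis using False by (simp add: partner_def)
  qed
  then show "\<Sum>(insert (partner n p S) S - {x}) < \<Sum>S"
    using partner_in[OF L] by (intro sum_exchange_less[OF fin x]) auto
qed

lemma el_0_eq_1:
  assumes "S \<in> dense_sets n p" "1 \<in> S"
  shows "el S 0 = 1"
proof -
  have fin: "finite S" using assms(1) by (rule dense_sets_finite)
  obtain k where k: "k < card S" "1 = el S k" using el_cases[OF fin assms(2)] by blast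
  have "el S 0 \<le> 1" unfolding k(2) using k(1) by (intro el_le[OF fin]) auto
  moreover have "el S 0 \<in> S" using k(1) by (intro el_in[OF fin]) auto
  then have "1 \<le> el S 0" using assms(1) by (auto simp: dense_sets_def)
  ultimately show ?thesis by simp
qed

text \<open>The neighbours of the removed element are within p of each other, so p free positions
  cannot fit between them. Any window missed after the removal was missed by S before.\<close>

lemma delete_dense_inner:
  assumes S: "S \<in> dense_sets n p" and i: "Suc (Suc i) < card S"
    and gap: "el S (Suc (Suc i)) \<le> el S i + p"
  shows "S - {el S (Suc i)} \<in> dense_sets n p"
proof -
  have fin: "finite S" using S by (rule dense_sets_finite)
  have less: "el S i < el S (Suc i)" "el S (Suc i) < el S (Suc (Suc i))"
    using i by (auto intro: el_less[OF fin])
  have mem: "el S i \<in> S" "el S (Suc i) \<in> S" "el S (Suc (Suc i)) \<in> S"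
    using i by (auto intro: el_in[OF fin])
  have range: "S \<subseteq> {1..n}" using S by (auto simp: dense_sets_def)
  have False if "S - {el S (Suc i)} \<in> arc_complex n p"
  proof -
    obtain a where a: "a \<in> {1..n}"
      and gap': "\<And>y. y \<in> S \<Longrightarrow> y \<noteq> el S (Suc i) \<Longrightarrow> y \<le> a \<and> a + p < y + n \<or> a + p < y"
      using \<open>S - _ \<in> arc_complex n p\<close> unfolding arc_complex_def by blast
    have g: "el S i \<le> a \<and> a + p < el S i + n \<or> a + p < el S i"
      "el S (Suc (Suc i)) \<le> a \<and> a + p < el S (Suc (Suc i)) + n \<or> a + p < el S (Suc (Suc i))"
      using gap' mem less by auto
    have "el S (Suc i) \<le> a \<and> a + p < el S (Suc i) + n \<or> a + p < el S (Suc i)"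
      using g less gap by linarith
    then have "S \<in> arc_complex n p"
      using gap' a range mem by (intro arc_complexI[of S n a]) auto
    then show False using S by (simp add: dense_sets_def)
  qed
  moreover have "S - {el S (Suc i)} \<noteq> {}" using mem(1) less by auto
  ultimately show ?thesis using range by (auto simp: dense_sets_def)
qed

text \<open>The same for the removal of 1, whose cyclic neighbours are the last element and
  \<open>el S 1\<close>.\<close>

lemma delete_dense_first:
  assumes S: "S \<in> dense_sets n p" "1 \<in> S" and c: "1 < card S"
    and gap: "el S 1 + n \<le> el S (card S - 1) + p"
  shows "S - {1} \<in> dense_sets n p"
proof -
  have fin: "finite S" using S(1) by (rule dense_sets_finite)
  have first: "el S 0 = 1" by (rule el_0_eq_1[OF S])
  have less: "el S 0 < el S 1" "el S 1 \<le> el S (card S - 1)"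
    using c by (auto intro: el_less[OF fin] el_le[OF fin])
  have mem: "el S 1 \<in> S" "el S (card S - 1) \<in> S"
    using c by (auto intro: el_in[OF fin])
  have range: "S \<subseteq> {1..n}" using S by (auto simp: dense_sets_def)
  have False if "S - {1} \<in> arc_complex n p"
  proof -
    obtain a where a: "a \<in> {1..n}"
      and gap': "\<And>y. y \<in> S \<Longrightarrow> y \<noteq> 1 \<Longrightarrow> y \<le> a \<and> a + p < y + n \<or> a + p < y"
      using \<open>S - _ \<in> arc_complex n p\<close> unfolding arc_complex_def by blast
    have g: "el S 1 \<le> a \<and> a + p < el S 1 + n \<or> a + p < el S 1"
      "el S (card S - 1) \<le> a \<and> a + p < el S (card S - 1) + n \<or> a + p < el S (card S - 1)"
      using gap' mem less first by auto
    have "el S (card S - 1) \<in> {1..n}" using mem range by blast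
    then have "1 \<le> a \<and> a + p < 1 + n \<or> a + p < 1"
      using g less gap first a by auto
    then have "S \<in> arc_complex n p"
      using gap' a range mem by (intro arc_complexI[of S n a]) auto
    then show False using S by (simp add: dense_sets_def)
  qed
  moreover have "S - {1} \<noteq> {}" using mem(1) less first by auto
  ultimately show ?thesis using range by (auto simp: dense_sets_def)
qed

text \<open>At the first index where the next element differs from the target, it comes either after
  the target, and S is a lower set, or before it. In the latter case removing the element at that
  index keeps the set dense, and it remains to see that the matching rule puts this element
  back.\<close>

lemma dense_trichotomy:
  assumes S: "S \<in> dense_sets n p"
  shows "S \<in> lower_sets n p \<or> (\<exists>S0\<in>lower_sets n p. S = insert (partner n p S0) S0) \<or> critical n p S"
proof (cases "S \<in> lower_sets n p \<or> critical n p S")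
  case False
  have fin: "finite S" using S by (rule dense_sets_finite)
  have one: "1 \<in> S" using False S by (auto simp: lower_sets_def)
  define bad where "bad i \<longleftrightarrow> Suc i < card S \<and> el S (Suc i) \<noteq> target n p S i" for i
  define i where "i = (LEAST i. bad i)"
  have "\<exists>i. bad i" using False S one by (auto simp: critical_def bad_def)
  then have "bad i" unfolding i_def by (rule LeastI_ex)
  then have i: "Suc i < card S" "el S (Suc i) \<noteq> target n p S i" by (auto simp: bad_def)
  have before: "el S (Suc j) = target n p S j" if "j < i" for j
    using not_less_Least[of j bad] that i(1) unfolding i_def[symmetric] by (auto simp: bad_def)
  have less: "el S (Suc i) < target n p S i"
  proof (rule ccontr)
    assume "\<not> ?thesis"
    then have "insertable n p S i" using one i before by (auto simp: insertable_def)
    then show False using False S by (auto simp: lower_sets_def)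
  qed
  show ?thesis
  proof (cases i)
    case 0
    have "S - {1} \<in> dense_sets n p"
      using i less target_0[OF S] by (intro delete_dense_first[OF S one]) (auto simp: 0)
    then have "S - {1} \<in> lower_sets n p" by (simp add: lower_sets_def)
    moreover have "S = insert (partner n p (S - {1})) (S - {1})" using one by (auto simp: partner_def)
    ultimately show ?thesis by blast
  next
    case (Suc m)
    \<comment> \<open>By minimality of i the removed element is the target at m = i - 1. Targets up
      to m do not change, so S0 is insertable at m and gets this very element back.\<close>
    define S0 where "S0 = S - {el S i}"
    have card0: "card S0 = card S - 1" using fin i el_in[OF fin, of i] by (simp add: S0_def)
    have D: "S0 \<in> dense_sets n p"
      unfolding S0_def Suc using i less by (intro delete_dense_inner[OF S]) (auto simp: Suc target_Suc)
    have el0: "el S0 j = (if j < i then el S j else el S (Suc j))" if "j < card S - 1" for j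
      unfolding S0_def by (rule el_delete[OF fin _ that]) (use i in simp)
    have one0: "1 \<in> S0"
      using one el_less[OF fin, of 0 i] i Suc el_0_eq_1[OF S one] by (auto simp: S0_def)
    have tgt: "target n p S0 j = target n p S j" if "j \<le> m" for j
    proof (cases j)
      case 0
      \<comment> \<open>The removed index is not the last one, so the target at 0, which depends on
        the last element, is kept.\<close>
      have "el S0 (card S0 - 1) = el S (card S - 1)"
        using i Suc el0[of "card S0 - 1"] by (simp add: card0 Suc_diff_Suc)
      then show ?thesis by (simp add: 0 target_def)
    next
      case (Suc k)
      then show ?thesis using that i \<open>i = Suc m\<close> by (simp add: target_Suc el0)
    qed
    have im: "el S i = target n p S m" using before[of m] Suc by simp
    have "insertable n p S0 m"
      unfolding insertable_def
    proof (intro conjI allI impI)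
      show "Suc m < card S0" using i Suc by (simp add: card0)
      show "el S0 (Suc j) = target n p S0 j" if "j < m" for j
        using that before[of j] i Suc by (simp add: el0 tgt)
      show "target n p S0 m < el S0 (Suc m)"
        using i Suc el_less[OF fin, of i "Suc i"] by (simp add: tgt el0 flip: im)
    qed (rule one0)
    then have "S0 \<in> lower_sets n p" "partner n p S0 = el S i"
      using D by (auto simp: lower_sets_def partner_insertable tgt im)
    moreover have "S = insert (el S i) S0" using el_in[OF fin, of i] i by (auto simp: S0_def)
    ultimately show ?thesis by metis
  qed
qed auto

section \<open>Positions in a critical set\<close>

lemma critical_even:
  assumes "critical n p S" "2 * j < card S"
  shows "el S (2 * j) = 1 + (p + 1) * j"
  using assms(2)
proof (induction j)
  case 0
  then show ?case using assms(1) el_0_eq_1[of S n p] by (simp add: critical_def)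
next
  case (Suc j)
  then have "el S (Suc (Suc (2 * j))) = target n p S (Suc (2 * j))"
    using assms(1) by (simp add: critical_def)
  then show ?case using Suc by (simp add: target_Suc algebra_simps)
qed

lemma critical_odd:
  assumes "critical n p S" "2 * j + 1 < card S"
  shows "el S (2 * j + 1) = el S 1 + (p + 1) * j"
  using assms(2)
proof (induction j)
  case (Suc j)
  then have "el S (Suc (Suc (2 * j + 1))) = target n p S (Suc (2 * j + 1))"
    using assms(1) by (simp add: critical_def)
  then show ?case using Suc by (simp add: target_Suc algebra_simps)
qed simp

text \<open>The even entries advance from 1 in steps of p + 1. The condition at index 0 adds one
  more step from the last of them, across n, and lands on \<open>el S 1\<close>.\<close>

lemma critical_second:
  assumes "critical n p S" "card S = 2 * l + 3"
  shows "el S 1 + n = 1 + (p + 1) * (l + 2)"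
proof -
  have S: "S \<in> dense_sets n p" using assms(1) by (simp add: critical_def)
  have "el S (2 * (l + 1)) = 1 + (p + 1) * (l + 1)"
    using assms by (intro critical_even) auto
  moreover have "el S 1 = target n p S 0" using assms by (auto simp: critical_def)
  ultimately show ?thesis using target_0[OF S] assms(2) by (simp add: algebra_simps)
qed

text \<open>Given the value of \<open>el S 1\<close>, the two inequalities say that it lies strictly
  between the entries 1 and p + 2.\<close>

lemma critical_range:
  assumes "critical n p S" "card S = 2 * l + 3"
  shows "(p + 1) * (l + 1) < n" "n < (p + 1) * (l + 2)"
proof -
  have fin: "finite S" using assms(2) by (metis card.infinite add_is_0 zero_neq_numeral)
  have "el S 0 < el S 1" "el S 1 < el S 2" using assms(2) by (auto intro: el_less[OF fin])
  moreover have "el S 0 = 1" "el S 2 = p + 2"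
    using critical_even[OF assms(1), of 0] critical_even[OF assms(1), of 1] assms(2) by auto
  ultimately show "(p + 1) * (l + 1) < n" "n < (p + 1) * (l + 2)"
    using critical_second[OF assms] by (auto simp: algebra_simps)
qed

text \<open>Both progressions, of even and of odd entries, have step p + 1, and their starting
  points are determined by n, p and l.\<close>

lemma critical_unique:
  assumes S: "critical n p S" "card S = 2 * l + 3" and T: "critical n p T" "card T = 2 * l + 3"
  shows "S = T"
proof -
  have fin: "finite S" "finite T" using S T by (auto simp: critical_def dense_sets_finite)
  have 1: "el S 1 = el T 1" using critical_second[OF S] critical_second[OF T] by simp
  have "el S i = el T i" if "i < 2 * l + 3" for i
  proof (cases "even i")
    case True
    then obtain j where "i = 2 * j" by blast
    then show ?thesis using critical_even[OF S(1), of j] critical_even[OF T(1), of j] that S T by simp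
  next
    case False
    then obtain j where "i = 2 * j + 1" by (elim oddE)
    then show ?thesis using critical_odd[OF S(1), of j] critical_odd[OF T(1), of j] that S T 1 by simp
  qed
  then have "el S ` {..<card S} = el T ` {..<card T}" using S T by auto
  then show ?thesis using el_image fin by simp
qed

section \<open>A cocycle on the arc complex\<close>

text \<open>With n appended as entry 2 l + 2, the conditions become uniform: successive entries are
  at most p apart, and successive even entries are more than p apart.\<close>

definition winding_pattern :: "nat \<Rightarrow> nat \<Rightarrow> nat \<Rightarrow> (nat \<Rightarrow> nat) \<Rightarrow> bool" where
  "winding_pattern n p l y \<longleftrightarrow>
     (\<forall>i<2 * l + 1. y (Suc i) \<le> y i + p) \<and>
     (\<forall>j<l. y (2 * j) + p < y (2 * j + 2)) \<and>
     y (2 * l) + p < n \<and> n \<le> y (2 * l + 1) + p"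

definition winding :: "nat \<Rightarrow> nat \<Rightarrow> nat \<Rightarrow> nat set \<Rightarrow> 'k::field" where
  "winding n p l \<sigma> = of_bool (card \<sigma> = 2 * l + 2 \<and> winding_pattern n p l (el \<sigma>))"

definition skip :: "nat \<Rightarrow> (nat \<Rightarrow> nat) \<Rightarrow> nat \<Rightarrow> nat" where
  "skip i x j = (if j < i then x j else x (Suc j))"

lemma winding_pattern_cong:
  assumes "\<And>i. i < 2 * l + 2 \<Longrightarrow> y i = z i"
  shows "winding_pattern n p l y \<longleftrightarrow> winding_pattern n p l z"
  using assms by (simp add: winding_pattern_def)

lemma step_sum:
  fixes y :: "nat \<Rightarrow> nat"
  assumes "\<And>j. j < k \<Longrightarrow> y j + c \<le> y (Suc j)"
  shows "y 0 + c * k \<le> y k"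
  using assms
proof (induction k)
  case (Suc k)
  then have "y 0 + c * k \<le> y k" "y k + c \<le> y (Suc k)" by auto
  then show ?case by (simp add: algebra_simps)
qed simp

lemma step_sum_upper:
  fixes y :: "nat \<Rightarrow> nat"
  assumes "\<And>j. j < k \<Longrightarrow> y (Suc j) \<le> y j + c"
  shows "y k \<le> y 0 + c * k"
  using assms
proof (induction k)
  case (Suc k)
  then have "y k \<le> y 0 + c * k" "y (Suc k) \<le> y k + c" by auto
  then show ?case by (simp add: algebra_simps)
qed simp

text \<open>From the first entry to n there are l + 1 even steps, each of length at least p +
  1.\<close>

lemma winding_pattern_first:
  assumes "winding_pattern n p l y" "n < (p + 1) * (l + 2)"
  shows "y 0 \<le> p"
proof -
  have "y (2 * 0) + (p + 1) * l \<le> y (2 * l)"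
    using assms(1) by (intro step_sum[of l "\<lambda>j. y (2 * j)"]) (auto simp: winding_pattern_def)
  moreover have "y (2 * l) + p < n" using assms(1) by (simp add: winding_pattern_def)
  ultimately show ?thesis using assms(2) by (simp add: algebra_simps)
qed

text \<open>A gap longer than p remains visible after deleting one entry, unless an end entry next
  to it is deleted. A gap after the first entry then contradicts
  \<open>winding_pattern_first\<close>, and one before the last entry contradicts the closing
  condition at n.\<close>

lemma no_pattern_if_inner_gap:
  assumes mono: "\<And>i j. i < j \<Longrightarrow> j < 2 * l + 3 \<Longrightarrow> x i < x j"
    and le_n: "x (2 * l + 2) \<le> n" and n: "n < (p + 1) * (l + 2)"
    and a: "a < 2 * l + 2" "x a + p < x (Suc a)" and i: "i < 2 * l + 3"
  shows "\<not> winding_pattern n p l (skip i x)"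
proof
  assume w: "winding_pattern n p l (skip i x)"
  have inner: "skip i x (Suc k) \<le> skip i x k + p" if "k < 2 * l + 1" for k
    using w that by (simp add: winding_pattern_def)
  consider "i < a" | "i = a" "0 < a" | "i = a" "a = 0" | "i = Suc a" "a < 2 * l + 1"
    | "i = Suc a" "a = 2 * l + 1" | "Suc a < i"
    using a(1) by linarith
  then show False
  proof cases
    case 1
    then obtain b where "a = Suc b" by (cases a) auto
    then show False using inner[of b] a 1 by (auto simp: skip_def split: if_splits)
  next
    case 2
    then obtain b where "a = Suc b" by (cases a) auto
    then show False using inner[of b] a 2 mono[of b a] by (auto simp: skip_def split: if_splits)
  next
    case 3
    then have "x (Suc 0) \<le> p" using winding_pattern_first[OF w n] by (simp add: skip_def)
    then show False using a 3 by simp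
  next
    case 4
    then show False using inner[of a] a mono[of "Suc a" "Suc (Suc a)"] by (auto simp: skip_def split: if_splits)
  next
    case 5
    then have "n \<le> x (2 * l + 1) + p" using w by (simp add: winding_pattern_def skip_def)
    then show False using a 5 le_n by simp
  next
    case 6
    then show False using inner[of a] a i by (auto simp: skip_def split: if_splits)
  qed
qed

lemma skip_inner:
  assumes "\<And>i. i < 2 * l + 2 \<Longrightarrow> x (Suc i) \<le> x i + p" and "i < 2 * l + 3"
  shows "(\<forall>k<2 * l + 1. skip i x (Suc k) \<le> skip i x k + p) \<longleftrightarrow>
    i = 0 \<or> i = 2 * l + 2 \<or> x (Suc i) \<le> x (i - 1) + p"
proof
  assume *: "\<forall>k<2 * l + 1. skip i x (Suc k) \<le> skip i x k + p"
  show "i = 0 \<or> i = 2 * l + 2 \<or> x (Suc i) \<le> x (i - 1) + p"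
  proof (cases "i = 0 \<or> i = 2 * l + 2")
    case False
    then obtain m where m: "i = Suc m" by (cases i) auto
    then have "m < 2 * l + 1" using False assms(2) by simp
    then show ?thesis using *[rule_format, of m] m by (simp add: skip_def)
  qed blast
next
  assume *: "i = 0 \<or> i = 2 * l + 2 \<or> x (Suc i) \<le> x (i - 1) + p"
  show "\<forall>k<2 * l + 1. skip i x (Suc k) \<le> skip i x k + p"
  proof (intro allI impI)
    fix k assume k: "k < 2 * l + 1"
    consider "Suc k < i" | "Suc k = i" | "i \<le> k" by linarith
    then show "skip i x (Suc k) \<le> skip i x k + p"
      by cases (use * k assms(1)[of k] assms(1)[of "Suc k"] in \<open>auto simp: skip_def\<close>)
  qed
qed

lemma sum_alternating_pairs:
  fixes f :: "nat \<Rightarrow> 'k::comm_ring_1"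
  shows "(\<Sum>i<2 * l + 1. (-1) ^ i * f i) = f 0 + (\<Sum>k<l. f (2 * k + 2) - f (2 * k + 1))"
  by (induction l) (simp_all add: algebra_simps)

text \<open>
  Deleting the entries \<open>2 k + 1\<close> and \<open>2 k + 2\<close> gives the same entries in even position, and the
  difference of the two terms is \<open>S (k + 1) - S k\<close>, so that the sum telescopes.
\<close>

lemma winding_alternating_sum:
  fixes x :: "nat \<Rightarrow> nat"
  assumes mono: "\<And>i j. i < j \<Longrightarrow> j < 2 * l + 3 \<Longrightarrow> x i < x j"
    and le_n: "x (2 * l + 2) \<le> n" and n: "n < (p + 1) * (l + 2)"
    and gap: "(\<exists>a<2 * l + 2. x a + p < x (Suc a)) \<or> x (2 * l + 2) + p < x 0 + n"
  shows "(\<Sum>i<2 * l + 3. (-1) ^ i * of_bool (winding_pattern n p l (skip i x))) = (0 :: 'k::comm_ring_1)"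
proof (cases "\<exists>a<2 * l + 2. x a + p < x (Suc a)")
  case True
  then obtain a where a: "a < 2 * l + 2" "x a + p < x (Suc a)" by blast
  show ?thesis
    using no_pattern_if_inner_gap[where x = x, OF mono le_n n a] by (intro sum.neutral) simp
next
  case False
  then have inner: "x (Suc i) \<le> x i + p" if "i < 2 * l + 2" for i using that by (meson not_le)
  have outer: "x (2 * l + 2) + p < x 0 + n" using gap False by blast
  have skip_iff: "(\<forall>k<2 * l + 1. skip i x (Suc k) \<le> skip i x k + p) \<longleftrightarrow>
      i = 0 \<or> i = 2 * l + 2 \<or> x (Suc i) \<le> x (i - 1) + p" if "i < 2 * l + 3" for i
    using skip_inner[of l x p i] inner that by blast
  \<comment> \<open>Long steps between even entries and between odd entries. After deletion of entry
    2 k + 1 or 2 k + 2 the even positions hold even entries up to 2 k and odd ones from 2 k + 3 on,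
    so that C is the step at the change; it follows from A as well as from B.\<close>
  define A B where "A k \<longleftrightarrow> x (2 * k) + p < x (2 * k + 2)" and "B k \<longleftrightarrow> x (2 * k + 1) + p < x (2 * k + 3)" for k
  define C where "C k \<longleftrightarrow> x (2 * k) + p < x (2 * k + 3)" for k
  define Q where "Q \<longleftrightarrow> x (2 * l + 1) + p < n \<and> n \<le> x (2 * l + 2) + p"
  \<comment> \<open>Long even steps before k, long odd steps from k on, and the closing condition
    for the odd entries; no step joins the two halves.\<close>
  define S :: "nat \<Rightarrow> 'k" where "S k = of_bool ((\<forall>j<k. A j) \<and> (\<forall>j\<in>{k..<l}. B j) \<and> Q)" for k
  define t :: "nat \<Rightarrow> 'k" where "t i = of_bool (winding_pattern n p l (skip i x))" for i
  have AC: "C k" if "A k" "k < l" for k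
    using that mono[of "2 * k + 2" "2 * k + 3"] by (simp add: A_def C_def)
  have BC: "C k" if "B k" "k < l" for k
    using that mono[of "2 * k" "2 * k + 1"] by (simp add: B_def C_def)
  have t0: "t 0 = S 0"
    unfolding t_def S_def winding_pattern_def
    by (subst skip_iff) (auto simp: skip_def B_def Q_def numeral_3_eq_3)
  have evens: "(\<forall>j<l. skip i x (2 * j) + p < skip i x (2 * j + 2)) \<longleftrightarrow>
      (\<forall>j<k. A j) \<and> C k \<and> (\<forall>j\<in>{Suc k..<l}. B j)"
    if i: "i = 2 * k + 1 \<or> i = 2 * k + 2" and k: "k < l" for i k
  proof -
    have "skip i x (2 * j) + p < skip i x (2 * j + 2) \<longleftrightarrow> (if j < k then A j else if j = k then C k else B j)" for j
      using i by (auto simp: skip_def A_def B_def C_def numeral_3_eq_3)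
    moreover have "(\<forall>j<l. if j < k then A j else if j = k then C k else B j) \<longleftrightarrow>
        (\<forall>j<k. A j) \<and> C k \<and> (\<forall>j\<in>{Suc k..<l}. B j)"
    proof
      assume *: "\<forall>j<l. if j < k then A j else if j = k then C k else B j"
      have "A j" if "j < k" for j using *[rule_format, of j] that k by simp
      moreover have "C k" using *[rule_format, of k] k by simp
      moreover have "B j" if "j \<in> {Suc k..<l}" for j using *[rule_format, of j] that by simp
      ultimately show "(\<forall>j<k. A j) \<and> C k \<and> (\<forall>j\<in>{Suc k..<l}. B j)" by blast
    qed auto
    ultimately show ?thesis by simp
  qed
  have ends: "skip i x (2 * l) = x (2 * l + 1)" "skip i x (2 * l + 1) = x (2 * l + 2)"
    if "i = 2 * k + 1 \<or> i = 2 * k + 2" "k < l" for i k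
    using that by (auto simp: skip_def)
  \<comment> \<open>Deleting entry 2 k + 1 requires its neighbours to be close, that is, the
    negation of A; deleting 2 k + 2 requires that of B. As A and B both imply C, the difference of
    the indicators is that of A minus that of B.\<close>
  have step: "t (2 * k + 2) - t (2 * k + 1) = S (Suc k) - S k" if k: "k < l" for k
  proof -
    have t1: "t (2 * k + 1) = of_bool (\<not> A k \<and> (\<forall>j<k. A j) \<and> C k \<and> (\<forall>j\<in>{Suc k..<l}. B j) \<and> Q)"
    proof -
      have "(\<forall>j<2 * l + 1. skip (2 * k + 1) x (Suc j) \<le> skip (2 * k + 1) x j + p) \<longleftrightarrow> \<not> A k"
        using k by (subst skip_iff) (auto simp: A_def)
      then show ?thesis
        unfolding t_def winding_pattern_def using evens[OF disjI1[OF refl] k] ends[OF disjI1[OF refl] k]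
        by (simp add: Q_def)
    qed
    have t2: "t (2 * k + 2) = of_bool (\<not> B k \<and> (\<forall>j<k. A j) \<and> C k \<and> (\<forall>j\<in>{Suc k..<l}. B j) \<and> Q)"
    proof -
      have "(\<forall>j<2 * l + 1. skip (2 * k + 2) x (Suc j) \<le> skip (2 * k + 2) x j + p) \<longleftrightarrow> \<not> B k"
        using k by (subst skip_iff) (auto simp: B_def numeral_3_eq_3)
      then show ?thesis
        unfolding t_def winding_pattern_def using evens[OF disjI2[OF refl] k] ends[OF disjI2[OF refl] k]
        by (simp add: Q_def)
    qed
    have "{k..<l} = insert k {Suc k..<l}" using k by auto
    then have Sk: "S k = of_bool ((\<forall>j<k. A j) \<and> B k \<and> (\<forall>j\<in>{Suc k..<l}. B j) \<and> Q)"
      by (simp add: S_def)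
    have Sk': "S (Suc k) = of_bool ((\<forall>j<k. A j) \<and> A k \<and> (\<forall>j\<in>{Suc k..<l}. B j) \<and> Q)"
      by (auto simp: S_def less_Suc_eq)
    show ?thesis
      unfolding t1 t2 Sk Sk' using AC[OF _ k] BC[OF _ k]
      by (cases "A k"; cases "B k"; cases "C k") auto
  qed
  have t_odd: "t (2 * l + 1) = of_bool (\<not> A l \<and> (\<forall>j<l. A j) \<and> x (2 * l) + p < n \<and> n \<le> x (2 * l + 2) + p)"
    unfolding t_def winding_pattern_def
    by (subst skip_iff) (auto simp: skip_def A_def)
  have t_even: "t (2 * l + 2) = of_bool ((\<forall>j<l. A j) \<and> x (2 * l) + p < n \<and> n \<le> x (2 * l + 1) + p)"
    unfolding t_def winding_pattern_def
    by (subst skip_iff) (auto simp: skip_def A_def)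
  have last: "S l + t (2 * l + 2) = t (2 * l + 1)"
  proof (cases "\<forall>j<l. A j")
    case True
    \<comment> \<open>The gap across n enters here: l + 1 long even steps together with it would
      need at least (p + 1) (l + 2) positions.\<close>
    have "\<not> A l"
    proof
      assume "A l"
      have "x (2 * 0) + (p + 1) * Suc l \<le> x (2 * Suc l)"
        using True \<open>A l\<close> by (intro step_sum[of "Suc l" "\<lambda>j. x (2 * j)"]) (auto simp: A_def less_Suc_eq)
      then show False using outer n by (simp add: algebra_simps)
    qed
    moreover have "x (2 * l) < x (2 * l + 1)" "x (2 * l + 1) < x (2 * l + 2)" by (simp_all add: mono)
    ultimately show ?thesis using True unfolding S_def Q_def t_odd t_even by auto
  next
    case False
    then have no: "((\<forall>j<l. A j) \<and> R) = False" for R by blast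
    show ?thesis unfolding S_def t_odd t_even no by simp
  qed
  have "(\<Sum>i<2 * l + 3. (-1) ^ i * t i) = t 0 + (\<Sum>k<Suc l. t (2 * k + 2) - t (2 * k + 1))"
    using sum_alternating_pairs[of t "Suc l"] by (simp add: numeral_3_eq_3)
  also have "\<dots> = S 0 + (\<Sum>k<l. S (Suc k) - S k) + (t (2 * l + 2) - t (2 * l + 1))"
    using step by (simp add: t0)
  also have "(\<Sum>k<l. S (Suc k) - S k) = S l - S 0" by (rule sum_lessThan_telescope)
  finally show ?thesis using last by (simp add: t_def algebra_simps)
qed

text \<open>Listing the vertices of T in increasing order turns the value on its boundary into the
  alternating sum over deleted positions. The gap of T provides the hypothesis of that
  identity.\<close>

lemma winding_cocycle:
  assumes T: "T \<in> arc_complex n p" and n: "n < (p + 1) * (l + 2)"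
  shows "pairing (winding n p l) (simplex_boundary T) = (0 :: 'k::field)"
proof (cases "card T = 2 * l + 3")
  case False
  have "winding n p l (T - {v}) = (0 :: 'k)" if "v \<in> T" for v
    using False that arc_complex_finite[OF T] by (auto simp: winding_def card_Diff_singleton)
  then show ?thesis by (simp add: pairing_simplex_boundary)
next
  case True
  have fin: "finite T" using T by (rule arc_complex_finite)
  have bij: "bij_betw (el T) {..<2 * l + 3} T"
    unfolding bij_betw_def
  proof
    show "inj_on (el T) {..<2 * l + 3}"
      using True el_less[OF fin] by (intro linorder_inj_onI) (auto simp: neq_iff)
    show "el T ` {..<2 * l + 3} = T" using el_image[OF fin] True by simp
  qed
  have "pairing (winding n p l) (simplex_boundary T)
      = (\<Sum>v\<in>T. face_sign T v * winding n p l (T - {v}) :: 'k)"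
    using True by (simp add: pairing_simplex_boundary)
  also have "\<dots> = (\<Sum>i<2 * l + 3. face_sign T (el T i) * winding n p l (T - {el T i}))"
    by (rule sum.reindex_bij_betw[OF bij, symmetric])
  also have "\<dots> = (\<Sum>i<2 * l + 3. (-1) ^ i * of_bool (winding_pattern n p l (skip i (el T))))"
  proof (rule sum.cong)
    fix i assume "i \<in> {..<2 * l + 3}"
    then have i: "i < card T" using True by simp
    have "card (T - {el T i}) = 2 * l + 2" using el_in[OF fin i] True fin by simp
    moreover have "winding_pattern n p l (el (T - {el T i})) \<longleftrightarrow> winding_pattern n p l (skip i (el T))"
      by (rule winding_pattern_cong) (simp add: el_delete[OF fin i] skip_def True)
    ultimately show "face_sign T (el T i) * winding n p l (T - {el T i})
        = (-1) ^ i * of_bool (winding_pattern n p l (skip i (el T)))"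
      using card_below_el[OF fin i] by (simp add: winding_def)
  qed simp
  also have "\<dots> = 0"
  proof (rule winding_alternating_sum[OF _ _ n])
    show "el T i < el T j" if "i < j" "j < 2 * l + 3" for i j using that True by (intro el_less[OF fin]) auto
    have "el T (2 * l + 2) \<in> T" using True by (intro el_in[OF fin]) simp
    then show "el T (2 * l + 2) \<le> n" using T by (auto simp: arc_complex_def)
    show "(\<exists>a<2 * l + 2. el T a + p < el T (Suc a)) \<or> el T (2 * l + 2) + p < el T 0 + n"
      using arc_complex_gap[OF T] True by (metis Suc_less_eq add_Suc_right diff_Suc_1 numeral_2_eq_2 numeral_3_eq_3)
  qed
  finally show ?thesis .
qed

section \<open>A cycle made of adjacent pairs\<close>

fun paired :: "nat list \<Rightarrow> bool" where
  "paired [] \<longleftrightarrow> True"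
| "paired [a] \<longleftrightarrow> False"
| "paired (a # b # xs) \<longleftrightarrow> b = Suc a \<and> paired xs"

lemma paired_iff_nth:
  "paired xs \<longleftrightarrow> even (length xs) \<and> (\<forall>j. Suc (2 * j) < length xs \<longrightarrow> xs ! Suc (2 * j) = Suc (xs ! (2 * j)))"
proof (induction xs rule: paired.induct)
  case (3 a b xs)
  have "(\<forall>j. Suc (2 * j) < length (a # b # xs) \<longrightarrow> (a # b # xs) ! Suc (2 * j) = Suc ((a # b # xs) ! (2 * j)))
    \<longleftrightarrow> b = Suc a \<and> (\<forall>j. Suc (2 * j) < length xs \<longrightarrow> xs ! Suc (2 * j) = Suc (xs ! (2 * j)))" (is "?L \<longleftrightarrow> ?R")
  proof
    assume L: ?L
    have "b = Suc a" using L[rule_format, of 0] by simp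
    moreover have "xs ! Suc (2 * j) = Suc (xs ! (2 * j))" if "Suc (2 * j) < length xs" for j
      using L[rule_format, of "Suc j"] that by simp
    ultimately show ?R by blast
  next
    assume R: ?R
    show ?L
    proof (intro allI impI)
      fix j assume "Suc (2 * j) < length (a # b # xs)"
      then show "(a # b # xs) ! Suc (2 * j) = Suc ((a # b # xs) ! (2 * j))"
        using R by (cases j) auto
    qed
  qed
  then show ?case using 3 by simp blast
qed auto

text \<open>Up to sign, the boundary coefficient of the face consisting of 1 and \<open>xs\<close>,
  for lo = 1. The bound \<open>lo\<close> is a parameter because the recursion passes over a leading
  pair and continues to its right.\<close>

definition insertion_sum :: "nat \<Rightarrow> nat \<Rightarrow> nat list \<Rightarrow> 'k::comm_ring_1" where
  "insertion_sum n lo xs = (\<Sum>v\<in>{lo<..n} - set xs.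
     (-1) ^ length (filter (\<lambda>u. u < v) xs) * of_bool (paired (insort v xs)))"

lemma insort_before: "\<forall>u\<in>set xs. v < u \<Longrightarrow> insort v xs = v # xs" for v :: nat
  by (cases xs) auto

text \<open>
  Inserting \<open>v\<close> next to the entry that has no partner is possible on either side of it, with opposite
  signs, unless the neighbouring position is taken; so the sum telescopes.
\<close>

lemma insertion_sum_eq:
  assumes "sorted_wrt (<) xs" "set xs \<subseteq> {lo<..n}" "odd (length xs)"
  shows "insertion_sum n lo xs =
    of_bool (paired (butlast xs) \<and> last xs = n) - (of_bool (hd xs = Suc lo \<and> paired (tl xs)) :: 'k::comm_ring_1)"
  using assms
proof (induction xs arbitrary: lo rule: paired.induct)
  case (2 a)
  then have a: "lo < a" "a \<le> n" by auto
  have split: "{lo<..n} - set [a] = {lo<..<a} \<union> {a<..n}" using a by auto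
  have "insertion_sum n lo [a] = (\<Sum>v\<in>{lo<..<a}. of_bool (a = Suc v)) + (\<Sum>v\<in>{a<..n}. - of_bool (v = Suc a) :: 'k)"
    unfolding insertion_sum_def split by (subst sum.union_disjoint) (auto intro!: arg_cong2[where f = "(+)"] sum.cong)
  also have "(\<Sum>v\<in>{lo<..<a}. of_bool (a = Suc v) :: 'k) = of_bool (a \<noteq> Suc lo)"
  proof -
    have "(\<Sum>v\<in>{lo<..<a}. of_bool (a = Suc v) :: 'k) = (\<Sum>v\<in>{lo<..<a}. if v = a - 1 then 1 else 0)"
      by (rule sum.cong) auto
    then show ?thesis using a by auto
  qed
  also have "(\<Sum>v\<in>{a<..n}. - of_bool (v = Suc a) :: 'k) = - of_bool (a \<noteq> n)"
  proof -
    have "(\<Sum>v\<in>{a<..n}. - of_bool (v = Suc a) :: 'k) = (\<Sum>v\<in>{a<..n}. if v = Suc a then -1 else 0)"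
      by (rule sum.cong) auto
    then show ?thesis using a by auto
  qed
  finally show ?case by auto
next
  case (3 a b r)
  have ab: "lo < a" "a < b" "b \<le> n" and r: "\<forall>u\<in>set r. b < u" "\<forall>u\<in>set r. a < u" "set r \<subseteq> {b<..n}"
    "sorted_wrt (<) r" "odd (length r)"
    using "3.prems" by auto
  have "r \<noteq> []" using r(5) by auto
  define P E where "P \<longleftrightarrow> paired (b # r)" and "E \<longleftrightarrow> paired (butlast r) \<and> last r = n"
  have P: "hd r = Suc b \<and> paired (tl r) \<longleftrightarrow> P" using \<open>r \<noteq> []\<close> by (cases r) (auto simp: P_def)
  let ?f = "\<lambda>v. (-1) ^ length (filter (\<lambda>u. u < v) (a # b # r)) * of_bool (paired (insort v (a # b # r))) :: 'k"
  have split: "{lo<..n} - set (a # b # r) = {lo<..<a} \<union> ({a<..<b} \<union> ({b<..n} - set r))"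
    using ab r by auto
  have no_r: "filter (\<lambda>u. u < v) r = []" if "v \<le> b" for v
    using r(1) that by (auto simp: filter_empty_conv)
  have before: "insort v (a # b # r) = v # a # b # r" if "v < a" for v
    using that by simp
  have "insertion_sum n lo (a # b # r) = sum ?f {lo<..<a} + (sum ?f {a<..<b} + sum ?f ({b<..n} - set r))"
    unfolding insertion_sum_def split using ab by (subst sum.union_disjoint; (subst sum.union_disjoint)?) auto
  also have "sum ?f {lo<..<a} = (\<Sum>v\<in>{lo<..<a}. if v = a - 1 then of_bool P else 0)"
    using ab no_r by (intro sum.cong) (auto simp: P_def)
  also have "\<dots> = of_bool (a \<noteq> Suc lo \<and> P)" using ab by auto
  also have "sum ?f {a<..<b} = (\<Sum>v\<in>{a<..<b}. if v = Suc a then - of_bool P else 0)"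
    using ab no_r by (intro sum.cong) (auto simp: P_def)
  also have "\<dots> = - of_bool (b \<noteq> Suc a \<and> P)" using ab by auto
  also have "sum ?f ({b<..n} - set r) = of_bool (b = Suc a) * insertion_sum n b r"
    unfolding insertion_sum_def sum_distrib_left using ab by (intro sum.cong) auto
  also have "insertion_sum n b r = of_bool E - (of_bool P :: 'k)"
    using "3.IH"[OF r(4,3,5)] by (simp add: P E_def)
  finally show ?case
    using \<open>r \<noteq> []\<close> by (cases "a = Suc lo"; cases "b = Suc a"; cases P) (auto simp: E_def P_def)
qed simp

text \<open>The triangulation of the cyclic polytope of dimension 2 l + 2 that cones the facets
  avoiding vertex 1 from that vertex. Its boundary is a cycle without further proof.\<close>

definition pair_chain :: "nat \<Rightarrow> nat \<Rightarrow> (nat set \<Rightarrow>\<^sub>0 'k::field)" where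
  "pair_chain n l = (\<Sum>\<tau>\<in>{\<tau>. \<tau> \<subseteq> {1..n} \<and> card \<tau> = 2 * l + 3 \<and> 1 \<in> \<tau> \<and> paired (tl (sorted_list_of_set \<tau>))}.
     Poly_Mapping.single \<tau> 1)"

definition pair_cycle :: "nat \<Rightarrow> nat \<Rightarrow> (nat set \<Rightarrow>\<^sub>0 'k::field)" where
  "pair_cycle n l = boundary (pair_chain n l)"

lemma lookup_pair_chain:
  "Poly_Mapping.lookup (pair_chain n l) \<tau> =
     of_bool (\<tau> \<subseteq> {1..n} \<and> card \<tau> = 2 * l + 3 \<and> 1 \<in> \<tau> \<and> paired (tl (sorted_list_of_set \<tau>)))"
proof -
  have "finite {\<tau>. \<tau> \<subseteq> {1..n} \<and> card \<tau> = 2 * l + 3 \<and> 1 \<in> \<tau> \<and> paired (tl (sorted_list_of_set \<tau>))}"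
    by (rule finite_subset[of _ "Pow {1..n}"]) auto
  then show ?thesis by (auto simp: pair_chain_def lookup_sum lookup_single when_def)
qed

text \<open>Summing over the cofaces of \<sigma>, not over the simplices of c, expresses the
  coefficient by insertions into a sorted list.\<close>

lemma lookup_boundary_insert:
  assumes fin: "finite W" and keys: "\<forall>\<tau>\<in>Poly_Mapping.keys c. \<tau> \<subseteq> W" and \<sigma>: "\<sigma> \<subseteq> W" "\<sigma> \<noteq> {}"
  shows "Poly_Mapping.lookup (boundary c) \<sigma> =
    (\<Sum>v\<in>W - \<sigma>. face_sign \<sigma> v * Poly_Mapping.lookup c (insert v \<sigma>) :: 'k::field)"
proof -
  have fins: "finite \<sigma>" using \<sigma>(1) fin finite_subset by blast
  have inj: "inj_on (\<lambda>v. insert v \<sigma>) (W - \<sigma>)" by (auto simp: inj_on_def)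
  have "Poly_Mapping.lookup (boundary c) \<sigma> =
      (\<Sum>\<tau>\<in>Pow W. Poly_Mapping.lookup c \<tau> * Poly_Mapping.lookup (simplex_boundary \<tau>) \<sigma>)"
    unfolding lookup_boundary by (rule pairing_eq_sum) (use fin keys in auto)
  also have "\<dots> = (\<Sum>\<tau>\<in>(\<lambda>v. insert v \<sigma>) ` (W - \<sigma>).
      Poly_Mapping.lookup c \<tau> * Poly_Mapping.lookup (simplex_boundary \<tau>) \<sigma>)"
  proof (rule sum.mono_neutral_right)
    show "\<forall>\<tau>\<in>Pow W - (\<lambda>v. insert v \<sigma>) ` (W - \<sigma>).
        Poly_Mapping.lookup c \<tau> * Poly_Mapping.lookup (simplex_boundary \<tau>) \<sigma> = 0"
    proof
      fix \<tau> assume \<tau>: "\<tau> \<in> Pow W - (\<lambda>v. insert v \<sigma>) ` (W - \<sigma>)"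
      have "Poly_Mapping.lookup (simplex_boundary \<tau>) \<sigma> = (0 :: 'k)"
      proof (rule ccontr)
        assume "\<not> ?thesis"
        then obtain v where "v \<in> \<tau>" "\<sigma> = \<tau> - {v}" by (rule lookup_simplex_boundary_nonzero)
        then have "\<tau> = insert v \<sigma>" "v \<in> W - \<sigma>" using \<tau> by auto
        then show False using \<tau> by blast
      qed
      then show "Poly_Mapping.lookup c \<tau> * Poly_Mapping.lookup (simplex_boundary \<tau>) \<sigma> = 0" by simp
    qed
  qed (use fin \<sigma> in auto)
  also have "\<dots> = (\<Sum>v\<in>W - \<sigma>. face_sign \<sigma> v * Poly_Mapping.lookup c (insert v \<sigma>))"
    unfolding sum.reindex[OF inj] comp_def
    by (rule sum.cong) (use fins \<sigma> in \<open>auto simp: lookup_simplex_boundary_insert\<close>)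
  finally show ?thesis .
qed

lemma card_less_eq_filter:
  assumes "finite S"
  shows "card {u\<in>S. u < v} = length (filter (\<lambda>u. u < v) (sorted_list_of_set S))"
proof -
  have "{u\<in>S. u < v} = set (filter (\<lambda>u. u < v) (sorted_list_of_set S))" using assms by auto
  also have "card \<dots> = length (filter (\<lambda>u. u < v) (sorted_list_of_set S))"
    by (intro distinct_card distinct_filter) simp
  finally show ?thesis .
qed

text \<open>The surviving faces are those of Gale's evenness condition. A face without 1 arises only
  by deleting 1. A face containing 1 is governed by \<open>insertion_sum\<close> of its tail, whose
  two end terms yield the unions of pairs and, with sign -1, those in which n and 1 form a
  pair.\<close>

lemma lookup_pair_cycle:
  assumes \<sigma>: "\<sigma> \<subseteq> {1..n}" "card \<sigma> = 2 * l + 2"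
  defines "xs \<equiv> sorted_list_of_set \<sigma>"
  shows "Poly_Mapping.lookup (pair_cycle n l) \<sigma> =
    of_bool (paired xs) - (of_bool (hd xs = 1 \<and> last xs = n \<and> paired (butlast (tl xs))) :: 'k::field)"
proof -
  have fin: "finite \<sigma>" using \<sigma>(1) finite_subset by blast
  have set_xs: "set xs = \<sigma>" and sorted: "sorted_wrt (<) xs" and len: "length xs = 2 * l + 2"
    using fin \<sigma>(2) by (auto simp: xs_def sorted_list_of_set.strict_sorted_key_list_of_set)
  have keys: "\<tau> \<subseteq> {1..n}" if "\<tau> \<in> Poly_Mapping.keys (pair_chain n l :: _ \<Rightarrow>\<^sub>0 'k)" for \<tau>
    using that by (auto simp: in_keys_iff lookup_pair_chain)
  have ne: "\<sigma> \<noteq> {}" using \<sigma>(2) by auto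
  have "Poly_Mapping.lookup (pair_cycle n l) \<sigma>
      = (\<Sum>v\<in>{1..n} - \<sigma>. face_sign \<sigma> v * Poly_Mapping.lookup (pair_chain n l) (insert v \<sigma>) :: 'k)"
    unfolding pair_cycle_def by (rule lookup_boundary_insert) (use keys \<sigma> ne in auto)
  also have "\<dots> = (\<Sum>v\<in>{1..n} - \<sigma>. (-1) ^ length (filter (\<lambda>u. u < v) xs)
      * of_bool (1 \<in> insert v \<sigma> \<and> paired (tl (insort v xs))))"
  proof (rule sum.cong)
    fix v assume v: "v \<in> {1..n} - \<sigma>"
    have "sorted_list_of_set (insert v \<sigma>) = insort v xs" using v fin by (simp add: xs_def)
    then show "face_sign \<sigma> v * Poly_Mapping.lookup (pair_chain n l) (insert v \<sigma>)
        = (-1) ^ length (filter (\<lambda>u. u < v) xs) * (of_bool (1 \<in> insert v \<sigma> \<and> paired (tl (insort v xs))) :: 'k)"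
      using v \<sigma> fin by (simp add: lookup_pair_chain card_less_eq_filter xs_def)
  qed simp
  also have "\<dots> = of_bool (paired xs) - of_bool (hd xs = 1 \<and> last xs = n \<and> paired (butlast (tl xs)))"
  proof (cases "1 \<in> \<sigma>")
    case False
    have gt: "\<forall>u\<in>set xs. 1 < u"
    proof
      fix u assume "u \<in> set xs"
      then have "u \<in> {1..n}" "u \<noteq> 1" using False \<sigma>(1) set_xs by auto
      then show "1 < u" by simp
    qed
    have "xs \<noteq> []" using len by auto
    then have "1 < hd xs" using gt by simp
    then have "hd xs \<noteq> 1" by simp
    have e: "filter (\<lambda>u. u < 1) xs = []" using gt by (auto simp: filter_empty_conv)
    have "n \<ge> 1" using \<sigma>(1) ne by force
    have "(\<Sum>v\<in>{1..n} - \<sigma>. (-1) ^ length (filter (\<lambda>u. u < v) xs)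
        * of_bool (1 \<in> insert v \<sigma> \<and> paired (tl (insort v xs)))) =
        (\<Sum>v\<in>{1..n} - \<sigma>. if v = 1 then of_bool (paired xs) else (0 :: 'k))"
      using False e insort_before[OF gt] by (intro sum.cong) auto
    also have "\<dots> = of_bool (paired xs)" using False \<open>n \<ge> 1\<close> by simp
    finally show ?thesis using \<open>hd xs \<noteq> 1\<close> by simp
  next
    case True
    obtain a ys where xs: "xs = a # ys" using len by (cases xs) auto
    have "a = 1"
    proof -
      have "1 \<in> set xs" using True set_xs by simp
      moreover have "a \<in> {1..n}" using xs set_xs \<sigma>(1) by auto
      ultimately show ?thesis using sorted xs by auto
    qed
    have ys: "sorted_wrt (<) ys" "set ys \<subseteq> {1<..n}" "odd (length ys)"
      using sorted set_xs \<sigma>(1) xs len \<open>a = 1\<close> by (auto dest: arg_cong[of _ _ even])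
    then have "ys \<noteq> []" by auto
    have D: "{1..n} - \<sigma> = {1<..n} - set ys" using set_xs xs \<open>a = 1\<close> by auto
    \<comment> \<open>The leading 1 is below every inserted v and contributes one more factor
      -1.\<close>
    have "(\<Sum>v\<in>{1..n} - \<sigma>. (-1) ^ length (filter (\<lambda>u. u < v) xs)
        * of_bool (1 \<in> insert v \<sigma> \<and> paired (tl (insort v xs)))) = - (insertion_sum n 1 ys :: 'k)"
      unfolding insertion_sum_def sum_negf[symmetric] D
      by (rule sum.cong) (use True xs \<open>a = 1\<close> in auto)
    also have "\<dots> = of_bool (hd ys = Suc 1 \<and> paired (tl ys)) - of_bool (paired (butlast ys) \<and> last ys = n)"
      unfolding insertion_sum_eq[OF ys] by simp
    also have "hd ys = Suc 1 \<and> paired (tl ys) \<longleftrightarrow> paired xs"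
      using \<open>ys \<noteq> []\<close> xs \<open>a = 1\<close> by (cases ys) auto
    finally show ?thesis using xs \<open>a = 1\<close> \<open>ys \<noteq> []\<close> by (simp add: conj_commute)
  qed
  finally show ?thesis .
qed

lemma keys_pair_cycle:
  assumes "\<sigma> \<in> Poly_Mapping.keys (pair_cycle n l)"
  shows "\<sigma> \<subseteq> {1..n}" "card \<sigma> = 2 * l + 2"
proof -
  obtain \<tau> v where "\<tau> \<in> Poly_Mapping.keys (pair_chain n l :: _ \<Rightarrow>\<^sub>0 'a)" "v \<in> \<tau>" "\<sigma> = \<tau> - {v}"
    using assms unfolding pair_cycle_def by (rule keys_boundary)
  then show "\<sigma> \<subseteq> {1..n}" "card \<sigma> = 2 * l + 2"
    by (auto simp: in_keys_iff lookup_pair_chain card_Diff_singleton)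
qed

lemma keys_pair_cycle_cases:
  assumes "\<sigma> \<in> Poly_Mapping.keys (pair_cycle n l :: _ \<Rightarrow>\<^sub>0 'k::field)"
  obtains (pairs) "\<And>j. j \<le> l \<Longrightarrow> el \<sigma> (2 * j + 1) = el \<sigma> (2 * j) + 1"
  | (wrapped) "el \<sigma> 0 = 1" "el \<sigma> (2 * l + 1) = n" "\<And>j. j < l \<Longrightarrow> el \<sigma> (2 * j + 2) = el \<sigma> (2 * j + 1) + 1"
proof -
  note \<sigma> = keys_pair_cycle[OF assms]
  let ?xs = "sorted_list_of_set \<sigma>"
  have len: "length ?xs = 2 * l + 2" using \<sigma> by simp
  then have ne: "?xs \<noteq> []" by (metis add_is_0 list.size(3) zero_neq_numeral)
  have "Poly_Mapping.lookup (pair_cycle n l) \<sigma> \<noteq> (0 :: 'k)" using assms by (simp add: in_keys_iff)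
  then have "paired ?xs \<or> hd ?xs = 1 \<and> last ?xs = n \<and> paired (butlast (tl ?xs))"
    unfolding lookup_pair_cycle[OF \<sigma>] by (rule contrapos_np) simp
  then consider "paired ?xs" | "hd ?xs = 1" "last ?xs = n" "paired (butlast (tl ?xs))" by blast
  then show ?thesis
  proof cases
    case 1
    then show ?thesis using len by (intro pairs) (simp add: paired_iff_nth el_def)
  next
    case 2
    show ?thesis
    proof (rule wrapped)
      show "el \<sigma> 0 = 1" using 2(1) ne by (simp add: el_def hd_conv_nth)
      show "el \<sigma> (2 * l + 1) = n" using 2(2) ne len by (simp add: el_def last_conv_nth)
      fix j assume "j < l"
      then have "butlast (tl ?xs) ! Suc (2 * j) = Suc (butlast (tl ?xs) ! (2 * j))"
        using 2(3) len unfolding paired_iff_nth by simp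
      then show "el \<sigma> (2 * j + 2) = el \<sigma> (2 * j + 1) + 1"
        using \<open>j < l\<close> len by (simp add: el_def nth_butlast nth_tl)
    qed
  qed
qed

text \<open>In a dense set the distance from one adjacent pair to the next is at most p + 1. So l +
  1 pairs reach around the circle only if n \<le> (p + 1) (l + 1).\<close>

lemma pair_cycle_in_cycles:
  assumes n: "(p + 1) * (l + 1) < n"
  shows "pair_cycle n l \<in> cycles (arc_complex n p) (2 * l + 1)"
proof -
  have "\<sigma> \<in> arc_complex n p" if key: "\<sigma> \<in> Poly_Mapping.keys (pair_cycle n l :: _ \<Rightarrow>\<^sub>0 'a)" for \<sigma>
  proof (rule ccontr)
    assume "\<sigma> \<notin> arc_complex n p"
    note \<sigma> = keys_pair_cycle[OF key]
    have ne: "\<sigma> \<noteq> {}" using \<sigma>(2) by auto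
    have D: "\<sigma> \<in> dense_sets n p" using \<open>\<sigma> \<notin> _\<close> \<sigma> ne by (simp add: dense_sets_def)
    have inner: "el \<sigma> (Suc i) \<le> el \<sigma> i + p" if "i < 2 * l + 1" for i
      using dense_inner[OF D, of i] that \<sigma>(2) by simp
    have outer: "el \<sigma> 0 + n \<le> el \<sigma> (2 * l + 1) + p"
      using dense_outer[OF D] \<sigma>(2) by simp
    show False
      using key
    proof (cases rule: keys_pair_cycle_cases)
      case pairs
      have "el \<sigma> (2 * l) \<le> el \<sigma> (2 * 0) + (p + 1) * l"
      proof (rule step_sum_upper[of l "\<lambda>j. el \<sigma> (2 * j)"])
        fix j assume "j < l"
        then show "el \<sigma> (2 * Suc j) \<le> el \<sigma> (2 * j) + (p + 1)"
          using inner[of "2 * j + 1"] pairs[of j] by simp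
      qed
      then show False using pairs[of l] outer n by (simp add: algebra_simps)
    next
      case wrapped
      have "el \<sigma> (2 * l + 1) \<le> el \<sigma> (2 * 0 + 1) + (p + 1) * l"
      proof (rule step_sum_upper[of l "\<lambda>j. el \<sigma> (2 * j + 1)"])
        fix j assume "j < l"
        then show "el \<sigma> (2 * Suc j + 1) \<le> el \<sigma> (2 * j + 1) + (p + 1)"
          using inner[of "2 * j + 2"] wrapped(3)[of j] by simp
      qed
      then show False using wrapped(1,2) inner[of 0] n by (simp add: algebra_simps)
    qed
  qed
  moreover have "card \<sigma> = Suc (2 * l + 1)" if "\<sigma> \<in> Poly_Mapping.keys (pair_cycle n l :: _ \<Rightarrow>\<^sub>0 'a)" for \<sigma>
    using keys_pair_cycle(2)[OF that] by simp
  ultimately show ?thesis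
    by (auto simp: cycles_def chains_def) (simp add: pair_cycle_def boundary_boundary)
qed

text \<open>On unions of pairs the winding pattern leaves no freedom: the pairs are spaced by
  exactly p + 1 and the last one ends at n - p. This single simplex has coefficient 1 in the
  cycle.\<close>

lemma pairing_winding_pair_cycle:
  assumes n: "(p + 1) * (l + 1) < n" "n < (p + 1) * (l + 2)"
  shows "pairing (winding n p l) (pair_cycle n l) = (1 :: 'k::field)"
proof -
  have p: "p \<ge> 1" using n by (cases p) auto
  \<comment> \<open>The start of the first pair, obtained by going back l + 1 steps of length p + 1
    from n.\<close>
  define f where "f = n - (p + 1) * (l + 1)"
  have f: "f \<ge> 1" "f + (p + 1) * l + p + 1 = n" using n by (auto simp: f_def algebra_simps)
  define g where "g i = f + (p + 1) * (i div 2) + i mod 2" for i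
  define \<sigma>0 where "\<sigma>0 = g ` {..<2 * l + 2}"
  have g_step: "g i < g (Suc i)" for i
  proof (cases "even i")
    case True
    then show ?thesis by (auto simp: g_def elim!: evenE)
  next
    case False
    then show ?thesis using p by (auto simp: g_def elim!: oddE)
  qed
  then have g_less: "g i < g j" if "i < j" for i j using that by (simp add: lift_Suc_mono_less)
  have card0: "card \<sigma>0 = 2 * l + 2" and el0: "el \<sigma>0 i = g i" if "i < 2 * l + 2" for i
    using el_unique[of "2 * l + 2" g \<sigma>0] g_less that by (auto simp: \<sigma>0_def)
  have card0: "card \<sigma>0 = 2 * l + 2" by (rule card0[of 0]) simp
  have g_last: "g (2 * l + 1) = n - p" using f by (simp add: g_def)
  have sub0: "\<sigma>0 \<subseteq> {1..n}"
  proof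
    fix x assume "x \<in> \<sigma>0"
    then obtain i where i: "i < 2 * l + 2" "x = g i" by (auto simp: \<sigma>0_def)
    have "g i \<le> g (2 * l + 1)" using g_less[of i "2 * l + 1"] i by (cases "i = 2 * l + 1") auto
    moreover have "1 \<le> g i" using f by (simp add: g_def)
    ultimately show "x \<in> {1..n}" using g_last i by simp
  qed
  have winding0: "winding n p l \<sigma>0 = (1 :: 'k)"
  proof -
    have "winding_pattern n p l g"
      unfolding winding_pattern_def
    proof (intro conjI allI impI)
      show "g (Suc i) \<le> g i + p" for i
      proof (cases "even i")
        case True
        then show ?thesis using p by (auto simp: g_def elim!: evenE)
      next
        case False
        then show ?thesis using p by (auto simp: g_def elim!: oddE)
      qed
      show "g (2 * j) + p < g (2 * j + 2)" for j by (simp add: g_def)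
      show "g (2 * l) + p < n" "n \<le> g (2 * l + 1) + p" using f by (simp_all add: g_def)
    qed
    then have "winding_pattern n p l (el \<sigma>0)" using winding_pattern_cong[of l "el \<sigma>0" g] el0 by blast
    then show ?thesis by (simp add: winding_def card0)
  qed
  have lookup0: "Poly_Mapping.lookup (pair_cycle n l) \<sigma>0 = (1 :: 'k)"
  proof -
    let ?xs = "sorted_list_of_set \<sigma>0"
    have "paired ?xs"
      unfolding paired_iff_nth
      using el0 by (auto simp: card0 el_def[symmetric] g_def)
    moreover have "last ?xs = g (2 * l + 1)"
    proof -
      have "?xs \<noteq> []" using card0 by (metis length_sorted_list_of_set list.size(3) add_is_0 zero_neq_numeral)
      then show ?thesis using el0[of "2 * l + 1"] by (simp add: last_conv_nth card0 el_def)
    qed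
    then have "last ?xs \<noteq> n" using g_last p f by simp
    ultimately show ?thesis by (simp add: lookup_pair_cycle[OF sub0 card0])
  qed
  have unique: "\<sigma> = \<sigma>0"
    if key: "\<sigma> \<in> Poly_Mapping.keys (pair_cycle n l :: _ \<Rightarrow>\<^sub>0 'k)" and w: "winding n p l \<sigma> \<noteq> (0 :: 'k)" for \<sigma>
  proof -
    note \<sigma> = keys_pair_cycle[OF key]
    have fin: "finite \<sigma>" using \<sigma>(1) finite_subset by blast
    have pat: "winding_pattern n p l (el \<sigma>)" using w by (auto simp: winding_def)
    then have inner: "el \<sigma> (Suc i) \<le> el \<sigma> i + p" if "i < 2 * l + 1" for i
      using that by (simp add: winding_pattern_def)
    have evens: "el \<sigma> (2 * j) + p < el \<sigma> (2 * j + 2)" if "j < l" for j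
      using pat that by (simp add: winding_pattern_def)
    have last: "el \<sigma> (2 * l) + p < n" "n \<le> el \<sigma> (2 * l + 1) + p"
      using pat by (simp_all add: winding_pattern_def)
    show ?thesis
      using key
    proof (cases rule: keys_pair_cycle_cases)
      case pairs
      \<comment> \<open>Successive entries at most p apart bound the distance of neighbouring pairs
        by p + 1 from above, and the long even steps bound it from below.\<close>
      have step: "el \<sigma> (2 * j + 2) = el \<sigma> (2 * j) + (p + 1)" if "j < l" for j
        using evens[OF that] inner[of "2 * j + 1"] pairs[of j] that by simp
      have "el \<sigma> (2 * j) = el \<sigma> 0 + (p + 1) * j" if "j \<le> l" for j
        using that
      proof (induction j)
        case (Suc j)
        then show ?case using step[of j] by (simp add: algebra_simps)
      qed simp
      note ev = this
      have "el \<sigma> (2 * l) + p + 1 = n" using last pairs[of l] by simp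
      then have "el \<sigma> 0 = f" using ev[of l] f by simp
      have "el \<sigma> i = g i" if "i < 2 * l + 2" for i
      proof (cases "even i")
        case True
        then obtain j where "i = 2 * j" by blast
        then show ?thesis using ev[of j] \<open>el \<sigma> 0 = f\<close> that by (simp add: g_def)
      next
        case False
        then obtain j where "i = 2 * j + 1" by (elim oddE)
        then show ?thesis using ev[of j] pairs[of j] \<open>el \<sigma> 0 = f\<close> that by (simp add: g_def)
      qed
      then have "el \<sigma> ` {..<2 * l + 2} = g ` {..<2 * l + 2}" by auto
      then show ?thesis using el_image[OF fin] \<sigma>(2) by (simp add: \<sigma>0_def)
    next
      case wrapped
      \<comment> \<open>A face using n and 1 as a pair has no gap across n, and the pattern excludes
        all other gaps, so it would be dense.\<close>
      have "\<sigma> \<in> arc_complex n p"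
        using pair_cycle_in_cycles[OF n(1), where ?'a = 'k] key by (auto simp: cycles_def chains_def)
      then show ?thesis
      proof (cases rule: arc_complex_gap)
        case (1 i)
        then show ?thesis using inner[of i] \<sigma>(2) by simp
      next
        case 2
        then show ?thesis using wrapped p \<sigma>(2) by simp
      qed
    qed
  qed
  have "pairing (winding n p l) (pair_cycle n l) =
      (\<Sum>\<sigma>\<in>Poly_Mapping.keys (pair_cycle n l :: _ \<Rightarrow>\<^sub>0 'k). if \<sigma> = \<sigma>0 then 1 else (0 :: 'k))"
    unfolding pairing_def
  proof (rule sum.cong)
    fix \<sigma> assume key: "\<sigma> \<in> Poly_Mapping.keys (pair_cycle n l :: _ \<Rightarrow>\<^sub>0 'k)"
    show "Poly_Mapping.lookup (pair_cycle n l) \<sigma> * winding n p l \<sigma> = (if \<sigma> = \<sigma>0 then 1 else (0 :: 'k))"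
    proof (cases "\<sigma> = \<sigma>0")
      case False
      then have "winding n p l \<sigma> = (0 :: 'k)" using unique[OF key] by blast
      then show ?thesis using False by simp
    qed (simp add: winding0 lookup0)
  qed simp
  also have "\<dots> = 1" using lookup0 by (simp add: in_keys_iff)
  finally show ?thesis .
qed

lemma pair_cycle_not_boundary:
  assumes n: "(p + 1) * (l + 1) < n" "n < (p + 1) * (l + 2)"
  shows "pair_cycle n l \<notin> (boundaries (arc_complex n p) (2 * l + 1) :: (_ \<Rightarrow>\<^sub>0 'k::field) set)"
proof
  assume "(pair_cycle n l :: _ \<Rightarrow>\<^sub>0 'k) \<in> boundaries (arc_complex n p) (2 * l + 1)"
  then obtain e :: "nat set \<Rightarrow>\<^sub>0 'k" where e: "e \<in> chains (arc_complex n p) (Suc (2 * l + 1))"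
    and z: "pair_cycle n l = boundary e" by (auto simp: boundaries_def)
  have "pairing (winding n p l) (boundary e) = (0 :: 'k)"
    unfolding pairing_boundary pairing_def[of _ e]
    by (rule sum.neutral) (use e winding_cocycle[OF _ n(2)] in \<open>auto simp: chains_def\<close>)
  then show False using pairing_winding_pair_cycle[OF n, where ?'k = 'k] by (simp add: z)
qed

section \<open>Odd homology of the arc complex\<close>

lemma in_chains_of_no_dense:
  assumes "Poly_Mapping.keys d \<subseteq> simplices {1..n} (Suc k)" "Poly_Mapping.keys d \<inter> dense_sets n p = {}"
  shows "d \<in> chains (arc_complex n p) k"
  using assms by (fastforce simp: chains_def simplices_def dense_sets_def)

text \<open>Coning from vertex 1 fills c in the full simplex. Subtracting a boundary to clear the
  lower sets does not affect what the filling bounds.\<close>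

lemma cycle_filling:
  fixes c :: "nat set \<Rightarrow>\<^sub>0 'k::field"
  assumes c: "c \<in> cycles (arc_complex n p) (2 * l + 1)"
  obtains d where "Poly_Mapping.keys d \<subseteq> simplices {1..n} (2 * l + 3)" "boundary d = c"
    and "Poly_Mapping.keys d \<inter> lower_sets n p = {}"
proof -
  have keys: "\<sigma> \<subseteq> {1..n}" "card \<sigma> = 2 * l + 2" "finite \<sigma>" if "\<sigma> \<in> Poly_Mapping.keys c" for \<sigma>
    using c that arc_complex_finite[of \<sigma> n p] by (auto simp: cycles_def chains_def arc_complex_def)
  define d0 where "d0 = extend_linearly (cone 1) c"
  have d0: "boundary d0 = c"
    unfolding d0_def
  proof (rule cycle_bounds_cone)
    show "boundary c = 0" using c by (simp add: cycles_def)
    show "\<forall>\<sigma>\<in>Poly_Mapping.keys c. 2 \<le> card \<sigma> \<and> (\<forall>v\<in>\<sigma>. 1 \<le> v)"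
      using keys by fastforce
  qed
  have "Poly_Mapping.keys d0 \<subseteq> simplices {1..n} (2 * l + 3)"
  proof
    fix \<tau> assume "\<tau> \<in> Poly_Mapping.keys d0"
    then have "pairing (\<lambda>\<sigma>. Poly_Mapping.lookup (cone 1 \<sigma> :: _ \<Rightarrow>\<^sub>0 'k) \<tau>) c \<noteq> 0"
      by (simp add: d0_def in_keys_iff lookup_extend)
    then obtain \<sigma> where \<sigma>: "\<sigma> \<in> Poly_Mapping.keys c"
      and "Poly_Mapping.lookup c \<sigma> * Poly_Mapping.lookup (cone 1 \<sigma> :: _ \<Rightarrow>\<^sub>0 'k) \<tau> \<noteq> 0"
      unfolding pairing_def by (rule sum.not_neutral_contains_not_neutral)
    then have "1 \<notin> \<sigma>" "\<tau> = insert 1 \<sigma>"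
      by (auto simp: cone_def lookup_single when_def split: if_splits)
    moreover have "1 \<le> n" using keys[OF \<sigma>] by (cases "n = 0") auto
    ultimately show "\<tau> \<in> simplices {1..n} (2 * l + 3)"
      using keys[OF \<sigma>] by (auto simp: simplices_def)
  qed
  then obtain e where e: "Poly_Mapping.keys e \<subseteq> simplices {1..n} (Suc (2 * l + 3))"
    "Poly_Mapping.keys (d0 - boundary e) \<inter> lower_sets n p = {}"
    by (rule arc_matching.eliminate_lower)
  have "Poly_Mapping.keys (d0 - boundary e) \<subseteq> simplices {1..n} (2 * l + 3)"
  proof
    fix \<rho> assume "\<rho> \<in> Poly_Mapping.keys (d0 - boundary e)"
    then have "\<rho> \<in> Poly_Mapping.keys d0 \<or> \<rho> \<in> Poly_Mapping.keys (boundary e)"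
      using keys_diff[of d0 "boundary e"] by auto
    then show "\<rho> \<in> simplices {1..n} (2 * l + 3)"
    proof
      assume "\<rho> \<in> Poly_Mapping.keys (boundary e)"
      then obtain \<sigma> v where "\<sigma> \<in> Poly_Mapping.keys e" "v \<in> \<sigma>" "\<rho> = \<sigma> - {v}" by (rule keys_boundary)
      then show ?thesis using e(1) by (auto simp: simplices_def card_Diff_singleton)
    qed (use \<open>Poly_Mapping.keys d0 \<subseteq> _\<close> in blast)
  qed
  moreover have "boundary (d0 - boundary e) = c" by (simp add: boundary_linear boundary_boundary d0)
  ultimately show ?thesis using that e(2) by blast
qed

text \<open>Without lower and critical sets, the dense sets in d are all upper sets of the matching,
  and those are ruled out because the boundary of d avoids dense sets. So d itself is a chain of the
  complex.\<close>

lemma filling_bounds: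
  fixes d :: "nat set \<Rightarrow>\<^sub>0 'k::field"
  assumes d: "Poly_Mapping.keys d \<subseteq> simplices {1..n} (2 * l + 3)"
    and lower: "Poly_Mapping.keys d \<inter> lower_sets n p = {}"
    and crit: "\<forall>S\<in>Poly_Mapping.keys d. \<not> critical n p S"
    and cyc: "boundary d \<in> cycles (arc_complex n p) (2 * l + 1)"
  shows "boundary d \<in> boundaries (arc_complex n p) (2 * l + 1)"
proof -
  have "Poly_Mapping.keys d \<inter> dense_sets n p = {}"
  proof (rule arc_matching.eliminate_upper)
    show "\<forall>S\<in>Poly_Mapping.keys d. S \<subseteq> {1..n}" using d by (auto simp: simplices_def)
    show "Poly_Mapping.keys (boundary d) \<inter> dense_sets n p = {}"
      using cyc by (auto simp: cycles_def chains_def dense_sets_def)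
    show "\<forall>S\<in>Poly_Mapping.keys d \<inter> dense_sets n p. \<exists>S0\<in>lower_sets n p. S = insert (partner n p S0) S0"
      using dense_trichotomy[of _ n p] lower crit by blast
  qed
  then have "d \<in> chains (arc_complex n p) (Suc (2 * l + 1))"
    using d by (intro in_chains_of_no_dense) (simp_all add: numeral_3_eq_3)
  then show ?thesis by (simp add: boundaries_def)
qed

lemma odd_cycles_bound:
  assumes "\<not> ((p + 1) * (l + 1) < n \<and> n < (p + 1) * (l + 2))"
  shows "(cycles (arc_complex n p) (2 * l + 1) :: (_ \<Rightarrow>\<^sub>0 'k::field) set) \<subseteq> boundaries (arc_complex n p) (2 * l + 1)"
proof
  fix c :: "nat set \<Rightarrow>\<^sub>0 'k" assume c: "c \<in> cycles (arc_complex n p) (2 * l + 1)"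
  then obtain d where d: "Poly_Mapping.keys d \<subseteq> simplices {1..n} (2 * l + 3)" "boundary d = c"
    "Poly_Mapping.keys d \<inter> lower_sets n p = {}" by (rule cycle_filling)
  have "\<not> critical n p S" if "S \<in> Poly_Mapping.keys d" for S
    using critical_range[of n p S l] d(1) that assms by (auto simp: simplices_def)
  then show "c \<in> boundaries (arc_complex n p) (2 * l + 1)"
    using filling_bounds[OF d(1,3)] c by (simp add: d(2))
qed

text \<open>A filling of the pair cycle must contain the only critical set, since otherwise the pair
  cycle would bound. A suitable multiple of it therefore removes this set from the filling of
  c.\<close>

lemma odd_cycles_spanned:
  fixes c :: "nat set \<Rightarrow>\<^sub>0 'k::field"
  assumes n: "(p + 1) * (l + 1) < n" "n < (p + 1) * (l + 2)"
    and c: "c \<in> cycles (arc_complex n p) (2 * l + 1)"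
  shows "\<exists>r. c - chain_scale r (pair_cycle n l) \<in> boundaries (arc_complex n p) (2 * l + 1)"
proof -
  let ?z = "pair_cycle n l :: nat set \<Rightarrow>\<^sub>0 'k"
  have z: "?z \<in> cycles (arc_complex n p) (2 * l + 1)" by (rule pair_cycle_in_cycles[OF n(1)])
  obtain d where d: "Poly_Mapping.keys d \<subseteq> simplices {1..n} (2 * l + 3)" "boundary d = c"
    "Poly_Mapping.keys d \<inter> lower_sets n p = {}" using c by (rule cycle_filling)
  obtain e where e: "Poly_Mapping.keys e \<subseteq> simplices {1..n} (2 * l + 3)" "boundary e = ?z"
    "Poly_Mapping.keys e \<inter> lower_sets n p = {}" using z by (rule cycle_filling)
  have "\<exists>S\<in>Poly_Mapping.keys e. critical n p S"
  proof (rule ccontr)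
    assume "\<not> ?thesis"
    then have "?z \<in> boundaries (arc_complex n p) (2 * l + 1)"
      using filling_bounds[OF e(1,3)] z by (simp add: e(2))
    then show False using pair_cycle_not_boundary[OF n] by blast
  qed
  then obtain S where S: "S \<in> Poly_Mapping.keys e" "critical n p S" by blast
  then have card_S: "card S = 2 * l + 3" using e(1) by (auto simp: simplices_def)
  define r where "r = Poly_Mapping.lookup d S / Poly_Mapping.lookup e S"
  define f where "f = d - chain_scale r e"
  have keys_f: "Poly_Mapping.keys f \<subseteq> Poly_Mapping.keys d \<union> Poly_Mapping.keys e"
    unfolding f_def using keys_diff[of d "chain_scale r e"] keys_chain_scale[of r e] by blast
  have fS: "Poly_Mapping.lookup f S = 0"
    using S(1) by (simp add: f_def lookup_minus r_def in_keys_iff)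
  have "boundary f = c - chain_scale r ?z" by (simp add: f_def boundary_linear d(2) e(2))
  moreover have "boundary f \<in> boundaries (arc_complex n p) (2 * l + 1)"
  proof (rule filling_bounds)
    show "Poly_Mapping.keys f \<subseteq> simplices {1..n} (2 * l + 3)" using keys_f d(1) e(1) by blast
    show "Poly_Mapping.keys f \<inter> lower_sets n p = {}" using keys_f d(3) e(3) by blast
    show "\<forall>T\<in>Poly_Mapping.keys f. \<not> critical n p T"
    proof (rule ballI, rule notI)
      fix T assume T: "T \<in> Poly_Mapping.keys f" "critical n p T"
      then have "card T = 2 * l + 3" using keys_f d(1) e(1) by (auto simp: simplices_def)
      then have "T = S" using critical_unique[OF T(2) _ S(2) card_S] by blast
      then show False using T(1) fS by (simp add: in_keys_iff)
    qed
    show "boundary f \<in> cycles (arc_complex n p) (2 * l + 1)"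
      using calculation cycles_linear(3)[OF c cycles_linear(4)[OF z]] by simp
  qed
  ultimately show ?thesis by metis
qed

section \<open>The Dowker filtration of the cycle network\<close>

lemma dowker_sink_cycle_neg:
  assumes "\<delta> < 0"
  shows "dowker_sink (cycle_nodes n) (cycle_weight n) \<delta> = {}"
proof -
  have "cycle_weight n x y > \<delta>" for x y using assms by (simp add: cycle_weight_def less_le_trans)
  then have "\<not> cycle_weight n x y \<le> \<delta>" for x y by (simp only: not_le)
  then show ?thesis unfolding dowker_sink_def by auto
qed

text \<open>With a as the sink, the admissible y are a and its \<lfloor>\<delta>\<rfloor> cyclic
  predecessors; the other n - 1 - \<lfloor>\<delta>\<rfloor> vertices are those right after
  a.\<close>

lemma dowker_sink_cycle:
  assumes n: "n \<ge> 1" and \<delta>: "\<delta> \<ge> 0"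
  shows "dowker_sink (cycle_nodes n) (cycle_weight n) \<delta> = arc_complex n (n - 1 - nat \<lfloor>\<delta>\<rfloor>)"
proof -
  define m where "m = nat \<lfloor>\<delta>\<rfloor>"
  have m: "\<lfloor>\<delta>\<rfloor> = int m" using \<delta> by (simp add: m_def)
  let ?p = "n - 1 - m"
  have key: "cycle_weight n y a \<le> \<delta> \<longleftrightarrow> y \<le> a \<and> a + ?p < y + n \<or> a + ?p < y"
    if y: "y \<in> {1..n}" and a: "a \<in> {1..n}" for y a
  proof -
    have "cycle_weight n y a = real_of_int ((int a - int y) mod int n)"
      by (rule cycle_weight_eq) (use y a in \<open>auto simp: cycle_nodes_def\<close>)
    then have "cycle_weight n y a \<le> \<delta> \<longleftrightarrow> (int a - int y) mod int n \<le> \<lfloor>\<delta>\<rfloor>"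
      by (simp add: le_floor_iff)
    also have "(int a - int y) mod int n = (if y \<le> a then int a - int y else int a - int y + int n)"
    proof (cases "y \<le> a")
      case True
      then show ?thesis using y a by (simp add: mod_pos_pos_trivial)
    next
      case False
      have "(int a - int y + int n) mod int n = int a - int y + int n"
        using False y a by (intro mod_pos_pos_trivial) auto
      then show ?thesis using False by simp
    qed
    also have "\<dots> \<le> \<lfloor>\<delta>\<rfloor> \<longleftrightarrow> y \<le> a \<and> a + ?p < y + n \<or> a + ?p < y"
    proof -
      have range: "1 \<le> y" "y \<le> n" "1 \<le> a" "a \<le> n" using y a by auto
      show ?thesis
      proof (cases "m < n")
        case True
        define q where "q = n - 1 - m"
        have q: "n = m + 1 + q" using True by (simp add: q_def)
        show ?thesis
          unfolding m q_def[symmetric] using range q by (cases "y \<le> a") auto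
      next
        \<comment> \<open>Here the subtraction truncates to p = 0, no vertex is missing, and both
          sides hold.\<close>
        case False
        then show ?thesis unfolding m using range by (cases "y \<le> a") auto
      qed
    qed
    finally show ?thesis .
  qed
  show ?thesis
    unfolding dowker_sink_def arc_complex_def cycle_nodes_def m_def[symmetric]
    by (intro Collect_cong conj_cong refl bex_cong ball_cong) (use key in blast)
qed

lemma dowker_sink_mono: "\<delta> \<le> \<epsilon> \<Longrightarrow> dowker_sink X \<omega> \<delta> \<subseteq> dowker_sink X \<omega> \<epsilon>"
  unfolding dowker_sink_def by (blast intro: order_trans)

text \<open>With q = n - m, both descriptions reduce to q l < m < q (l + 1).\<close>

lemma M_set_iff:
  assumes "n \<ge> 1"
  shows "m \<in> M_set n l \<longleftrightarrow> (n - 1 - m + 1) * (l + 1) < n \<and> n < (n - 1 - m + 1) * (l + 2)"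
proof -
  have "real (n * l) / real (l + 1) < real m \<longleftrightarrow> real (n * l) < real (m * (l + 1))"
    by (simp add: divide_less_eq algebra_simps)
  moreover have "real m < real (n * (l + 1)) / real (l + 2) \<longleftrightarrow> real (m * (l + 2)) < real (n * (l + 1))"
    by (simp add: less_divide_eq algebra_simps)
  ultimately have M: "m \<in> M_set n l \<longleftrightarrow> 1 \<le> m \<and> n * l < m * (l + 1) \<and> m * (l + 2) < n * (l + 1)"
    unfolding M_set_def by (simp only: mem_Collect_eq of_nat_less_iff)
  show ?thesis
  proof (cases "m < n")
    case True
    define q where "q = n - m"
    have q: "n = m + q" "q \<ge> 1" using True by (auto simp: q_def)
    then have "n - 1 - m + 1 = q" by simp
    moreover have "n * l < m * (l + 1) \<longleftrightarrow> q * l < m" by (simp add: q(1) algebra_simps)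
    moreover have "q * (l + 1) < n \<longleftrightarrow> q * l < m" by (simp add: q(1) algebra_simps)
    moreover have "m * (l + 2) < n * (l + 1) \<longleftrightarrow> m < q * (l + 1)" by (simp add: q(1) algebra_simps)
    moreover have "n < q * (l + 2) \<longleftrightarrow> m < q * (l + 1)" by (simp add: q(1) algebra_simps)
    ultimately show ?thesis unfolding M by auto
  next
    case False
    \<comment> \<open>For m \<ge> n truncation gives q = 1, which would require l + 1 < n < l + 2;
      the bounds on m fail as well.\<close>
    then have "n * (l + 1) \<le> m * (l + 1)" by (intro mult_le_mono1) simp
    moreover have "n - 1 - m + 1 = 1" using False by simp
    ultimately show ?thesis unfolding M by (auto simp: algebra_simps)
  qed
qed

lemma cycles_empty: "cycles {} k \<subseteq> boundaries L k"
proof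
  fix c :: "'a set \<Rightarrow>\<^sub>0 'b" assume "c \<in> cycles {} k"
  then have "Poly_Mapping.keys c = {}" by (auto simp: cycles_def chains_def)
  then have "c = 0" by simp
  then show "c \<in> boundaries L k" using boundaries_linear(1) by simp
qed

lemma dowker_cycles_bound:
  assumes "n \<ge> 1" and "\<not> (\<delta> \<ge> 0 \<and> nat \<lfloor>\<delta>\<rfloor> \<in> M_set n l)"
  shows "(cycles (dowker_sink (cycle_nodes n) (cycle_weight n) \<delta>) (2 * l + 1) :: (_ \<Rightarrow>\<^sub>0 'k::field) set)
    \<subseteq> boundaries (dowker_sink (cycle_nodes n) (cycle_weight n) \<delta>) (2 * l + 1)"
proof (cases "\<delta> < 0")
  case True
  then show ?thesis by (simp only: dowker_sink_cycle_neg cycles_empty)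
next
  case False
  then have \<delta>: "\<delta> \<ge> 0" by simp
  then show ?thesis
    unfolding dowker_sink_cycle[OF assms(1) \<delta>] using assms(2) M_set_iff[OF assms(1)]
    by (intro odd_cycles_bound) blast
qed

text \<open>The set is a run of consecutive integers, since its lower bound is inherited by
  everything above the minimum. The ceiling appears because \<lfloor>\<delta>\<rfloor> < x is
  equivalent to \<delta> < \<lceil>x\<rceil>.\<close>

lemma covers_iff_M_set:
  assumes n: "n \<ge> 1" and ne: "M_set n l \<noteq> {}"
  shows "covers (real (Min (M_set n l)), ereal (real_of_int \<lceil>real (n * (l + 1)) / real (l + 2)\<rceil>)) \<delta>
    \<longleftrightarrow> \<delta> \<ge> 0 \<and> nat \<lfloor>\<delta>\<rfloor> \<in> M_set n l"
proof -
  let ?x = "real (n * (l + 1)) / real (l + 2)" and ?a = "Min (M_set n l)"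
  have "m < n" if "m \<in> M_set n l" for m
    using that unfolding M_set_iff[OF n] by (cases "m < n") auto
  then have "M_set n l \<subseteq> {..<n}" by blast
  then have fin: "finite (M_set n l)" using finite_lessThan by (rule finite_subset)
  then have a: "?a \<in> M_set n l" using ne by (rule Min_in)
  have "real ?a \<le> \<delta> \<and> \<delta> < real_of_int \<lceil>?x\<rceil> \<longleftrightarrow> \<delta> \<ge> 0 \<and> nat \<lfloor>\<delta>\<rfloor> \<in> M_set n l"
  proof
    assume *: "real ?a \<le> \<delta> \<and> \<delta> < real_of_int \<lceil>?x\<rceil>"
    then have \<delta>: "\<delta> \<ge> 0" by (meson of_nat_0_le_iff order_trans)
    have "int ?a \<le> \<lfloor>\<delta>\<rfloor>" using * by (simp add: le_floor_iff)
    then have "?a \<le> nat \<lfloor>\<delta>\<rfloor>" by linarith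
    moreover have "\<lfloor>\<delta>\<rfloor> < \<lceil>?x\<rceil>" using * by (simp only: floor_less_iff)
    then have "real_of_int \<lfloor>\<delta>\<rfloor> < ?x" by (simp only: less_ceiling_iff)
    then have "real (nat \<lfloor>\<delta>\<rfloor>) < ?x" using \<delta> by simp
    ultimately show "\<delta> \<ge> 0 \<and> nat \<lfloor>\<delta>\<rfloor> \<in> M_set n l"
      using a \<delta> unfolding M_set_def by (auto intro: less_le_trans)
  next
    assume *: "\<delta> \<ge> 0 \<and> nat \<lfloor>\<delta>\<rfloor> \<in> M_set n l"
    then have "?a \<le> nat \<lfloor>\<delta>\<rfloor>" using fin by simp
    then have "int ?a \<le> \<lfloor>\<delta>\<rfloor>" using * by linarith
    then have "real ?a \<le> \<delta>" by (simp add: le_floor_iff)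
    moreover have "real (nat \<lfloor>\<delta>\<rfloor>) < ?x" using * unfolding M_set_def by blast
    then have "real_of_int \<lfloor>\<delta>\<rfloor> < ?x" using * by simp
    then have "\<lfloor>\<delta>\<rfloor> < \<lceil>?x\<rceil>" by (simp only: less_ceiling_iff)
    then have "\<delta> < real_of_int \<lceil>?x\<rceil>" by (simp only: floor_less_iff)
    ultimately show "real ?a \<le> \<delta> \<and> \<delta> < real_of_int \<lceil>?x\<rceil>" by blast
  qed
  then show ?thesis by (simp only: covers_def fst_conv snd_conv less_ereal.simps(1))
qed

theorem theorem38:
  fixes n l :: nat
  assumes "n \<ge> 3"
  shows "dowker_diagram TYPE('k::field) (2 * l + 1) (cycle_nodes n) (cycle_weight n) =
    (if M_set n l = {} then {#}
     else {# (real (Min (M_set n l)),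
              ereal (real_of_int \<lceil>real (n * (l + 1)) / real (l + 2)\<rceil>)) #})"
proof -
  let ?F = "dowker_sink (cycle_nodes n) (cycle_weight n)"
  let ?V = "persistent_homology ?F (2 * l + 1) :: ('k, (nat set \<Rightarrow>\<^sub>0 'k) set) persistence_space"
  have n: "n \<ge> 1" using assms by simp
  have diagram: "dowker_diagram TYPE('k) (2 * l + 1) (cycle_nodes n) (cycle_weight n) = persistence_diagram ?V"
    by (simp add: dowker_diagram_def dowker_persistence_def)
  show ?thesis
  proof (cases "M_set n l = {}")
    case True
    have bound: "(cycles (?F t) (2 * l + 1) :: (_ \<Rightarrow>\<^sub>0 'k) set) \<subseteq> boundaries (?F t) (2 * l + 1)" for t
      using True by (intro dowker_cycles_bound[OF n]) simp
    have "persistence_diagram ?V = {#}"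
      unfolding persistence_diagram_def
      using has_diagram_empty(1)[of ?F, OF bound] diagram_empty_unique[OF _ has_diagram_empty(2)[of ?F, OF bound]]
      by (rule the_equality)
    then show ?thesis using True unfolding diagram by simp
  next
    case False
    define a where "a = real (Min (M_set n l))"
    define b where "b = ereal (real_of_int \<lceil>real (n * (l + 1)) / real (l + 2)\<rceil>)"
    have cov: "covers (a, b) t \<longleftrightarrow> t \<ge> 0 \<and> nat \<lfloor>t\<rfloor> \<in> M_set n l" for t
      unfolding a_def b_def by (rule covers_iff_M_set[OF n False])
    obtain m where "m \<in> M_set n l" using False by blast
    then have "covers (a, b) (real m)" unfolding cov by simp
    then have ab: "ereal a < b" unfolding covers_def by (auto intro: le_less_trans[of _ "ereal (real m)"])
    have range: "(n - 1 - nat \<lfloor>t\<rfloor> + 1) * (l + 1) < n" "n < (n - 1 - nat \<lfloor>t\<rfloor> + 1) * (l + 2)"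
      and F: "?F t = arc_complex n (n - 1 - nat \<lfloor>t\<rfloor>)" if "covers (a, b) t" for t
      using that dowker_sink_cycle[OF n, of t] unfolding cov M_set_iff[OF n] by blast+
    have has: "has_persistence_diagram ?V {#(a, b)#}"
    proof (rule has_diagram_singleton[OF ab])
      show "?F s \<subseteq> ?F t" if "s \<le> t" for s t using that by (rule dowker_sink_mono)
      fix t
      show "pair_cycle n l \<in> cycles (?F t) (2 * l + 1)" if "covers (a, b) t"
        unfolding F[OF that] by (rule pair_cycle_in_cycles[OF range(1)[OF that]])
      show "pair_cycle n l \<notin> (boundaries (?F t) (2 * l + 1) :: (_ \<Rightarrow>\<^sub>0 'k) set)" if "covers (a, b) t"
        unfolding F[OF that] by (rule pair_cycle_not_boundary[OF range[OF that]])
      show "\<exists>r. c - chain_scale r (pair_cycle n l) \<in> boundaries (?F t) (2 * l + 1)"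
        if "covers (a, b) t" "c \<in> cycles (?F t) (2 * l + 1)" for c :: "nat set \<Rightarrow>\<^sub>0 'k"
        using that(2) unfolding F[OF that(1)] by (rule odd_cycles_spanned[OF range[OF that(1)]])
      show "(cycles (?F t) (2 * l + 1) :: (_ \<Rightarrow>\<^sub>0 'k) set) \<subseteq> boundaries (?F t) (2 * l + 1)"
        if "\<not> covers (a, b) t"
        using that unfolding cov by (rule dowker_cycles_bound[OF n])
    qed
    have "closed_persistence ?V" by (rule closed_persistent_homology) (rule dowker_sink_mono)
    then have "persistence_diagram ?V = {#(a, b)#}"
      unfolding persistence_diagram_def using has diagram_singleton_unique has by (intro the_equality) blast+
    then show ?thesis using False unfolding diagram a_def b_def by simp
  qed
qed

end
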